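(* If $X$ is a Hopf surface of type $\mathrm{IV}$ or of type $\mathrm{III}$, then $(X,\Lambda_0=0)$ is obstructed in Poisson deformations.
   Context: Let $W=\mathbb{C}^2\setminus\{(0,0)\}$ with coordinates $(z,w)$. A Hopf surface of type $\mathrm{IV}$ is $X=W/\langle f\rangle$ with $f(z,w)=(\alpha z,\alpha w)$, $0<|\alpha|<1$. A Hopf surface of type $\mathrm{III}$ is $X=W/\langle f\rangle$ with $f(z,w)=(\delta^pz,\delta w)$, $p\in\mathbb{N}$, $p\ge2$, $0<|\delta|<1$. A holomorphic Poisson manifold $(M,\Lambda_0)$ is a complex manifold $M$ with $\Lambda_0\in H^0(M,\wedge^2\Theta_M)$ satisfying $[\Lambda_0,\Lambda_0]=0$; $\Theta_M$ is the sheaf of germs of holomorphic vector fields and $[-,-]$ is the Schouten bracket (so that $[\Lambda,X]=-\mathcal{L}_X\Lambda$ for a bivector field $\Lambda$ and a vector field $X$). $\mathbb{H}^i(M,\Theta_M^\bullet)$ is the hypercohomology of the complex $\Theta_M\to\wedge^2\Theta_M\to\cdots\to\wedge^n\Theta_M\to0$ with differential $[\Lambda_0,-]$ and $\Theta_M$ in degree $0$. A Poisson analytic family $(\mathcal{M},\Lambda,B,\omega)$ over a domain $B\subset\mathbb{C}^m$ is a holomorphic Poisson manifold $(\mathcal{M},\Lambda)$ with a holomorphic map $\omega:\mathcal{M}\to B$ such that each $\omega^{-1}(t)$ is a compact holomorphic Poisson submanifold, $(M_t,\Lambda_t)=\omega^{-1}(t)$ carries the induced Poisson structure, and the Jacobian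 of $\omega$ has rank $m$ everywhere. Locally $\mathcal{M}$ has coordinates $(z_j,t)$ with $\omega(z_j,t)=t$, transition functions $z_j^\alpha=f^\alpha_{jk}(z_k,t)$ and $\Lambda=\sum g^j_{\alpha\beta}(z_j,t)\frac{\partial}{\partial z_j^\alpha}\wedge\frac{\partial}{\partial z_j^\beta}$, $g^j_{\alpha\beta}=-g^j_{\beta\alpha}$. The Poisson Kodaira-Spencer map at $0\in B$, $\varphi_0:T_0B\to\mathbb{H}^1(M_0,\Theta_{M_0}^\bullet)$, sends $\frac{\partial}{\partial t}$ to the class of the Cech $1$-cocycle $\left(\left\{\sum_\alpha\frac{\partial f^\alpha_{jk}}{\partial t}\big|_{t=0}\frac{\partial}{\partial z_j^\alpha}\right\},\left\{\sum_{\alpha,\beta}\frac{\partial g^j_{\alpha\beta}}{\partial t}\big|_{t=0}\frac{\partial}{\partial z_j^\alpha}\wedge\frac{\partial}{\partial z_j^\beta}\right\}\right)$. A compact holomorphic Poisson manifold $(M,\Lambda_0)$ is unobstructed in Poisson deformations if there is a Poisson analytic family with $\omega^{-1}(0)=(M,\Lambda_0)$, $0\in B$, whose Poisson Kodaira-Spencer map at $0$ is an isomorphism; otherwise it is obstructed. *)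

theory Defs
  imports "HOL-Analysis.Analysis"
begin

text \<open>The space of \<open>n\<close>-tuples of complex numbers is realised as the set of all
  \<open>x :: nat \<Rightarrow> complex\<close> that vanish from index \<open>n\<close> on, with the topology induced from the product
  topology. In this way the dimension is an ordinary natural number that can be quantified over;
  coordinates are numbered from \<open>0\<close>.\<close>

definition cvec :: "nat \<Rightarrow> (nat \<Rightarrow> complex) set" where
  "cvec n = {x. \<forall>i\<ge>n. x i = 0}"

definition cspace :: "nat \<Rightarrow> (nat \<Rightarrow> complex) topology" where
  "cspace n = subtopology euclidean (cvec n)"

text \<open>Holomorphic functions on an open subset \<open>V\<close> of \<open>cspace n\<close>: continuous, and holomorphic in
  each of the variables separately.\<close>

definition hol_on :: "nat \<Rightarrow> (nat \<Rightarrow> complex) set \<Rightarrow> ((nat \<Rightarrow> complex) \<Rightarrow> complex) \<Rightarrow> bool" where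
  "hol_on n V f \<longleftrightarrow> continuous_on V f \<and>
     (\<forall>x\<in>V. \<forall>i<n. (\<lambda>s. f (x(i := s))) field_differentiable (at (x i)))"

type_synonym 'a chart = "'a set \<times> ('a \<Rightarrow> nat \<Rightarrow> complex)"

record 'a cmanifold =
  mdim :: nat
  mtop :: "'a topology"
  matlas :: "'a chart set"

abbreviation points :: "'a cmanifold \<Rightarrow> 'a set" where
  "points M \<equiv> topspace (mtop M)"

definition chart_inv :: "'a chart \<Rightarrow> (nat \<Rightarrow> complex) \<Rightarrow> 'a" where
  "chart_inv c = inv_into (fst c) (snd c)"

definition is_chart :: "nat \<Rightarrow> 'a topology \<Rightarrow> 'a chart \<Rightarrow> bool" where
  "is_chart n T c \<longleftrightarrow> openin T (fst c) \<and> openin (cspace n) (snd c ` fst c) \<and>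
     homeomorphic_map (subtopology T (fst c)) (subtopology (cspace n) (snd c ` fst c)) (snd c)"

definition hol_transition :: "nat \<Rightarrow> 'a chart \<Rightarrow> 'a chart \<Rightarrow> bool" where
  "hol_transition n c d \<longleftrightarrow>
     (\<forall>a<n. hol_on n (snd c ` (fst c \<inter> fst d)) (\<lambda>x. snd d (chart_inv c x) a))"

definition compatible :: "nat \<Rightarrow> 'a chart \<Rightarrow> 'a chart \<Rightarrow> bool" where
  "compatible n c d \<longleftrightarrow> hol_transition n c d \<and> hol_transition n d c"

definition complex_manifold :: "'a cmanifold \<Rightarrow> bool" where
  "complex_manifold M \<longleftrightarrow>
     Hausdorff_space (mtop M) \<and> second_countable (mtop M) \<and>
     (\<Union>c\<in>matlas M. fst c) = points M \<and>
     (\<forall>c\<in>matlas M. is_chart (mdim M) (mtop M) c) \<and>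
     (\<forall>c\<in>matlas M. \<forall>d\<in>matlas M. compatible (mdim M) c d)"

definition max_atlas :: "'a cmanifold \<Rightarrow> 'a chart set" where
  "max_atlas M = {c. is_chart (mdim M) (mtop M) c \<and> (\<forall>d\<in>matlas M. compatible (mdim M) c d)}"

definition hol_fun :: "'a cmanifold \<Rightarrow> 'a set \<Rightarrow> ('a \<Rightarrow> complex) \<Rightarrow> bool" where
  "hol_fun M U f \<longleftrightarrow>
     (\<forall>c\<in>max_atlas M. hol_on (mdim M) (snd c ` (U \<inter> fst c)) (\<lambda>x. f (chart_inv c x)))"

definition hol_map :: "'a cmanifold \<Rightarrow> 'b cmanifold \<Rightarrow> ('a \<Rightarrow> 'b) \<Rightarrow> bool" where
  "hol_map M N f \<longleftrightarrow> continuous_map (mtop M) (mtop N) f \<and>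
     (\<forall>d\<in>max_atlas N. \<forall>a<mdim N.
        hol_fun M {p \<in> points M. f p \<in> fst d} (\<lambda>p. snd d (f p) a))"

definition biholomorphic_map :: "'a cmanifold \<Rightarrow> 'b cmanifold \<Rightarrow> ('a \<Rightarrow> 'b) \<Rightarrow> bool" where
  "biholomorphic_map M N f \<longleftrightarrow> bij_betw f (points M) (points N) \<and>
     hol_map M N f \<and> hol_map N M (inv_into (points M) f)"

text \<open>\<open>pd c i f p\<close> is the partial derivative at the point \<open>p\<close> of the function \<open>f\<close> with respect to
  the \<open>i\<close>-th coordinate of the chart \<open>c\<close>.\<close>

definition pd :: "'a chart \<Rightarrow> nat \<Rightarrow> ('a \<Rightarrow> complex) \<Rightarrow> 'a \<Rightarrow> complex" where
  "pd c i f p = deriv (\<lambda>s. f (chart_inv c ((snd c p)(i := s)))) (snd c p i)"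

text \<open>A (bi)vector field is given by its components in every chart of the maximal atlas; only
  the values at points of the chart domain (and at indices below the dimension) are relevant.
  The components \<open>P c i j\<close> of a bivector field in the chart \<open>c\<close> with coordinates \<open>z\<close> are those of
  \<open>\<Sum>i j. P c i j (\<partial>/\<partial>z i) \<and> (\<partial>/\<partial>z j)\<close>, the sum being over all pairs of indices, with
  \<open>P c i j = - P c j i\<close>.\<close>

type_synonym 'a vfield = "'a chart \<Rightarrow> nat \<Rightarrow> 'a \<Rightarrow> complex"
type_synonym 'a bivfield = "'a chart \<Rightarrow> nat \<Rightarrow> nat \<Rightarrow> 'a \<Rightarrow> complex"

definition hol_vfield :: "'a cmanifold \<Rightarrow> 'a set \<Rightarrow> 'a vfield \<Rightarrow> bool" where
  "hol_vfield M U X \<longleftrightarrow>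
     (\<forall>c\<in>max_atlas M. \<forall>i<mdim M. hol_fun M (U \<inter> fst c) (X c i)) \<and>
     (\<forall>c\<in>max_atlas M. \<forall>d\<in>max_atlas M. \<forall>p\<in>U \<inter> fst c \<inter> fst d. \<forall>a<mdim M.
        X d a p = (\<Sum>i<mdim M. X c i p * pd c i (\<lambda>q. snd d q a) p))"

definition hol_bivfield :: "'a cmanifold \<Rightarrow> 'a set \<Rightarrow> 'a bivfield \<Rightarrow> bool" where
  "hol_bivfield M U P \<longleftrightarrow>
     (\<forall>c\<in>max_atlas M. \<forall>i<mdim M. \<forall>j<mdim M. hol_fun M (U \<inter> fst c) (P c i j)) \<and>
     (\<forall>c\<in>max_atlas M. \<forall>i<mdim M. \<forall>j<mdim M. \<forall>p\<in>U \<inter> fst c. P c i j p = - P c j i p) \<and>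
     (\<forall>c\<in>max_atlas M. \<forall>d\<in>max_atlas M. \<forall>p\<in>U \<inter> fst c \<inter> fst d. \<forall>a<mdim M. \<forall>b<mdim M.
        P d a b p = (\<Sum>i<mdim M. \<Sum>j<mdim M.
          P c i j p * pd c i (\<lambda>q. snd d q a) p * pd c j (\<lambda>q. snd d q b) p))"

definition vf_eq :: "'a cmanifold \<Rightarrow> 'a set \<Rightarrow> 'a vfield \<Rightarrow> 'a vfield \<Rightarrow> bool" where
  "vf_eq M U X Y \<longleftrightarrow> (\<forall>c\<in>max_atlas M. \<forall>p\<in>U \<inter> fst c. \<forall>i<mdim M. X c i p = Y c i p)"

definition bf_eq :: "'a cmanifold \<Rightarrow> 'a set \<Rightarrow> 'a bivfield \<Rightarrow> 'a bivfield \<Rightarrow> bool" where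
  "bf_eq M U P Q \<longleftrightarrow>
     (\<forall>c\<in>max_atlas M. \<forall>p\<in>U \<inter> fst c. \<forall>i<mdim M. \<forall>j<mdim M. P c i j p = Q c i j p)"

definition vf_add :: "'a vfield \<Rightarrow> 'a vfield \<Rightarrow> 'a vfield" where
  "vf_add X Y = (\<lambda>c i p. X c i p + Y c i p)"

definition vf_scale :: "complex \<Rightarrow> 'a vfield \<Rightarrow> 'a vfield" where
  "vf_scale s X = (\<lambda>c i p. s * X c i p)"

definition vf_diff :: "'a vfield \<Rightarrow> 'a vfield \<Rightarrow> 'a vfield" where
  "vf_diff X Y = (\<lambda>c i p. X c i p - Y c i p)"

definition bf_zero :: "'a bivfield" where
  "bf_zero = (\<lambda>c i j p. 0)"

definition bf_add :: "'a bivfield \<Rightarrow> 'a bivfield \<Rightarrow> 'a bivfield" where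
  "bf_add P Q = (\<lambda>c i j p. P c i j p + Q c i j p)"

definition bf_scale :: "complex \<Rightarrow> 'a bivfield \<Rightarrow> 'a bivfield" where
  "bf_scale s P = (\<lambda>c i j p. s * P c i j p)"

definition bf_diff :: "'a bivfield \<Rightarrow> 'a bivfield \<Rightarrow> 'a bivfield" where
  "bf_diff P Q = (\<lambda>c i j p. P c i j p - Q c i j p)"

definition lie_deriv :: "'a cmanifold \<Rightarrow> 'a vfield \<Rightarrow> 'a bivfield \<Rightarrow> 'a bivfield" where
  "lie_deriv M X P = (\<lambda>c i j p. \<Sum>l<mdim M.
     X c l p * pd c l (P c i j) p
     - P c l j p * pd c l (X c i) p
     - P c i l p * pd c l (X c j) p)"

text \<open>The sign convention for the Schouten bracket is \<open>[P, X] = - L\<^sub>X P\<close>.\<close>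

definition schouten_bv :: "'a cmanifold \<Rightarrow> 'a bivfield \<Rightarrow> 'a vfield \<Rightarrow> 'a bivfield" where
  "schouten_bv M P X = bf_scale (- 1) (lie_deriv M X P)"

text \<open>Components of the Schouten bracket \<open>[P, Q]\<close> of two bivector fields, up to a universal
  nonzero constant factor, which is immaterial because only the vanishing of such brackets is
  ever used.\<close>

definition schouten_bb ::
  "'a cmanifold \<Rightarrow> 'a bivfield \<Rightarrow> 'a bivfield \<Rightarrow> 'a chart \<Rightarrow> nat \<Rightarrow> nat \<Rightarrow> nat \<Rightarrow> 'a \<Rightarrow> complex" where
  "schouten_bb M P Q = (\<lambda>c i j k p. \<Sum>l<mdim M.
       P c l i p * pd c l (Q c j k) p + Q c l i p * pd c l (P c j k) p
     + P c l j p * pd c l (Q c k i) p + Q c l j p * pd c l (P c k i) p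
     + P c l k p * pd c l (Q c i j) p + Q c l k p * pd c l (P c i j) p)"

definition schouten_bb_zero ::
  "'a cmanifold \<Rightarrow> 'a set \<Rightarrow> 'a bivfield \<Rightarrow> 'a bivfield \<Rightarrow> bool" where
  "schouten_bb_zero M U P Q \<longleftrightarrow>
     (\<forall>c\<in>max_atlas M. \<forall>p\<in>U \<inter> fst c. \<forall>i<mdim M. \<forall>j<mdim M. \<forall>k<mdim M.
        schouten_bb M P Q c i j k p = 0)"

text \<open>The functions \<open>\<xi>\<close> and \<open>\<pi>\<close> are the components in the chart \<open>e\<close>; the results are
  meaningful on the domain of \<open>e\<close>.\<close>

definition vf_of_comps :: "'a cmanifold \<Rightarrow> 'a chart \<Rightarrow> (nat \<Rightarrow> 'a \<Rightarrow> complex) \<Rightarrow> 'a vfield" where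
  "vf_of_comps M e \<xi> = (\<lambda>d a p. \<Sum>i<mdim M. \<xi> i p * pd e i (\<lambda>q. snd d q a) p)"

definition bf_of_comps ::
  "'a cmanifold \<Rightarrow> 'a chart \<Rightarrow> (nat \<Rightarrow> nat \<Rightarrow> 'a \<Rightarrow> complex) \<Rightarrow> 'a bivfield" where
  "bf_of_comps M e \<pi> = (\<lambda>d a b p. \<Sum>i<mdim M. \<Sum>j<mdim M.
     \<pi> i j p * pd e i (\<lambda>q. snd d q a) p * pd e j (\<lambda>q. snd d q b) p)"

definition poisson_manifold :: "'a cmanifold \<Rightarrow> 'a bivfield \<Rightarrow> bool" where
  "poisson_manifold M L \<longleftrightarrow> complex_manifold M \<and> hol_bivfield M (points M) L \<and>
     schouten_bb_zero M (points M) L L"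

text \<open>Holomorphic maps whose differential carries the first bivector field to the second one.\<close>

definition poisson_map ::
  "'a cmanifold \<Rightarrow> 'a bivfield \<Rightarrow> 'b cmanifold \<Rightarrow> 'b bivfield \<Rightarrow> ('a \<Rightarrow> 'b) \<Rightarrow> bool" where
  "poisson_map M L N L' f \<longleftrightarrow> hol_map M N f \<and>
     (\<forall>c\<in>max_atlas M. \<forall>d\<in>max_atlas N. \<forall>p\<in>fst c. f p \<in> fst d \<longrightarrow> (\<forall>a<mdim N. \<forall>b<mdim N.
        L' d a b (f p) = (\<Sum>i<mdim M. \<Sum>j<mdim M.
          L c i j p * pd c i (\<lambda>q. snd d (f q) a) p * pd c j (\<lambda>q. snd d (f q) b) p)))"

definition poisson_iso ::
  "'a cmanifold \<Rightarrow> 'a bivfield \<Rightarrow> 'b cmanifold \<Rightarrow> 'b bivfield \<Rightarrow> ('a \<Rightarrow> 'b) \<Rightarrow> bool" where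
  "poisson_iso M L N L' f \<longleftrightarrow> biholomorphic_map M N f \<and> poisson_map M L N L' f"

text \<open>The first hypercohomology group of the complex of sheaves of holomorphic multivector fields
  with differential \<open>[L, -]\<close>, vector fields being in degree \<open>0\<close>, is the Cech hypercohomology
  group: the direct limit, over all open covers, of the first cohomology of the total complex of
  the Cech double complex. Since manifolds are second countable, covers indexed by the natural
  numbers suffice. A 1-cochain consists of a cover \<open>U\<close>, vector fields \<open>\<theta> j k\<close> on \<open>U j \<inter> U k\<close> and
  bivector fields \<open>P j\<close> on \<open>U j\<close>.\<close>

type_synonym 'a cochain1 =
  "(nat \<Rightarrow> 'a set) \<times> (nat \<Rightarrow> nat \<Rightarrow> 'a vfield) \<times> (nat \<Rightarrow> 'a bivfield)"

definition open_cover :: "'a cmanifold \<Rightarrow> (nat \<Rightarrow> 'a set) \<Rightarrow> bool" where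
  "open_cover M U \<longleftrightarrow> (\<forall>j. openin (mtop M) (U j)) \<and> (\<Union>j. U j) = points M"

definition hyper_Z1 :: "'a cmanifold \<Rightarrow> 'a bivfield \<Rightarrow> 'a cochain1 set" where
  "hyper_Z1 M L = {(U, \<theta>, P). open_cover M U \<and>
     (\<forall>j k. hol_vfield M (U j \<inter> U k) (\<theta> j k)) \<and>
     (\<forall>j. hol_bivfield M (U j) (P j)) \<and>
     (\<forall>i j k. vf_eq M (U i \<inter> U j \<inter> U k) (\<theta> i k) (vf_add (\<theta> i j) (\<theta> j k))) \<and>
     (\<forall>j k. bf_eq M (U j \<inter> U k)
        (bf_add (bf_diff (P k) (P j)) (schouten_bv M L (\<theta> j k))) bf_zero) \<and>
     (\<forall>j. schouten_bb_zero M (U j) L (P j))}"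

text \<open>Two cocycles represent the same class iff on some common refinement \<open>V\<close> of their covers
  (with refinement maps \<open>r\<close> and \<open>s\<close>) they differ by the total coboundary of a 0-cochain of vector
  fields.\<close>

definition hyper_rel :: "'a cmanifold \<Rightarrow> 'a bivfield \<Rightarrow> ('a cochain1 \<times> 'a cochain1) set" where
  "hyper_rel M L = {((U, \<theta>, P), (U', \<theta>', P')).
     (U, \<theta>, P) \<in> hyper_Z1 M L \<and> (U', \<theta>', P') \<in> hyper_Z1 M L \<and>
     (\<exists>V r s X. open_cover M V \<and> (\<forall>j. V j \<subseteq> U (r j) \<and> V j \<subseteq> U' (s j)) \<and>
        (\<forall>j. hol_vfield M (V j) (X j)) \<and>
        (\<forall>j k. vf_eq M (V j \<inter> V k)
           (vf_diff (\<theta> (r j) (r k)) (\<theta>' (s j) (s k))) (vf_diff (X k) (X j))) \<and>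
        (\<forall>j. bf_eq M (V j)
           (bf_diff (P (r j)) (P' (s j))) (bf_scale (- 1) (schouten_bv M L (X j)))))}"

definition hyper_H1 :: "'a cmanifold \<Rightarrow> 'a bivfield \<Rightarrow> 'a cochain1 set set" where
  "hyper_H1 M L = hyper_Z1 M L // hyper_rel M L"

definition hyper_class :: "'a cmanifold \<Rightarrow> 'a bivfield \<Rightarrow> 'a cochain1 \<Rightarrow> 'a cochain1 set" where
  "hyper_class M L z = hyper_rel M L `` {z}"

text \<open>Cochains on two covers are added on the common refinement formed
  by all intersections, indexed through the bijection between numbers and pairs of numbers.\<close>

definition cochain_add :: "'a cochain1 \<Rightarrow> 'a cochain1 \<Rightarrow> 'a cochain1" where
  "cochain_add = (\<lambda>(U, \<theta>, P) (U', \<theta>', P').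
     let l = (\<lambda>j. fst (prod_decode j)); r = (\<lambda>j. snd (prod_decode j)) in
     (\<lambda>j. U (l j) \<inter> U' (r j),
      \<lambda>j k. vf_add (\<theta> (l j) (l k)) (\<theta>' (r j) (r k)),
      \<lambda>j. bf_add (P (l j)) (P' (r j))))"

definition cochain_scale :: "complex \<Rightarrow> 'a cochain1 \<Rightarrow> 'a cochain1" where
  "cochain_scale s = (\<lambda>(U, \<theta>, P). (U, \<lambda>j k. vf_scale s (\<theta> j k), \<lambda>j. bf_scale s (P j)))"

definition hyper_add ::
  "'a cmanifold \<Rightarrow> 'a bivfield \<Rightarrow> 'a cochain1 set \<Rightarrow> 'a cochain1 set \<Rightarrow> 'a cochain1 set" where
  "hyper_add M L A B = (\<Union>x\<in>A. \<Union>y\<in>B. hyper_class M L (cochain_add x y))"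

definition hyper_scale ::
  "'a cmanifold \<Rightarrow> 'a bivfield \<Rightarrow> complex \<Rightarrow> 'a cochain1 set \<Rightarrow> 'a cochain1 set" where
  "hyper_scale M L s A = (\<Union>x\<in>A. hyper_class M L (cochain_scale s x))"

record 'e poisson_fam =
  tot :: "'e cmanifold"
  totbiv :: "'e bivfield"
  pardim :: nat
  base :: "(nat \<Rightarrow> complex) set"
  proj :: "'e \<Rightarrow> nat \<Rightarrow> complex"

definition fdim :: "'e poisson_fam \<Rightarrow> nat" where
  "fdim F = mdim (tot F) - pardim F"

text \<open>Adapted charts have coordinates \<open>(z, t)\<close> in which the projection is \<open>(z, t) \<mapsto> t\<close>; the
  coordinate \<open>t i\<close> has index \<open>fdim F + i\<close>. Leaving out \<open>t\<close> gives charts of the fibres.\<close>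

definition adapted_chart :: "'e poisson_fam \<Rightarrow> 'e chart \<Rightarrow> bool" where
  "adapted_chart F c \<longleftrightarrow> c \<in> max_atlas (tot F) \<and>
     (\<forall>p\<in>fst c. \<forall>i<pardim F. snd c p (fdim F + i) = proj F p i)"

definition fibre_set :: "'e poisson_fam \<Rightarrow> (nat \<Rightarrow> complex) \<Rightarrow> 'e set" where
  "fibre_set F t = {p \<in> points (tot F). proj F p = t}"

definition fibre_chart :: "'e poisson_fam \<Rightarrow> (nat \<Rightarrow> complex) \<Rightarrow> 'e chart \<Rightarrow> 'e chart" where
  "fibre_chart F t c = (fst c \<inter> fibre_set F t, \<lambda>p i. if i < fdim F then snd c p i else 0)"

definition fibre :: "'e poisson_fam \<Rightarrow> (nat \<Rightarrow> complex) \<Rightarrow> 'e cmanifold" where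
  "fibre F t = \<lparr>mdim = fdim F, mtop = subtopology (mtop (tot F)) (fibre_set F t),
     matlas = fibre_chart F t ` {c. adapted_chart F c}\<rparr>"

text \<open>\<open>L\<close> is a Poisson structure on the fibre that makes the fibre a Poisson submanifold of the
  total space. Since the inclusion is an immersion, \<open>L\<close> is unique as a bivector field.\<close>

definition induces_on_fibre :: "'e poisson_fam \<Rightarrow> (nat \<Rightarrow> complex) \<Rightarrow> 'e bivfield \<Rightarrow> bool" where
  "induces_on_fibre F t L \<longleftrightarrow> poisson_manifold (fibre F t) L \<and>
     poisson_map (fibre F t) L (tot F) (totbiv F) (\<lambda>p. p)"

definition fibre_biv :: "'e poisson_fam \<Rightarrow> (nat \<Rightarrow> complex) \<Rightarrow> 'e bivfield" where
  "fibre_biv F t = (SOME L. induces_on_fibre F t L)"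

text \<open>The condition that the Jacobian of the projection has rank \<open>pardim F\<close> is expressed by the
  linear independence of its \<open>pardim F\<close> rows. The local coordinates \<open>(z, t)\<close> are part of the
  definition; they are the charts from which the submanifold structure of the fibres and the
  Kodaira-Spencer map are formed.\<close>

definition poisson_analytic_family :: "'e poisson_fam \<Rightarrow> bool" where
  "poisson_analytic_family F \<longleftrightarrow>
     poisson_manifold (tot F) (totbiv F) \<and>
     openin (cspace (pardim F)) (base F) \<and> connectedin (cspace (pardim F)) (base F) \<and>
     base F \<noteq> {} \<and>
     proj F \<in> points (tot F) \<rightarrow> base F \<and>
     (\<forall>i<pardim F. hol_fun (tot F) (points (tot F)) (\<lambda>p. proj F p i)) \<and>
     (\<forall>c\<in>max_atlas (tot F). \<forall>p\<in>fst c. \<forall>v.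
        (\<forall>k<mdim (tot F). (\<Sum>i<pardim F. v i * pd c k (\<lambda>q. proj F q i) p) = 0) \<longrightarrow>
        (\<forall>i<pardim F. v i = 0)) \<and>
     (\<forall>p\<in>points (tot F). \<exists>c. adapted_chart F c \<and> p \<in> fst c) \<and>
     (\<forall>t\<in>base F. compactin (mtop (tot F)) (fibre_set F t) \<and> (\<exists>L. induces_on_fibre F t L))"

text \<open>The tangent space of the base at \<open>0\<close> is \<open>cvec (pardim F)\<close>: the tuple \<open>v\<close> stands for the
  tangent vector \<open>\<Sum>i. v i (\<partial>/\<partial>t i)\<close>. For a sequence \<open>c\<close> of adapted charts covering the fibre over
  \<open>0\<close>, the function \<open>\<lambda>q. snd (c j) q a\<close>, differentiated with respect to the coordinates of \<open>c k\<close>,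
  is the component \<open>a\<close> of the transition function from \<open>c k\<close> to \<open>c j\<close>.\<close>

definition adapted_cover :: "'e poisson_fam \<Rightarrow> (nat \<Rightarrow> 'e chart) \<Rightarrow> bool" where
  "adapted_cover F c \<longleftrightarrow> (\<forall>j. adapted_chart F (c j)) \<and> fibre_set F (\<lambda>i. 0) \<subseteq> (\<Union>j. fst (c j))"

definition ks_cocycle ::
  "'e poisson_fam \<Rightarrow> (nat \<Rightarrow> 'e chart) \<Rightarrow> (nat \<Rightarrow> complex) \<Rightarrow> 'e cochain1" where
  "ks_cocycle F c v =
     (let M0 = fibre F (\<lambda>i. 0); e = (\<lambda>j. fibre_chart F (\<lambda>i. 0) (c j)) in
      (\<lambda>j. fst (e j),
       \<lambda>j k. vf_of_comps M0 (e j)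
         (\<lambda>a p. \<Sum>i<pardim F. v i * pd (c k) (fdim F + i) (\<lambda>q. snd (c j) q a) p),
       \<lambda>j. bf_of_comps M0 (e j)
         (\<lambda>a b p. \<Sum>i<pardim F. v i * pd (c j) (fdim F + i) (totbiv F (c j) a b) p)))"

text \<open>The class does not depend on the choice of the charts.\<close>

definition ks_map :: "'e poisson_fam \<Rightarrow> (nat \<Rightarrow> complex) \<Rightarrow> 'e cochain1 set" where
  "ks_map F v = hyper_class (fibre F (\<lambda>i. 0)) (fibre_biv F (\<lambda>i. 0))
     (ks_cocycle F (SOME c. adapted_cover F c) v)"

definition ks_isomorphism :: "'e poisson_fam \<Rightarrow> bool" where
  "ks_isomorphism F \<longleftrightarrow>
     (let M0 = fibre F (\<lambda>i. 0); L0 = fibre_biv F (\<lambda>i. 0); T0 = cvec (pardim F) in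
      bij_betw (ks_map F) T0 (hyper_H1 M0 L0) \<and>
      (\<forall>u\<in>T0. \<forall>v\<in>T0. ks_map F (\<lambda>i. u i + v i) = hyper_add M0 L0 (ks_map F u) (ks_map F v)) \<and>
      (\<forall>s. \<forall>v\<in>T0. ks_map F (\<lambda>i. s * v i) = hyper_scale M0 L0 s (ks_map F v)))"

text \<open>The total space of a family may be any manifold. As HOL cannot quantify over types inside a
  definition, the type of the points of the total space is a parameter; a statement about all
  families is polymorphic in it. The identification of the fibre over \<open>0\<close> with the given Poisson
  manifold is an isomorphism of Poisson manifolds.\<close>

definition poisson_unobstructed :: "'e itself \<Rightarrow> 'a cmanifold \<Rightarrow> 'a bivfield \<Rightarrow> bool" where
  "poisson_unobstructed _ M L \<longleftrightarrow>
     (\<exists>(F :: 'e poisson_fam) \<iota>. poisson_analytic_family F \<and> (\<lambda>i. 0) \<in> base F \<and>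
        poisson_iso M L (fibre F (\<lambda>i. 0)) (fibre_biv F (\<lambda>i. 0)) \<iota> \<and>
        ks_isomorphism F)"

definition poisson_obstructed :: "'e itself \<Rightarrow> 'a cmanifold \<Rightarrow> 'a bivfield \<Rightarrow> bool" where
  "poisson_obstructed ty M L \<longleftrightarrow> \<not> poisson_unobstructed ty M L"

text \<open>The coordinates \<open>(z, w)\<close> of a point \<open>x\<close> are \<open>(x 0, x 1)\<close>.\<close>

definition punctured_C2 :: "(nat \<Rightarrow> complex) set" where
  "punctured_C2 = cvec 2 - {\<lambda>i. 0}"

text \<open>The orbit of \<open>x\<close> under the group generated by an automorphism \<open>f\<close> of \<open>punctured_C2\<close>: both
  the positive and the negative iterates.\<close>

definition hopf_orbit ::
  "((nat \<Rightarrow> complex) \<Rightarrow> nat \<Rightarrow> complex) \<Rightarrow> (nat \<Rightarrow> complex) \<Rightarrow> (nat \<Rightarrow> complex) set" where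
  "hopf_orbit f x = {y \<in> punctured_C2. \<exists>k. y = (f ^^ k) x \<or> x = (f ^^ k) y}"

definition hopf_topology ::
  "((nat \<Rightarrow> complex) \<Rightarrow> nat \<Rightarrow> complex) \<Rightarrow> (nat \<Rightarrow> complex) set topology" where
  "hopf_topology f = topology (\<lambda>S. S \<subseteq> hopf_orbit f ` punctured_C2 \<and>
       openin (cspace 2) {x \<in> punctured_C2. hopf_orbit f x \<in> S})"

lemma openin_hopf_topology:
  "openin (hopf_topology f) S \<longleftrightarrow>
     S \<subseteq> hopf_orbit f ` punctured_C2 \<and>
       openin (cspace 2) {x \<in> punctured_C2. hopf_orbit f x \<in> S}"
proof -
  have "istopology (\<lambda>S. S \<subseteq> hopf_orbit f ` punctured_C2 \<and>
       openin (cspace 2) {x \<in> punctured_C2. hopf_orbit f x \<in> S})"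
    unfolding istopology_def
  proof (intro conjI allI impI)
    fix S T
    assume S: "S \<subseteq> hopf_orbit f ` punctured_C2 \<and>
       openin (cspace 2) {x \<in> punctured_C2. hopf_orbit f x \<in> S}"
      and T: "T \<subseteq> hopf_orbit f ` punctured_C2 \<and>
       openin (cspace 2) {x \<in> punctured_C2. hopf_orbit f x \<in> T}"
    show "S \<inter> T \<subseteq> hopf_orbit f ` punctured_C2"
      using S by blast
    have "{x \<in> punctured_C2. hopf_orbit f x \<in> S \<inter> T} =
       {x \<in> punctured_C2. hopf_orbit f x \<in> S} \<inter> {x \<in> punctured_C2. hopf_orbit f x \<in> T}"
      by blast
    then show "openin (cspace 2) {x \<in> punctured_C2. hopf_orbit f x \<in> S \<inter> T}"
      using S T by (simp add: openin_Int)
  next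
    fix K
    assume K: "\<forall>S\<in>K. S \<subseteq> hopf_orbit f ` punctured_C2 \<and>
       openin (cspace 2) {x \<in> punctured_C2. hopf_orbit f x \<in> S}"
    show "\<Union>K \<subseteq> hopf_orbit f ` punctured_C2"
      using K by blast
    have "{x \<in> punctured_C2. hopf_orbit f x \<in> \<Union>K} = (\<Union>S\<in>K. {x \<in> punctured_C2. hopf_orbit f x \<in> S})"
      by blast
    then show "openin (cspace 2) {x \<in> punctured_C2. hopf_orbit f x \<in> \<Union>K}"
      using K by auto
  qed
  then show ?thesis
    by (simp add: hopf_topology_def topology_inverse')
qed

text \<open>The quotient of \<open>punctured_C2\<close> by the group generated by \<open>f\<close>; the charts are the local inverses
  of the quotient map.\<close>

definition hopf_quotient ::
  "((nat \<Rightarrow> complex) \<Rightarrow> nat \<Rightarrow> complex) \<Rightarrow> (nat \<Rightarrow> complex) set cmanifold" where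
  "hopf_quotient f = \<lparr>mdim = 2, mtop = hopf_topology f,
     matlas = {(hopf_orbit f ` V, inv_into V (hopf_orbit f)) | V.
       openin (cspace 2) V \<and> V \<subseteq> punctured_C2 \<and> inj_on (hopf_orbit f) V}\<rparr>"

definition hopf_IV_map :: "complex \<Rightarrow> (nat \<Rightarrow> complex) \<Rightarrow> nat \<Rightarrow> complex" where
  "hopf_IV_map \<alpha> x = (\<lambda>i. 0)(0 := \<alpha> * x 0, 1 := \<alpha> * x 1)"

definition hopf_III_map :: "nat \<Rightarrow> complex \<Rightarrow> (nat \<Rightarrow> complex) \<Rightarrow> nat \<Rightarrow> complex" where
  "hopf_III_map p \<delta> x = (\<lambda>i. 0)(0 := \<delta> ^ p * x 0, 1 := \<delta> * x 1)"

definition hopf_type_IV :: "(nat \<Rightarrow> complex) set cmanifold \<Rightarrow> bool" where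
  "hopf_type_IV X \<longleftrightarrow> (\<exists>\<alpha>. 0 < cmod \<alpha> \<and> cmod \<alpha> < 1 \<and> X = hopf_quotient (hopf_IV_map \<alpha>))"

definition hopf_type_III :: "(nat \<Rightarrow> complex) set cmanifold \<Rightarrow> bool" where
  "hopf_type_III X \<longleftrightarrow> (\<exists>p \<delta>. 2 \<le> p \<and> 0 < cmod \<delta> \<and> cmod \<delta> < 1 \<and>
     X = hopf_quotient (hopf_III_map p \<delta>))"

end

theory Submission
  imports Defs "HOL-Complex_Analysis.Complex_Analysis"
begin

text \<open>A Hopf surface of type IV is treated as one of type III with \<open>p = 1\<close>. Write \<open>(z, w)\<close> for the
  coordinates, \<open>V = z \<partial>/\<partial>z\<close> and \<open>P = w ^ (p + 1) \<partial>/\<partial>z \<and> \<partial>/\<partial>w\<close>; both are invariant under the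
  contraction \<open>f\<close> and descend to the surface. On a cover by images of annuli the branches of the
  number of applications of \<open>f\<close> form an integral cocycle \<open>n\<close>, and \<open>(n V, P)\<close> is a hypercocycle.
  If the Kodaira-Spencer map of a family is onto, some tangent vector \<open>v\<close> is mapped to its class.
  Restrict the bivector field of the family to the parameters \<open>s v\<close>. It vanishes for \<open>s = 0\<close>, so
  comparing the coefficients of \<open>s\<^sup>2\<close> in two charts shows that \<open>n [V, P]\<close> is a coboundary. As
  \<open>L\<^sub>V P = - P\<close>, dividing by \<open>P\<close> along the curve \<open>z = 0\<close> yields a holomorphic function \<open>h\<close> of
  \<open>w \<noteq> 0\<close> with \<open>h (\<delta> w) = h w + 2\<close>. But the mean of \<open>h\<close> over circles around \<open>0\<close> does not depend
  on the radius.\<close>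

section \<open>Holomorphic functions of several variables\<close>

text \<open>The two halves of the class clash. Gluing by \<open>n V\<close> amounts to replacing the
  multiplier \<delta>^p of \<open>z\<close> by \<delta>^p e^s, up to the sign of \<open>s\<close>.
  The exponent \<open>p + 1\<close> is the one that balances the factor by which the contraction
  scales the bivector of the two coordinate fields, so it is tied to the old multipliers and
  \<open>P\<close> does not survive the change. Trivector fields on a surface are zero, so the clash
  is not visible in the bracket of the bivector field with itself; it shows only when the
  coefficients of the bivector field are glued to second order. Because \<open>P\<close> is an
  eigenvector of the Lie derivative along \<open>V\<close>, the obstruction is again a multiple of
  \<open>n P\<close>. The 2 in the functional equation is the binomial coefficient in a second
  derivative. No cohomology group is computed. The difficulty is that the total space, its charts
  and the number of parameters are arbitrary, and that the central fibre is only isomorphic to the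
  Hopf surface. Everything is therefore pulled back to \<open>W\<close>, where tensor fields become
  functions with a weight under the contraction.\<close>

definition pbox :: "nat \<Rightarrow> (nat \<Rightarrow> complex) \<Rightarrow> real \<Rightarrow> (nat \<Rightarrow> complex) set" where
  "pbox n x e = {y\<in>cvec n. \<forall>i<n. cmod (y i - x i) < e}"

section \<open>Coordinate boxes and the topology of \<open>cspace n\<close>\<close>

lemma topspace_cspace [simp]: "topspace (cspace n) = cvec n"
  by (simp add: cspace_def)

lemma cvec_eqI: "x \<in> cvec n \<Longrightarrow> y \<in> cvec n \<Longrightarrow> (\<And>i. i < n \<Longrightarrow> x i = y i) \<Longrightarrow> x = y"
  unfolding cvec_def by (rule ext) (metis (mono_tags, lifting) mem_Collect_eq not_le)

lemma openin_cspace_sub: "openin (cspace n) S \<Longrightarrow> S \<subseteq> cvec n"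
  using openin_subset by fastforce

lemma continuous_on_coordinate: "continuous_on S (\<lambda>x::nat \<Rightarrow> complex. x i)"
  by (rule continuous_on_subset[OF continuous_on_product_coordinates subset_UNIV])

lemma open_coordinate_box: "open {y::nat \<Rightarrow> complex. \<forall>i<n. cmod (y i - x i) < e}"
proof -
  have "{y::nat \<Rightarrow> complex. \<forall>i<n. cmod (y i - x i) < e} = (\<Inter>i\<in>{..<n}. {y. cmod (y i - x i) < e})"
    by auto
  moreover have "open {y::nat \<Rightarrow> complex. cmod (y i - x i) < e}" for i
    by (intro open_Collect_less continuous_intros continuous_on_product_coordinates)
  ultimately show ?thesis
    by (simp add: open_INT)
qed

lemma openin_pbox: "openin (cspace n) (pbox n x e)"
proof -
  have "pbox n x e = {y. \<forall>i<n. cmod (y i - x i) < e} \<inter> cvec n"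
    by (auto simp: pbox_def)
  then show ?thesis
    unfolding cspace_def openin_subtopology
    using open_coordinate_box[of n x e] by auto
qed

lemma center_in_pbox: "x \<in> cvec n \<Longrightarrow> 0 < e \<Longrightarrow> x \<in> pbox n x e"
  by (auto simp: pbox_def)

lemma pbox_mono: "e \<le> e' \<Longrightarrow> pbox n x e \<subseteq> pbox n x e'"
  by (force simp: pbox_def)

text \<open>A basic open set of the product topology restricts only finitely many coordinates, and
  on \<open>cvec n\<close> those of index at least \<open>n\<close> are constantly 0. Hence boxes in
  the first \<open>n\<close> coordinates form a neighbourhood basis.\<close>

lemma openin_cspace_iff:
  "openin (cspace n) S \<longleftrightarrow> S \<subseteq> cvec n \<and> (\<forall>x\<in>S. \<exists>e>0. pbox n x e \<subseteq> S)"
proof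
  assume S: "openin (cspace n) S"
  then obtain T where T: "open T" "S = T \<inter> cvec n"
    by (auto simp: cspace_def openin_subtopology)
  have "\<exists>e>0. pbox n x e \<subseteq> S" if "x \<in> S" for x
  proof -
    have xT: "x \<in> T" using that T(2) by blast
    have op: "openin (product_topology (\<lambda>i. euclidean) UNIV) T"
      using T(1) by (simp add: euclidean_product_topology)
    then obtain X where X: "x \<in> (\<Pi>\<^sub>E i\<in>UNIV. X i)" "\<And>i::nat. open (X i :: complex set)"
        "(\<Pi>\<^sub>E i\<in>UNIV. X i) \<subseteq> T" "finite {i. X i \<noteq> UNIV}"
      using product_topology_open_contains_basis[OF op xT] by auto
    have "\<exists>e>0. ball (x i) e \<subseteq> X i" for i
      using X(1,2) by (meson PiE_E UNIV_I open_contains_ball)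
    then obtain e where e: "\<And>i. e i > 0" "\<And>i. ball (x i) (e i) \<subseteq> X i"
      by metis
    define J where "J = {i. X i \<noteq> UNIV}"
    \<comment> \<open>The 1 keeps the minimum meaningful when no coordinate is restricted.\<close>
    define d where "d = Min (insert 1 (e ` J))"
    have fin: "finite (insert 1 (e ` J))"
      using X(4) by (simp add: J_def)
    have d0: "d > 0"
      unfolding d_def using fin e(1) by (subst Min_gr_iff) auto
    have "y \<in> S" if y: "y \<in> pbox n x d" for y
    proof -
      have "y i \<in> X i" for i
      proof (cases "i \<in> J")
        case True
        then have "d \<le> e i"
          unfolding d_def using fin by (intro Min_le) auto
        moreover have "cmod (y i - x i) < d"
        proof (cases "i < n")
          case False
          then show ?thesis
            using y T(2) \<open>x \<in> S\<close> d0 by (auto simp: pbox_def cvec_def)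
        qed (use y in \<open>auto simp: pbox_def\<close>)
        ultimately have "y i \<in> ball (x i) (e i)"
          by (simp add: dist_norm norm_minus_commute)
        then show ?thesis using e(2) by blast
      qed (simp add: J_def)
      then have "y \<in> T" using X(3) by (auto simp: PiE_iff)
      then show ?thesis using T(2) y by (auto simp: pbox_def)
    qed
    then show ?thesis using d0 by blast
  qed
  then show "S \<subseteq> cvec n \<and> (\<forall>x\<in>S. \<exists>e>0. pbox n x e \<subseteq> S)"
    using openin_cspace_sub[OF S] by blast
next
  assume S: "S \<subseteq> cvec n \<and> (\<forall>x\<in>S. \<exists>e>0. pbox n x e \<subseteq> S)"
  show "openin (cspace n) S"
  proof (subst openin_subopen, intro ballI)
    fix x assume "x \<in> S"
    with S obtain e where "e > 0" "pbox n x e \<subseteq> S" by blast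
    then show "\<exists>T. openin (cspace n) T \<and> x \<in> T \<and> T \<subseteq> S"
      using \<open>x \<in> S\<close> S openin_pbox center_in_pbox by (metis subsetD)
  qed
qed

lemma top_of_set_cspace: "V \<subseteq> cvec n \<Longrightarrow> subtopology (cspace n) V = top_of_set V"
  by (simp add: cspace_def subtopology_subtopology Int_absorb1)

lemma continuous_preimage_cspace:
  assumes "continuous_on V f" "openin (cspace n) V" "open B"
  shows "openin (cspace n) {x\<in>V. f x \<in> B}"
proof -
  have "openin (top_of_set V) (V \<inter> f -` B)"
    using continuous_openin_preimage_gen assms by blast
  then have "openin (subtopology (cspace n) V) (V \<inter> f -` B)"
    using top_of_set_cspace openin_cspace_sub assms(2) by metis
  then have "openin (cspace n) (V \<inter> f -` B)"
    using openin_trans_full assms(2) by blast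
  moreover have "V \<inter> f -` B = {x\<in>V. f x \<in> B}" by auto
  ultimately show ?thesis by simp
qed

lemma continuous_on_pboxD:
  fixes f :: "(nat \<Rightarrow> complex) \<Rightarrow> 'b::metric_space"
  assumes "continuous_on V f" "openin (cspace n) V" "x \<in> V" "e > 0"
  obtains d where "d > 0" "pbox n x d \<subseteq> V" "\<And>y. y \<in> pbox n x d \<Longrightarrow> dist (f y) (f x) < e"
proof -
  have "openin (cspace n) {y\<in>V. f y \<in> ball (f x) e}"
    using continuous_preimage_cspace assms by blast
  moreover have "x \<in> {y\<in>V. f y \<in> ball (f x) e}" using assms by auto
  ultimately obtain d where "d > 0" "pbox n x d \<subseteq> {y\<in>V. f y \<in> ball (f x) e}"
    unfolding openin_cspace_iff by blast
  then show ?thesis using that by (force simp: dist_commute)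
qed

lemma continuous_on_pboxI:
  fixes f :: "(nat \<Rightarrow> complex) \<Rightarrow> 'b::metric_space"
  assumes "V \<subseteq> cvec n"
    and "\<And>x e. x \<in> V \<Longrightarrow> e > 0 \<Longrightarrow> \<exists>d>0. \<forall>y\<in>V \<inter> pbox n x d. dist (f y) (f x) < e"
  shows "continuous_on V f"
  unfolding continuous_on_topological
proof (intro ballI allI impI)
  fix x B assume x: "x \<in> V" "open B" "f x \<in> B"
  then obtain e where e: "e > 0" "ball (f x) e \<subseteq> B" by (meson open_contains_ball)
  obtain d where d: "d > 0" "\<forall>y\<in>V \<inter> pbox n x d. dist (f y) (f x) < e" using assms x(1) e(1) by blast
  show "\<exists>A. open A \<and> x \<in> A \<and> (\<forall>y\<in>V. y \<in> A \<longrightarrow> f y \<in> B)"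
  proof (intro exI conjI ballI impI)
    show "open {y::nat \<Rightarrow> complex. \<forall>i<n. cmod (y i - x i) < d}" by (rule open_coordinate_box)
    show "x \<in> {y::nat \<Rightarrow> complex. \<forall>i<n. cmod (y i - x i) < d}" using d by auto
    fix y assume "y \<in> V" "y \<in> {y::nat \<Rightarrow> complex. \<forall>i<n. cmod (y i - x i) < d}"
    then have "y \<in> V \<inter> pbox n x d" using assms(1) by (auto simp: pbox_def)
    then have "dist (f x) (f y) < e" using bspec[OF d(2)] by (metis dist_commute)
    then show "f y \<in> B" using e(2) by auto
  qed
qed

lemma slice_nhd:
  assumes "openin (cspace n) V" "x \<in> V" "i < n"
  shows "eventually (\<lambda>s. x(i := s) \<in> V) (nhds (x i))"
proof -
  obtain e where e: "e > 0" "pbox n x e \<subseteq> V" using assms openin_cspace_iff by blast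
  have "x \<in> cvec n" using assms openin_cspace_sub by blast
  have "eventually (\<lambda>s. s \<in> ball (x i) e) (nhds (x i))"
    using e by (intro eventually_nhds_in_open) auto
  then show ?thesis
  proof eventually_elim
    case (elim s)
    have "x(i := s) \<in> pbox n x e" using elim \<open>x \<in> cvec n\<close> assms(3) e(1)
      by (auto simp: pbox_def cvec_def dist_norm norm_minus_commute)
    then show ?case using e by blast
  qed
qed

subsection \<open>Partial derivatives\<close>

definition pdv :: "nat \<Rightarrow> ((nat \<Rightarrow> complex) \<Rightarrow> complex) \<Rightarrow> (nat \<Rightarrow> complex) \<Rightarrow> complex" where
  "pdv i f x = deriv (\<lambda>s. f (x(i := s))) (x i)"

lemma hol_on_slice:
  assumes "hol_on n V f" "i < n" "\<And>s. s \<in> A \<Longrightarrow> y(i := s) \<in> V"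
  shows "(\<lambda>s. f (y(i := s))) holomorphic_on A"
  unfolding holomorphic_on_def
proof
  fix s assume "s \<in> A"
  then have "y(i := s) \<in> V" using assms by blast
  then have "(\<lambda>t. f ((y(i := s))(i := t))) field_differentiable (at ((y(i := s)) i))"
    using assms unfolding hol_on_def by blast
  then show "(\<lambda>s. f (y(i := s))) field_differentiable (at s within A)"
    by (simp add: field_differentiable_at_within)
qed

lemma hol_on_pdv:
  assumes "hol_on n V f" "x \<in> V" "i < n"
  shows "((\<lambda>s. f (x(i := s))) has_field_derivative pdv i f x) (at (x i))"
  using assms unfolding hol_on_def pdv_def by (simp add: field_differentiable_derivI)

lemma pdv_cong_ev:
  assumes "eventually (\<lambda>s. f (x(i := s)) = g (x(i := s))) (nhds (x i))"
  shows "pdv i f x = pdv i g x"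
  unfolding pdv_def using assms by (intro deriv_cong_ev) auto

lemma pdv_cong:
  assumes "openin (cspace n) V" "x \<in> V" "i < n" "\<And>y. y \<in> V \<Longrightarrow> f y = g y"
  shows "pdv i f x = pdv i g x"
  by (rule pdv_cong_ev, rule eventually_mono[OF slice_nhd[OF assms(1-3)]]) (use assms in auto)

section \<open>Uniform Taylor estimates and derivatives of partial derivatives\<close>

lemma quadratic_bound:
  assumes hol: "g holomorphic_on ball a (2*r)" and r: "r > 0"
    and M: "\<And>z. z \<in> ball a (2*r) \<Longrightarrow> cmod (g z) \<le> M" and h: "cmod h < r"
  shows "cmod (g (a + h) - g a - deriv g a * h) \<le> 2 * (M + 1) / r^2 * (cmod h)^2"
proof -
  \<comment> \<open>Cauchy's estimate on the disc of radius \<open>r\<close> about \<open>z\<close>.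
    It asks for values in an open ball, whence \<open>M + 1\<close> in place of
    \<open>M\<close>.\<close>
  have 2: "cmod ((deriv ^^ 2) g z) \<le> 2 * (M + 1) / r^2" if z: "z \<in> ball a r" for z
  proof -
    have sub: "cball z r \<subseteq> ball a (2*r)"
    proof
      fix w assume "w \<in> cball z r"
      then have "dist a w < 2 * r" using z dist_triangle[of a w z] by auto
      then show "w \<in> ball a (2*r)" by simp
    qed
    have "cmod ((deriv ^^ 2) g z) \<le> fact 2 * (M + 1) / r^2"
    proof (rule Cauchy_higher_deriv_bound[where y=0])
      show "g holomorphic_on ball z r"
        using hol sub holomorphic_on_subset by (meson ball_subset_cball order_trans)
      show "continuous_on (cball z r) g"
        using hol sub holomorphic_on_imp_continuous_on continuous_on_subset by blast
      show "g w \<in> ball 0 (M + 1)" if "w \<in> ball z r" for w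
        using M[of w] sub that by force
    qed (use r in auto)
    then show ?thesis by simp
  qed
  have "cmod ((deriv ^^ 0) g (a + h) - (\<Sum>i\<le>1. (deriv ^^ i) g a * (a + h - a) ^ i / fact i))
      \<le> 2 * (M + 1) / r^2 * cmod (a + h - a) ^ Suc 1 / fact 1"
  proof (rule complex_Taylor[where S = "ball a r"])
    show "cmod ((deriv ^^ Suc 1) g x) \<le> 2 * (M + 1) / r^2" if "x \<in> ball a r" for x
      using 2[OF that] by (simp add: numeral_2_eq_2)
    show "((deriv ^^ i) g has_field_derivative (deriv ^^ Suc i) g x) (at x within ball a r)"
      if "x \<in> ball a r" "i \<le> 1" for i x
    proof -
      have "(deriv ^^ i) g holomorphic_on ball a (2*r)"
        using hol by (intro holomorphic_higher_deriv) auto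
      then have "((deriv ^^ i) g has_field_derivative deriv ((deriv ^^ i) g) x) (at x)"
        using that r by (intro holomorphic_derivI[of _ "ball a (2*r)"]) auto
      then show ?thesis by (simp add: has_field_derivative_at_within)
    qed
  qed (use h r in \<open>auto simp: dist_norm\<close>)
  then show ?thesis by (simp add: algebra_simps power2_eq_square)
qed

text \<open>One constant serves all nearby base points and all coordinate directions; this
  uniformity is what the chain rule and the convergence of difference quotients rest on.\<close>

lemma hol_on_local_bound:
  assumes "hol_on n V f" "openin (cspace n) V" "x0 \<in> V"
  obtains r C where "r > 0" "C \<ge> 0" "pbox n x0 (3*r) \<subseteq> V"
    "\<And>y i h. y \<in> pbox n x0 r \<Longrightarrow> i < n \<Longrightarrow> cmod h < r \<Longrightarrow>
      cmod (f (y(i := y i + h)) - f y - pdv i f y * h) \<le> C * (cmod h)^2"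
proof -
  have "continuous_on V f" using assms by (simp add: hol_on_def)
  then obtain d where d: "d > 0" "pbox n x0 d \<subseteq> V" "\<And>y. y \<in> pbox n x0 d \<Longrightarrow> dist (f y) (f x0) < 1"
    using continuous_on_pboxD[OF _ assms(2,3), of f 1] by auto
  define M where "M = cmod (f x0) + 1"
  have M: "cmod (f y) \<le> M" if "y \<in> pbox n x0 d" for y
    using d(3)[OF that] norm_triangle_ineq2[of "f y" "f x0"] unfolding M_def dist_norm by linarith
  \<comment> \<open>From a point of the box of radius \<open>r\<close>, a disc of radius
    \<open>2 * r\<close> in one coordinate stays in the box of radius
    \<open>3 * r = d\<close>.\<close>
  define r where "r = d / 3"
  have r: "r > 0" "3 * r = d" using d by (auto simp: r_def)
  define C where "C = 2 * (M + 1) / r^2"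
  have "cmod (f (y(i := y i + h)) - f y - pdv i f y * h) \<le> C * (cmod h)^2"
    if y: "y \<in> pbox n x0 r" and i: "i < n" and h: "cmod h < r" for y i h
  proof -
    have in_box: "y(i := s) \<in> pbox n x0 d" if s: "s \<in> ball (y i) (2*r)" for s
    proof -
      have "cmod (s - x0 i) < d"
      proof -
        have "cmod (s - x0 i) \<le> cmod (s - y i) + cmod (y i - x0 i)"
          using norm_triangle_ineq[of "s - y i" "y i - x0 i"] by simp
        moreover have "cmod (s - y i) < 2 * r" using s by (simp add: dist_norm norm_minus_commute)
        moreover have "cmod (y i - x0 i) < r" using y i by (auto simp: pbox_def)
        ultimately show ?thesis using r by linarith
      qed
      moreover have "y \<in> pbox n x0 d" using pbox_mono[of r d] r y by auto
      ultimately show ?thesis using i by (auto simp: pbox_def cvec_def)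
    qed
    have "cmod ((\<lambda>s. f (y(i := s))) (y i + h) - (\<lambda>s. f (y(i := s))) (y i)
        - deriv (\<lambda>s. f (y(i := s))) (y i) * h) \<le> 2 * (M + 1) / r^2 * (cmod h)^2"
    proof (rule quadratic_bound)
      show "(\<lambda>s. f (y(i := s))) holomorphic_on ball (y i) (2 * r)"
        using assms(1) i by (rule hol_on_slice) (use in_box d in blast)
    qed (use r h in_box M in auto)
    then show ?thesis by (simp add: C_def pdv_def)
  qed
  moreover have "C \<ge> 0" unfolding C_def M_def using r
    by (intro divide_nonneg_nonneg mult_nonneg_nonneg) (auto intro: add_nonneg_nonneg)
  ultimately show ?thesis using that[of r C] r d by auto
qed

text \<open>Convergence of the difference quotients is uniform in all variables jointly. Continuity,
  holomorphy and symmetry of second partial derivatives are all read off from it.\<close>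

lemma pdv_uniform_limit:
  assumes "hol_on n V f" "openin (cspace n) V" "x0 \<in> V" "i < n"
  obtains r \<eta> where "r > 0" "pbox n x0 (3*r) \<subseteq> V" "\<And>m. \<eta> m \<noteq> 0" "\<And>m. cmod (\<eta> m) < r" "\<eta> \<longlonglongrightarrow> 0"
    "uniform_limit (pbox n x0 r) (\<lambda>m y. (f (y(i := y i + \<eta> m)) - f y) / \<eta> m) (pdv i f) sequentially"
proof -
  obtain r C where r: "r > 0" "C \<ge> 0" "pbox n x0 (3*r) \<subseteq> V" and
    est: "\<And>y i h. y \<in> pbox n x0 r \<Longrightarrow> i < n \<Longrightarrow> cmod h < r \<Longrightarrow>
      cmod (f (y(i := y i + h)) - f y - pdv i f y * h) \<le> C * (cmod h)^2"
    using hol_on_local_bound[OF assms(1-3)] by blast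
  \<comment> \<open>The summand 2 makes the increment strictly smaller than \<open>r\<close> already
    for \<open>m = 0\<close>.\<close>
  define \<eta> :: "nat \<Rightarrow> complex" where "\<eta> m = of_real (r / (real m + 2))" for m
  have e0: "\<eta> m \<noteq> 0" "cmod (\<eta> m) = r / (real m + 2)" "cmod (\<eta> m) < r" for m
  proof -
    show n: "cmod (\<eta> m) = r / (real m + 2)" unfolding \<eta>_def norm_of_real using r by simp
    have "r / (real m + 2) > 0" using r by simp
    then show "\<eta> m \<noteq> 0" using n by auto
    have "r * 1 < r * (real m + 2)" using r by (intro mult_strict_left_mono) auto
    then show "cmod (\<eta> m) < r" unfolding n by (simp add: field_simps)
  qed
  have lim: "(\<lambda>m. r / (real m + 2)) \<longlonglongrightarrow> 0"
    using LIMSEQ_ignore_initial_segment[OF lim_const_over_n[of r], of 2] by (simp add: add.commute)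
  have "\<eta> \<longlonglongrightarrow> 0"
    using tendsto_of_real[OF lim, where 'a=complex] unfolding \<eta>_def by (simp only: of_real_0)
  moreover have "uniform_limit (pbox n x0 r) (\<lambda>m y. (f (y(i := y i + \<eta> m)) - f y) / \<eta> m) (pdv i f) sequentially"
  proof (rule uniform_limitI)
    fix e :: real assume "e > 0"
    have "(\<lambda>m. C * (r / (real m + 2))) \<longlonglongrightarrow> C * 0" using lim by (intro tendsto_mult) auto
    then have "eventually (\<lambda>m. C * (r / (real m + 2)) < e) sequentially"
      using \<open>e > 0\<close> order_tendstoD(2) by fastforce
    then show "\<forall>\<^sub>F m in sequentially. \<forall>y\<in>pbox n x0 r. dist ((f (y(i := y i + \<eta> m)) - f y) / \<eta> m) (pdv i f y) < e"
    proof eventually_elim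
      case (elim m)
      show ?case
      proof
        fix y assume y: "y \<in> pbox n x0 r"
        have "(f (y(i := y i + \<eta> m)) - f y) / \<eta> m - pdv i f y =
            (f (y(i := y i + \<eta> m)) - f y - pdv i f y * \<eta> m) / \<eta> m"
          using e0 by (simp add: field_simps)
        then have "dist ((f (y(i := y i + \<eta> m)) - f y) / \<eta> m) (pdv i f y) =
            cmod (f (y(i := y i + \<eta> m)) - f y - pdv i f y * \<eta> m) / cmod (\<eta> m)"
          by (simp add: dist_norm norm_divide)
        also have "\<dots> \<le> C * (cmod (\<eta> m))^2 / cmod (\<eta> m)"
          by (intro divide_right_mono est y assms e0) auto
        also have "\<dots> = C * (r / (real m + 2))"
          using e0 by (simp add: power2_eq_square)
        also have "\<dots> < e" by (rule elim)
        finally show "dist ((f (y(i := y i + \<eta> m)) - f y) / \<eta> m) (pdv i f y) < e" .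
      qed
    qed
  qed
  ultimately show ?thesis using that[of r \<eta>] r e0 by blast
qed

lemma pbox_shift:
  assumes "y \<in> pbox n x0 r" "cmod h < r" "i < n"
  shows "y(i := y i + h) \<in> pbox n x0 (3*r)"
proof -
  have "r > 0" using assms(2) by (meson norm_ge_zero le_less_trans)
  have "cmod (y i + h - x0 i) \<le> cmod (y i - x0 i) + cmod h"
    using norm_triangle_ineq[of "y i - x0 i" h] by (simp add: algebra_simps)
  moreover have "cmod (y i - x0 i) < r" using assms by (auto simp: pbox_def)
  ultimately have "cmod (y i + h - x0 i) < 3 * r" using assms \<open>r > 0\<close> by linarith
  moreover have "y \<in> pbox n x0 (3*r)" using pbox_mono[of r "3*r" n x0] assms \<open>r > 0\<close> by auto
  ultimately show ?thesis using assms(3) by (auto simp: pbox_def cvec_def)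
qed

lemma difference_quotient_slice:
  assumes f: "hol_on n V f" and V: "pbox n x0 (3*r) \<subseteq> V" and h: "cmod h < r" "h \<noteq> 0"
    and i: "i < n" and k: "k < n" and y: "y \<in> pbox n x0 r"
  shows "(\<lambda>s. (f ((y(k := s))(i := (y(k := s)) i + h)) - f (y(k := s))) / h) holomorphic_on ball (x0 k) r"
    (is "?D holomorphic_on _")
proof -
  have mem: "y(k := s) \<in> pbox n x0 r" if "s \<in> ball (x0 k) r" for s
    using y k that by (auto simp: pbox_def cvec_def dist_norm norm_minus_commute)
  have mem': "y(k := s) \<in> V" if "s \<in> ball (x0 k) r" for s
    using mem[OF that] pbox_mono[of r "3*r" n x0] V h by (smt (verit) norm_ge_zero subsetD)
  have shift: "(y(k := s))(i := (y(k := s)) i + h) \<in> V" if "s \<in> ball (x0 k) r" for s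
    using pbox_shift[OF mem[OF that] h(1) i] V by blast
  have 1: "(\<lambda>s. f (y(k := s))) holomorphic_on ball (x0 k) r"
    using f k mem' by (rule hol_on_slice)
  have 2: "(\<lambda>s. f ((y(k := s))(i := (y(k := s)) i + h))) holomorphic_on ball (x0 k) r"
  proof (cases "k = i")
    case True
    have "(\<lambda>s. f (y(i := s))) holomorphic_on ((\<lambda>s. s + h) ` ball (x0 k) r)"
      using f i by (rule hol_on_slice) (use shift True in auto)
    then have "(\<lambda>s. f (y(i := s))) \<circ> (\<lambda>s. s + h) holomorphic_on ball (x0 k) r"
      by (intro holomorphic_on_compose holomorphic_intros) auto
    then show ?thesis using True by (simp add: o_def)
  next
    case False
    have "(\<lambda>s. f ((y(i := y i + h))(k := s))) holomorphic_on ball (x0 k) r"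
      using f k by (rule hol_on_slice) (use shift False in \<open>auto simp: fun_upd_twist\<close>)
    then show ?thesis using False by (simp add: fun_upd_twist)
  qed
  show ?thesis by (intro holomorphic_intros 1 2) (use h in auto)
qed

text \<open>Locally uniform limits preserve continuity and, by Weierstrass, holomorphy along each
  coordinate slice; both are applied to the difference quotients.\<close>

lemma hol_on_pdv_hol:
  assumes "hol_on n V f" "openin (cspace n) V" "i < n"
  shows "hol_on n V (pdv i f)"
  unfolding hol_on_def
proof (intro conjI ballI allI impI)
  have Vsub: "V \<subseteq> cvec n" using assms openin_cspace_sub by blast
  have *: "\<exists>d>0. pbox n x0 d \<subseteq> V \<and> continuous_on (pbox n x0 d) (pdv i f) \<and>
      (\<forall>k<n. (\<lambda>s. pdv i f (x0(k := s))) field_differentiable (at (x0 k)))" if x0: "x0 \<in> V" for x0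
  proof -
    obtain r \<eta> where r: "r > 0" "pbox n x0 (3*r) \<subseteq> V" "\<And>m. \<eta> m \<noteq> 0" "\<And>m. cmod (\<eta> m) < r" "\<eta> \<longlonglongrightarrow> 0"
      and ul: "uniform_limit (pbox n x0 r) (\<lambda>m y. (f (y(i := y i + \<eta> m)) - f y) / \<eta> m) (pdv i f) sequentially"
      by (rule pdv_uniform_limit[OF assms(1,2) x0 assms(3)]) (rule that, assumption+)
    have x0b: "x0 \<in> pbox n x0 r" using center_in_pbox[OF subsetD[OF Vsub x0] r(1)] .
    have sub: "pbox n x0 r \<subseteq> V" using pbox_mono[of r "3*r" n x0] r by auto
    have contf: "continuous_on V f" using assms by (simp add: hol_on_def)
    have "continuous_on (pbox n x0 r) (pdv i f)"
    proof (rule uniform_limit_theorem[OF _ ul])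
      have "continuous_on (pbox n x0 r) (\<lambda>y. (f (y(i := y i + \<eta> m)) - f y) / \<eta> m)" for m
      proof -
        have "continuous_on (pbox n x0 r) (\<lambda>y. y(i := y i + \<eta> m))"
        proof (rule continuous_on_coordinatewise_then_product)
          show "continuous_on (pbox n x0 r) (\<lambda>y. (y(i := y i + \<eta> m)) j)" for j
            by (cases "j = i") (auto intro!: continuous_intros continuous_on_coordinate)
        qed
        then have "continuous_on (pbox n x0 r) (\<lambda>y. f (y(i := y i + \<eta> m)))"
          by (rule continuous_on_compose2[OF contf]) (use pbox_shift r assms(3) in blast)
        then show ?thesis
          using r(3) continuous_on_subset[OF contf sub] by (intro continuous_intros) auto
      qed
      then show "\<forall>\<^sub>F m in sequentially. continuous_on (pbox n x0 r) (\<lambda>y. (f (y(i := y i + \<eta> m)) - f y) / \<eta> m)"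
        by simp
    qed auto
    moreover have "(\<lambda>s. pdv i f (x0(k := s))) field_differentiable (at (x0 k))" if k: "k < n" for k
    proof -
      have mem: "x0(k := s) \<in> pbox n x0 r" if "s \<in> ball (x0 k) r" for s
        using x0b k that by (auto simp: pbox_def cvec_def dist_norm norm_minus_commute)
      let ?D = "\<lambda>m s. (f ((x0(k := s))(i := (x0(k := s)) i + \<eta> m)) - f (x0(k := s))) / \<eta> m"
      have "(\<lambda>s. pdv i f (x0(k := s))) holomorphic_on ball (x0 k) r"
      proof (rule holomorphic_uniform_sequence[where f = ?D])
        show "?D m holomorphic_on ball (x0 k) r" for m
          using difference_quotient_slice[OF assms(1) r(2) r(4) r(3) assms(3) k x0b] .
        fix x assume "x \<in> ball (x0 k) r"
        then obtain d where d: "d > 0" "cball x d \<subseteq> ball (x0 k) r"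
          by (meson open_ball open_contains_cball)
        from d(2) have "uniform_limit (cball x d) ?D (\<lambda>s. pdv i f (x0(k := s))) sequentially"
          using mem uniform_limit_compose'[OF ul, of "\<lambda>s. x0(k := s)" "cball x d"] by blast
        then show "\<exists>d>0. cball x d \<subseteq> ball (x0 k) r \<and> uniform_limit (cball x d) ?D (\<lambda>s. pdv i f (x0(k := s))) sequentially"
          using d by blast
      qed auto
      then show ?thesis using r(1) by (simp add: holomorphic_on_imp_differentiable_at)
    qed
    ultimately show ?thesis using r(1) sub by blast
  qed
  show "continuous_on V (pdv i f)"
  proof (rule continuous_on_pboxI[OF Vsub])
    fix x :: "nat \<Rightarrow> complex" and e :: real assume x: "x \<in> V" "e > 0"
    obtain d where d: "d > 0" "continuous_on (pbox n x d) (pdv i f)" using *[OF x(1)] by blast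
    have "x \<in> pbox n x d" using center_in_pbox[OF subsetD[OF Vsub x(1)] d(1)] .
    then obtain d' where "d' > 0" "\<And>y. y \<in> pbox n x d' \<Longrightarrow> dist (pdv i f y) (pdv i f x) < e"
      using continuous_on_pboxD[OF d(2) openin_pbox _ x(2)] by blast
    then show "\<exists>d>0. \<forall>y\<in>V \<inter> pbox n x d. dist (pdv i f y) (pdv i f x) < e" by blast
  qed
  show "(\<lambda>s. pdv i f (x(k := s))) field_differentiable at (x k)" if "x \<in> V" "k < n" for x k
    using * that by blast
qed

text \<open>By uniform convergence on a disc, differentiation along \<open>k\<close> commutes with
  the limit of the difference quotients along \<open>i\<close>. Differentiated, these become
  difference quotients of \<open>pdv k f\<close>, whose limit is the other mixed derivative.\<close>

lemma pdv_commute: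
  assumes f: "hol_on n V f" and V: "openin (cspace n) V" and x0: "x0 \<in> V" and i: "i < n" and k: "k < n"
  shows "pdv k (pdv i f) x0 = pdv i (pdv k f) x0"
proof (cases "k = i")
  case False
  have Vsub: "V \<subseteq> cvec n" using V openin_cspace_sub by blast
  obtain r \<eta> where r: "r > 0" "pbox n x0 (3*r) \<subseteq> V" "\<And>m. \<eta> m \<noteq> 0" "\<And>m. cmod (\<eta> m) < r" "\<eta> \<longlonglongrightarrow> 0"
    and ul: "uniform_limit (pbox n x0 r) (\<lambda>m y. (f (y(i := y i + \<eta> m)) - f y) / \<eta> m) (pdv i f) sequentially"
    by (rule pdv_uniform_limit[OF f V x0 i]) (rule that, assumption+)
  have x0b: "x0 \<in> pbox n x0 r" using center_in_pbox[OF subsetD[OF Vsub x0] r(1)] .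
  have mem: "x0(k := s) \<in> pbox n x0 r" if "s \<in> ball (x0 k) r" for s
    using x0b k that by (auto simp: pbox_def cvec_def dist_norm norm_minus_commute)
  let ?D = "\<lambda>m s. (f ((x0(k := s))(i := (x0(k := s)) i + \<eta> m)) - f (x0(k := s))) / \<eta> m"
  have "uniform_limit (ball (x0 k) r) ?D (\<lambda>s. pdv i f (x0(k := s))) sequentially"
    using mem uniform_limit_compose'[OF ul, of "\<lambda>s. x0(k := s)" "ball (x0 k) r"] by blast
  moreover have "\<forall>\<^sub>F m in sequentially. ?D m holomorphic_on ball (x0 k) r"
    using difference_quotient_slice[OF f r(2) r(4) r(3) i k x0b] by simp
  ultimately have "(\<lambda>m. deriv (?D m) (x0 k)) \<longlonglongrightarrow> deriv (\<lambda>s. pdv i f (x0(k := s))) (x0 k)"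
    using r(1) by (intro deriv_complex_uniform_limit) auto
  moreover have "deriv (?D m) (x0 k) = (pdv k f (x0(i := x0 i + \<eta> m)) - pdv k f x0) / \<eta> m" for m
  proof (rule DERIV_imp_deriv)
    have 1: "((\<lambda>s. f (x0(k := s))) has_field_derivative pdv k f x0) (at (x0 k))"
      using hol_on_pdv[OF f x0 k] .
    have "x0(i := x0 i + \<eta> m) \<in> V" using pbox_shift[OF x0b r(4) i] r by blast
    from hol_on_pdv[OF f this k]
    have 2: "((\<lambda>s. f ((x0(k := s))(i := (x0(k := s)) i + \<eta> m))) has_field_derivative pdv k f (x0(i := x0 i + \<eta> m))) (at (x0 k))"
      using False by (simp add: fun_upd_twist)
    show "(?D m has_field_derivative (pdv k f (x0(i := x0 i + \<eta> m)) - pdv k f x0) / \<eta> m) (at (x0 k))"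
      by (intro DERIV_cdivide DERIV_diff 1 2)
  qed
  ultimately have A: "(\<lambda>m. (pdv k f (x0(i := x0 i + \<eta> m)) - pdv k f x0) / \<eta> m) \<longlonglongrightarrow> pdv k (pdv i f) x0"
    by (simp add: pdv_def)
  have "((\<lambda>s. pdv k f (x0(i := s))) has_field_derivative pdv i (pdv k f) x0) (at (x0 i))"
    using hol_on_pdv[OF hol_on_pdv_hol[OF f V k] x0 i] .
  then have "((\<lambda>h. (pdv k f (x0(i := x0 i + h)) - pdv k f x0) / h) \<longlongrightarrow> pdv i (pdv k f) x0) (at 0)"
    unfolding DERIV_def by simp
  then have B: "(\<lambda>m. (pdv k f (x0(i := x0 i + \<eta> m)) - pdv k f x0) / \<eta> m) \<longlonglongrightarrow> pdv i (pdv k f) x0"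
    by (rule filterlim_compose) (use r in \<open>auto simp: filterlim_at\<close>)
  show ?thesis using LIMSEQ_unique[OF A B] .
qed simp

section \<open>The chain rule in several variables\<close>

lemma eventually_pbox:
  assumes "\<And>i. i < n \<Longrightarrow> ((\<lambda>s. y s i) \<longlongrightarrow> x i) F" "eventually (\<lambda>s. y s \<in> cvec n) F" "r > 0"
  shows "eventually (\<lambda>s. y s \<in> pbox n x r) F"
proof -
  have "eventually (\<lambda>s. dist (y s i) (x i) < r) F" if "i < n" for i
    using assms(1)[OF that] assms(3) tendstoD by blast
  then have "eventually (\<lambda>s. \<forall>i\<in>{..<n}. dist (y s i) (x i) < r) F"
    by (intro eventually_ball_finite) auto
  with assms(2) show ?thesis
    by eventually_elim (auto simp: pbox_def dist_norm)
qed

lemma tendsto_continuous_cspace: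
  fixes g :: "(nat \<Rightarrow> complex) \<Rightarrow> 'b::metric_space"
  assumes "continuous_on V g" "openin (cspace n) V" "x \<in> V"
    "\<And>i. i < n \<Longrightarrow> ((\<lambda>s. y s i) \<longlongrightarrow> x i) F" "eventually (\<lambda>s. y s \<in> cvec n) F"
  shows "((\<lambda>s. g (y s)) \<longlongrightarrow> g x) F"
proof (rule tendstoI)
  fix e :: real assume "e > 0"
  then obtain d where d: "d > 0" "\<And>z. z \<in> pbox n x d \<Longrightarrow> dist (g z) (g x) < e"
    using continuous_on_pboxD[OF assms(1,2,3)] by metis
  have "eventually (\<lambda>s. y s \<in> pbox n x d) F"
    by (rule eventually_pbox) (use assms(4,5) d in auto)
  then show "eventually (\<lambda>s. dist (g (y s)) (g x) < e) F"
    by eventually_elim (use d in auto)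
qed

text \<open>The increment of \<open>f\<close> is split into increments along the coordinate axes, each of which is
  controlled by \<open>hol_on_local_bound\<close>.\<close>

lemma hol_on_chain:
  assumes f: "hol_on n V f" and V: "openin (cspace n) V"
    and u: "\<And>i. i < n \<Longrightarrow> ((\<lambda>s. u s i) has_field_derivative u' i) (at s0)"
    and ev: "eventually (\<lambda>s. u s \<in> cvec n) (nhds s0)" and x0: "u s0 \<in> V"
  shows "((\<lambda>s. f (u s)) has_field_derivative (\<Sum>i<n. pdv i f (u s0) * u' i)) (at s0)"
proof -
  define x0 where "x0 = u s0"
  have x0V: "x0 \<in> V" and x0c: "x0 \<in> cvec n" using x0 V openin_cspace_sub by (auto simp: x0_def)
  obtain r C where r: "r > 0" "C \<ge> 0" "pbox n x0 (3*r) \<subseteq> V"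
    and est: "\<And>y i h. y \<in> pbox n x0 r \<Longrightarrow> i < n \<Longrightarrow> cmod h < r \<Longrightarrow>
      cmod (f (y(i := y i + h)) - f y - pdv i f y * h) \<le> C * (cmod h)^2"
    by (rule hol_on_local_bound[OF f V x0V]) (rule that, assumption+)
  \<comment> \<open>\<open>y k s\<close> has the first \<open>k\<close> coordinates of
    \<open>u s\<close> and still the remaining ones of \<open>x0\<close>.\<close>
  define y where "y k s = (\<lambda>i. if i < k then u s i else x0 i)" for k s
  define \<Delta> where "\<Delta> k s = u s k - x0 k" for k s
  have ev': "eventually (\<lambda>s. u s \<in> cvec n) (at s0)" using ev eventually_nhds_conv_at by blast
  have lim_u: "((\<lambda>s. u s i) \<longlongrightarrow> x0 i) (at s0)" if "i < n" for i
    using DERIV_isCont[OF u[OF that]] by (simp add: isCont_def x0_def)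
  have lim_y: "((\<lambda>s. y k s i) \<longlongrightarrow> x0 i) (at s0)" if "i < n" for i k
    using lim_u[OF that] by (cases "i < k") (auto simp: y_def)
  have y_c: "eventually (\<lambda>s. y k s \<in> cvec n) (at s0)" for k
    using ev' by eventually_elim (use x0c in \<open>auto simp: cvec_def y_def\<close>)
  have y_box: "eventually (\<lambda>s. y k s \<in> pbox n x0 r) (at s0)" for k
    by (rule eventually_pbox[OF lim_y y_c r(1)])
  have step: "((\<lambda>s. (f (y (Suc k) s) - f (y k s)) / (s - s0)) \<longlongrightarrow> pdv k f x0 * u' k) (at s0)"
    if k: "k < n" for k
  proof -
    have lim_quot: "((\<lambda>s. \<Delta> k s / (s - s0)) \<longlongrightarrow> u' k) (at s0)"
      using u[OF k] by (simp add: has_field_derivative_iff \<Delta>_def x0_def)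
    have lim_\<Delta>: "(\<Delta> k \<longlongrightarrow> 0) (at s0)"
      using tendsto_diff[OF lim_u[OF k] tendsto_const[of "x0 k"]] by (simp add: \<Delta>_def[abs_def])
    have "((\<lambda>s. pdv k f (y k s)) \<longlongrightarrow> pdv k f x0) (at s0)"
      using hol_on_pdv_hol[OF f V k]
      by (intro tendsto_continuous_cspace[OF _ V x0V lim_y y_c]) (auto simp: hol_on_def)
    then have main: "((\<lambda>s. pdv k f (y k s) * (\<Delta> k s / (s - s0))) \<longlongrightarrow> pdv k f x0 * u' k) (at s0)"
      by (intro tendsto_mult lim_quot)
    have "eventually (\<lambda>s. cmod (\<Delta> k s) < r) (at s0)"
      using tendstoD[OF lim_\<Delta> r(1)] by (simp add: dist_norm)
    with y_box[of k] have "eventually (\<lambda>s. cmod ((f (y (Suc k) s) - f (y k s)) / (s - s0) - pdv k f (y k s) * (\<Delta> k s / (s - s0)))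
        \<le> cmod (\<Delta> k s / (s - s0)) * cmod (\<Delta> k s) * C) (at s0)"
    proof eventually_elim
      case (elim s)
      have "y (Suc k) s = (y k s)(k := y k s k + \<Delta> k s)"
        by (auto simp: y_def \<Delta>_def)
      then have "cmod (f (y (Suc k) s) - f (y k s) - pdv k f (y k s) * \<Delta> k s) \<le> C * (cmod (\<Delta> k s))^2"
        using est[OF elim(1) k elim(2)] by simp
      then have "cmod (f (y (Suc k) s) - f (y k s) - pdv k f (y k s) * \<Delta> k s) / cmod (s - s0)
          \<le> C * (cmod (\<Delta> k s))^2 / cmod (s - s0)"
        by (intro divide_right_mono) auto
      moreover have "(f (y (Suc k) s) - f (y k s)) / (s - s0) - pdv k f (y k s) * (\<Delta> k s / (s - s0)) =
          (f (y (Suc k) s) - f (y k s) - pdv k f (y k s) * \<Delta> k s) / (s - s0)"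
        by (simp only: diff_divide_distrib times_divide_eq_right)
      moreover have "cmod (\<Delta> k s / (s - s0)) * cmod (\<Delta> k s) * C = C * (cmod (\<Delta> k s))^2 / cmod (s - s0)"
        by (simp only: norm_divide power2_eq_square times_divide_eq_left times_divide_eq_right mult.commute mult.left_commute)
      ultimately show ?case by (simp only: norm_divide)
    qed
    moreover have "((\<lambda>s. cmod (\<Delta> k s / (s - s0)) * cmod (\<Delta> k s) * C) \<longlongrightarrow> cmod (u' k) * cmod 0 * C) (at s0)"
      by (intro tendsto_intros lim_quot lim_\<Delta>)
    ultimately have "((\<lambda>s. (f (y (Suc k) s) - f (y k s)) / (s - s0) - pdv k f (y k s) * (\<Delta> k s / (s - s0))) \<longlongrightarrow> 0) (at s0)"
      unfolding norm_zero mult_zero_right mult_zero_left by (rule Lim_null_comparison)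
    from tendsto_add[OF this main] show ?thesis by simp
  qed
  have "((\<lambda>s. \<Sum>k<n. (f (y (Suc k) s) - f (y k s)) / (s - s0)) \<longlongrightarrow> (\<Sum>k<n. pdv k f x0 * u' k)) (at s0)"
    by (intro tendsto_sum step) auto
  moreover have "eventually (\<lambda>s. (\<Sum>k<n. (f (y (Suc k) s) - f (y k s)) / (s - s0)) = (f (u s) - f x0) / (s - s0)) (at s0)"
    using ev'
  proof eventually_elim
    case (elim s)
    have "y n s = u s" using elim x0c by (auto simp: y_def cvec_def)
    moreover have "y 0 s = x0" by (auto simp: y_def)
    moreover have "(\<Sum>k<n. f (y (Suc k) s) - f (y k s)) = f (y n s) - f (y 0 s)"
      by (rule sum_lessThan_telescope)
    ultimately show ?case by (simp add: sum_divide_distrib[symmetric])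
  qed
  ultimately have "((\<lambda>s. (f (u s) - f x0) / (s - s0)) \<longlongrightarrow> (\<Sum>k<n. pdv k f x0 * u' k)) (at s0)"
    by (rule Lim_transform_eventually)
  then show ?thesis by (simp add: has_field_derivative_iff x0_def)
qed

section \<open>Locality, composition and arithmetic of holomorphic functions\<close>

lemma hol_on_subset: "hol_on n V f \<Longrightarrow> U \<subseteq> V \<Longrightarrow> hol_on n U f"
  unfolding hol_on_def by (meson continuous_on_subset subsetD)

lemma hol_on_cong:
  assumes "openin (cspace n) V" "\<And>x. x \<in> V \<Longrightarrow> f x = g x" "hol_on n V f"
  shows "hol_on n V g"
  unfolding hol_on_def
proof (intro conjI ballI allI impI)
  show "continuous_on V g" using assms(2,3) continuous_on_cong[of V V f g] by (auto simp: hol_on_def)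
  fix x i assume x: "x \<in> V" "i < n"
  have ev: "eventually (\<lambda>s. f (x(i := s)) = g (x(i := s))) (nhds (x i))"
    using slice_nhd[OF assms(1) x] by eventually_elim (use assms in auto)
  have "((\<lambda>s. g (x(i := s))) has_field_derivative pdv i f x) (at (x i))"
    by (rule iffD1[OF DERIV_cong_ev[OF refl ev refl] hol_on_pdv[OF assms(3) x]])
  then show "(\<lambda>s. g (x(i := s))) field_differentiable (at (x i))"
    using field_differentiable_def by blast
qed

lemma hol_on_local:
  assumes V: "openin (cspace n) V"
    and loc: "\<And>x. x \<in> V \<Longrightarrow> \<exists>U. openin (cspace n) U \<and> x \<in> U \<and> hol_on n (U \<inter> V) f"
  shows "hol_on n V f"
  unfolding hol_on_def
proof (intro conjI ballI allI impI)
  show "continuous_on V f"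
  proof (rule continuous_on_pboxI[OF openin_cspace_sub[OF V]])
    fix x :: "nat \<Rightarrow> complex" and e :: real assume x: "x \<in> V" "e > 0"
    then obtain U where U: "openin (cspace n) U" "x \<in> U" "hol_on n (U \<inter> V) f" using loc by blast
    have c: "continuous_on (U \<inter> V) f" using U by (simp add: hol_on_def)
    have o: "openin (cspace n) (U \<inter> V)" using U V by blast
    obtain d where "d > 0" "\<And>y. y \<in> pbox n x d \<Longrightarrow> dist (f y) (f x) < e"
      using continuous_on_pboxD[OF c o _ x(2)] x U(2) by (metis IntI)
    then show "\<exists>d>0. \<forall>y\<in>V \<inter> pbox n x d. dist (f y) (f x) < e" by blast
  qed
  fix x i assume "x \<in> V" "i < n"
  then show "(\<lambda>s. f (x(i := s))) field_differentiable (at (x i))"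
    using loc[of x] unfolding hol_on_def by blast
qed

lemma hol_on_compose_aux:
  assumes f: "hol_on m V' f" and V': "openin (cspace m) V'" and V: "openin (cspace n) V"
    and G: "\<And>x. x \<in> V \<Longrightarrow> G x \<in> V'" and Gh: "\<And>i. i < m \<Longrightarrow> hol_on n V (\<lambda>x. G x i)"
    and x: "x \<in> V" and k: "k < n"
  shows "((\<lambda>s. f (G (x(k := s)))) has_field_derivative (\<Sum>i<m. pdv i f (G x) * pdv k (\<lambda>x. G x i) x)) (at (x k))"
proof -
  have "eventually (\<lambda>s. G (x(k := s)) \<in> cvec m) (nhds (x k))"
    using slice_nhd[OF V x k] by eventually_elim (use G openin_cspace_sub[OF V'] in auto)
  from hol_on_chain[OF f V' _ this] show ?thesis
    using hol_on_pdv[OF Gh x k] G[OF x] by simp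
qed

lemma continuous_on_cvec_valued:
  assumes G: "\<And>x. x \<in> V \<Longrightarrow> G x \<in> cvec m" and Gh: "\<And>i. i < m \<Longrightarrow> hol_on n V (\<lambda>x. G x i)"
  shows "continuous_on V G"
proof (rule continuous_on_coordinatewise_then_product)
  fix i show "continuous_on V (\<lambda>x. G x i)"
  proof (cases "i < m")
    case False
    then have "G x i = 0" if "x \<in> V" for x using G[OF that] by (auto simp: cvec_def)
    then show ?thesis using continuous_on_cong[of V V "\<lambda>x. G x i" "\<lambda>x. 0"] by auto
  qed (use Gh in \<open>auto simp: hol_on_def\<close>)
qed

lemma open_cvec: "openin (cspace n) (cvec n)" by (metis openin_topspace topspace_cspace)

lemma hol_preimage_open:
  assumes V: "openin (cspace n) V" and G: "\<And>x. x \<in> V \<Longrightarrow> G x \<in> cvec m"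
    and Gh: "\<And>i. i < m \<Longrightarrow> hol_on n V (\<lambda>x. G x i)" and S: "openin (cspace m) S"
  shows "openin (cspace n) {x\<in>V. G x \<in> S}"
proof -
  obtain T where T: "open T" "S = T \<inter> cvec m" using S by (auto simp: cspace_def openin_subtopology)
  have "continuous_on V G" by (rule continuous_on_cvec_valued[OF G Gh])
  then have "openin (cspace n) {x\<in>V. G x \<in> T}" by (rule continuous_preimage_cspace[OF _ V T(1)])
  moreover have "{x\<in>V. G x \<in> T} = {x\<in>V. G x \<in> S}" using T(2) G by auto
  ultimately show ?thesis by simp
qed

lemma hol_on_compose:
  assumes f: "hol_on m V' f" and V': "openin (cspace m) V'" and V: "openin (cspace n) V"
    and G: "\<And>x. x \<in> V \<Longrightarrow> G x \<in> V'" and Gh: "\<And>i. i < m \<Longrightarrow> hol_on n V (\<lambda>x. G x i)"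
  shows "hol_on n V (\<lambda>x. f (G x))"
  unfolding hol_on_def
proof (intro conjI ballI allI impI)
  have "G x \<in> cvec m" if "x \<in> V" for x using G[OF that] openin_cspace_sub[OF V'] by blast
  then have "continuous_on V G" using Gh by (rule continuous_on_cvec_valued)
  moreover have "continuous_on V' f" using f by (simp add: hol_on_def)
  ultimately show "continuous_on V (\<lambda>x. f (G x))"
    using continuous_on_compose2[of V' f V G] G by blast
  show "(\<lambda>s. f (G (x(k := s)))) field_differentiable (at (x k))" if "x \<in> V" "k < n" for x k
    using hol_on_compose_aux[OF f V' V G Gh that] field_differentiable_def by blast
qed

lemma pdv_compose:
  assumes f: "hol_on m V' f" and V': "openin (cspace m) V'" and V: "openin (cspace n) V"
    and G: "\<And>x. x \<in> V \<Longrightarrow> G x \<in> V'" and Gh: "\<And>i. i < m \<Longrightarrow> hol_on n V (\<lambda>x. G x i)"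
    and x: "x \<in> V" and k: "k < n"
  shows "pdv k (\<lambda>x. f (G x)) x = (\<Sum>i<m. pdv i f (G x) * pdv k (\<lambda>x. G x i) x)"
  unfolding pdv_def[of k "\<lambda>x. f (G x)"]
  using DERIV_imp_deriv[OF hol_on_compose_aux[OF f V' V G Gh x k]] .

lemma hol_on_const [intro]: "hol_on n V (\<lambda>x. c)"
  by (simp add: hol_on_def)

lemma hol_on_coord [intro]: "hol_on n V (\<lambda>x. x i)"
  unfolding hol_on_def
proof (intro conjI ballI allI impI)
  show "(\<lambda>s. (x(k := s)) i) field_differentiable (at (x k))" for x :: "nat \<Rightarrow> complex" and k
    by (cases "k = i") auto
qed (rule continuous_on_coordinate)

lemma hol_on_add: "hol_on n V f \<Longrightarrow> hol_on n V g \<Longrightarrow> hol_on n V (\<lambda>x. f x + g x)"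
  unfolding hol_on_def by (auto intro!: continuous_intros field_differentiable_add)

lemma hol_on_minus: "hol_on n V f \<Longrightarrow> hol_on n V (\<lambda>x. - f x)"
  unfolding hol_on_def by (auto intro!: continuous_intros field_differentiable_minus)

lemma hol_on_diff: "hol_on n V f \<Longrightarrow> hol_on n V g \<Longrightarrow> hol_on n V (\<lambda>x. f x - g x)"
  unfolding hol_on_def by (auto intro!: continuous_intros field_differentiable_diff)

lemma hol_on_mult: "hol_on n V f \<Longrightarrow> hol_on n V g \<Longrightarrow> hol_on n V (\<lambda>x. f x * g x)"
  unfolding hol_on_def by (auto intro!: continuous_intros field_differentiable_mult)

lemma hol_on_divide:
  "hol_on n V f \<Longrightarrow> hol_on n V g \<Longrightarrow> (\<And>x. x \<in> V \<Longrightarrow> g x \<noteq> 0) \<Longrightarrow> hol_on n V (\<lambda>x. f x / g x)"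
  unfolding hol_on_def by (auto intro!: continuous_intros field_differentiable_divide)

lemma hol_on_power: "hol_on n V f \<Longrightarrow> hol_on n V (\<lambda>x. f x ^ k)"
  by (induction k) (auto intro: hol_on_mult)

lemma hol_on_sum: "(\<And>i. i \<in> I \<Longrightarrow> hol_on n V (f i)) \<Longrightarrow> hol_on n V (\<lambda>x. \<Sum>i\<in>I. f i x)"
  by (induction I rule: infinite_finite_induct) (auto intro: hol_on_add)

lemmas hol_on_intros = hol_on_const hol_on_coord hol_on_add hol_on_minus hol_on_diff hol_on_mult
  hol_on_divide hol_on_power hol_on_sum

lemma pdv_eqI: "((\<lambda>s. f (x(i := s))) has_field_derivative D) (at (x i)) \<Longrightarrow> pdv i f x = D"
  unfolding pdv_def by (rule DERIV_imp_deriv)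

lemma pdv_const [simp]: "pdv i (\<lambda>x. c) x = 0"
  by (simp add: pdv_def)

lemma pdv_coord: "pdv i (\<lambda>x. x j) x = (if i = j then 1 else 0)"
  by (simp add: pdv_def)

lemma pdv_add:
  "hol_on n V f \<Longrightarrow> hol_on n V g \<Longrightarrow> x \<in> V \<Longrightarrow> i < n \<Longrightarrow> pdv i (\<lambda>x. f x + g x) x = pdv i f x + pdv i g x"
  by (intro pdv_eqI DERIV_add hol_on_pdv)

lemma pdv_diff:
  "hol_on n V f \<Longrightarrow> hol_on n V g \<Longrightarrow> x \<in> V \<Longrightarrow> i < n \<Longrightarrow> pdv i (\<lambda>x. f x - g x) x = pdv i f x - pdv i g x"
  by (intro pdv_eqI DERIV_diff hol_on_pdv)

lemma pdv_mult:
  assumes "hol_on n V f" "hol_on n V g" "x \<in> V" "i < n"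
  shows "pdv i (\<lambda>x. f x * g x) x = pdv i f x * g x + f x * pdv i g x"
  using DERIV_mult[OF hol_on_pdv[OF assms(1,3,4)] hol_on_pdv[OF assms(2,3,4)]]
  by (intro pdv_eqI) (simp add: mult.commute)

lemma pdv_cmult: "hol_on n V f \<Longrightarrow> x \<in> V \<Longrightarrow> i < n \<Longrightarrow> pdv i (\<lambda>x. c * f x) x = c * pdv i f x"
  by (intro pdv_eqI DERIV_cmult hol_on_pdv)

section \<open>Charts\<close>

context
  fixes n :: nat and T :: "'a topology" and c :: "'a chart"
  assumes c: "is_chart n T c"
begin

lemma chart_open_dom: "openin T (fst c)"
  using c by (simp add: is_chart_def)

lemma chart_open_range: "openin (cspace n) (snd c ` fst c)"
  using c by (simp add: is_chart_def)

lemma chart_homeo: "homeomorphic_map (subtopology T (fst c)) (subtopology (cspace n) (snd c ` fst c)) (snd c)"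
  using c by (simp add: is_chart_def)

lemma chart_topspace: "topspace (subtopology T (fst c)) = fst c"
  using openin_subset[OF chart_open_dom] by auto

lemma chart_inj: "inj_on (snd c) (fst c)"
  using homeomorphic_imp_injective_map[OF chart_homeo] chart_topspace by simp

lemma chart_inv_snd: "p \<in> fst c \<Longrightarrow> chart_inv c (snd c p) = p"
  by (simp add: chart_inv_def inv_into_f_f chart_inj)

lemma snd_chart_inv: "x \<in> snd c ` fst c \<Longrightarrow> snd c (chart_inv c x) = x"
  by (simp add: chart_inv_def f_inv_into_f)

lemma chart_open_image:
  assumes "openin T S"
  shows "openin (cspace n) (snd c ` (S \<inter> fst c))"
proof -
  have "openin (subtopology T (fst c)) (S \<inter> fst c)"
    using assms by (auto simp: openin_subtopology)
  then have "openin (subtopology (cspace n) (snd c ` fst c)) (snd c ` (S \<inter> fst c))"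
    using homeomorphic_imp_open_map[OF chart_homeo] by (auto simp: open_map_def)
  then show ?thesis using openin_trans_full chart_open_range by blast
qed

lemma chart_range_cvec: "p \<in> fst c \<Longrightarrow> snd c p \<in> cvec n"
  using openin_cspace_sub[OF chart_open_range] by blast

lemma pd_coord: "p \<in> fst c \<Longrightarrow> i < n \<Longrightarrow> pd c i (\<lambda>q. snd c q a) p = (if i = a then 1 else 0)"
proof -
  assume p: "p \<in> fst c" and i: "i < n"
  have "pd c i (\<lambda>q. snd c q a) p = pdv i (\<lambda>x. snd c (chart_inv c x) a) (snd c p)"
    by (simp add: pd_def pdv_def)
  also have "\<dots> = pdv i (\<lambda>x. x a) (snd c p)"
    by (rule pdv_cong[OF chart_open_range]) (use p i snd_chart_inv in auto)
  finally show ?thesis by (simp add: pdv_coord)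
qed

lemma pd_cong:
  assumes p: "p \<in> S" "p \<in> fst c" and S: "openin T S" and i: "i < n"
    and eq: "\<And>q. q \<in> S \<Longrightarrow> q \<in> fst c \<Longrightarrow> u q = w q"
  shows "pd c i u p = pd c i w p"
proof -
  have "pdv i (\<lambda>x. u (chart_inv c x)) (snd c p) = pdv i (\<lambda>x. w (chart_inv c x)) (snd c p)"
    by (rule pdv_cong[OF chart_open_image[OF S]]) (use p i eq in \<open>auto simp: chart_inv_snd\<close>)
  then show ?thesis by (simp add: pd_def pdv_def)
qed

end

lemma pd_pdv: "pd c i u p = pdv i (\<lambda>x. u (chart_inv c x)) (snd c p)"
  by (simp add: pd_def pdv_def)

lemma is_chartI:
  assumes U: "openin T U" and inj: "inj_on h U"
    and im: "\<And>S. openin T S \<Longrightarrow> S \<subseteq> U \<Longrightarrow> openin (cspace n) (h ` S)"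
    and pre: "\<And>S. openin (cspace n) S \<Longrightarrow> S \<subseteq> h ` U \<Longrightarrow> openin T {p\<in>U. h p \<in> S}"
  shows "is_chart n T (U, h)"
  unfolding is_chart_def fst_conv snd_conv
proof (intro conjI U im order_refl)
  have hU: "openin (cspace n) (h ` U)" using im[OF U] by simp
  have ts: "topspace (subtopology T U) = U" "topspace (subtopology (cspace n) (h ` U)) = h ` U"
    using openin_subset[OF U] openin_cspace_sub[OF hU] by auto
  show "homeomorphic_map (subtopology T U) (subtopology (cspace n) (h ` U)) h"
  proof (rule bijective_open_imp_homeomorphic_map)
    show "continuous_map (subtopology T U) (subtopology (cspace n) (h ` U)) h"
      unfolding continuous_map_def ts
    proof (intro conjI allI impI)
      fix S assume "openin (subtopology (cspace n) (h ` U)) S"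
      then have "openin (cspace n) S" "S \<subseteq> h ` U"
        using openin_trans_full[OF _ hU] openin_subset[of "subtopology (cspace n) (h ` U)"] unfolding ts by auto
      then have "openin T {p \<in> U. h p \<in> S}" using pre by blast
      then show "openin (subtopology T U) {p \<in> U. h p \<in> S}"
        using openin_subtopology_Int[of T "{p \<in> U. h p \<in> S}" U] by (simp add: Int_absorb2 subset_iff)
    qed auto
    show "open_map (subtopology T U) (subtopology (cspace n) (h ` U)) h"
      unfolding open_map_def
    proof (intro allI impI)
      fix S assume "openin (subtopology T U) S"
      then have S: "openin T S" "S \<subseteq> U"
        using openin_trans_full[OF _ U] openin_subset[of "subtopology T U"] unfolding ts by auto
      then have "openin (cspace n) (h ` S)" using im by blast
      then show "openin (subtopology (cspace n) (h ` U)) (h ` S)"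
        using openin_subtopology_Int[of "cspace n" "h ` S" "h ` U"] S by (simp add: Int_absorb2 image_mono)
    qed
  qed (simp_all only: ts inj)
qed

lemma max_atlas_chart: "c \<in> max_atlas M \<Longrightarrow> is_chart (mdim M) (mtop M) c"
  unfolding max_atlas_def by blast

lemma chart_dom_points: "c \<in> max_atlas M \<Longrightarrow> fst c \<subseteq> points M"
  using chart_open_dom[OF max_atlas_chart] openin_subset by blast

text \<open>Charts of the Hopf surface and of the fibre are both local inverses of a map defined on
  \<open>W\<close>. This form treats them together, with \<open>f\<close> the quotient map or its
  composite with the identification of the fibre.\<close>

definition inv_chart :: "((nat \<Rightarrow> complex) \<Rightarrow> 'a) \<Rightarrow> (nat \<Rightarrow> complex) set \<Rightarrow> 'a chart" where
  "inv_chart f U = (f ` U, inv_into U f)"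

context
  fixes f :: "(nat \<Rightarrow> complex) \<Rightarrow> 'a" and U :: "(nat \<Rightarrow> complex) set"
  assumes inj: "inj_on f U"
begin

lemma inv_chart_snd: "x \<in> U \<Longrightarrow> snd (inv_chart f U) (f x) = x"
  by (simp add: inv_chart_def inj)

lemma inv_chart_inv: "x \<in> U \<Longrightarrow> chart_inv (inv_chart f U) x = f x"
  unfolding chart_inv_def inv_chart_def fst_conv snd_conv
  by (rule inv_into_f_eq) (auto simp: inj inj_on_inv_into)

lemma inv_chart_range: "snd (inv_chart f U) ` (S \<inter> f ` U) = {x\<in>U. f x \<in> S}"
proof (intro set_eqI iffI)
  fix x assume "x \<in> snd (inv_chart f U) ` (S \<inter> f ` U)"
  then obtain y where "y \<in> U" "f y \<in> S" "x = snd (inv_chart f U) (f y)" by auto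
  then show "x \<in> {x\<in>U. f x \<in> S}" using inv_chart_snd by simp
next
  fix x assume "x \<in> {x\<in>U. f x \<in> S}"
  then show "x \<in> snd (inv_chart f U) ` (S \<inter> f ` U)"
    by (intro image_eqI[of _ _ "f x"]) (auto simp: inv_chart_snd)
qed

lemma inv_chart_is_chart:
  assumes U: "openin (cspace n) U"
    and im: "\<And>S. openin (cspace n) S \<Longrightarrow> S \<subseteq> U \<Longrightarrow> openin T (f ` S)"
    and pre: "\<And>S. openin T S \<Longrightarrow> openin (cspace n) {x\<in>U. f x \<in> S}"
  shows "is_chart n T (inv_chart f U)"
  unfolding inv_chart_def
proof (rule is_chartI)
  show "openin T (f ` U)" using im U by simp
  show "inj_on (inv_into U f) (f ` U)" by (simp add: inj_on_inv_into)
  fix S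
  { assume S: "openin T S" "S \<subseteq> f ` U"
    then have "inv_into U f ` S = {x\<in>U. f x \<in> S}"
      using inv_chart_range[of S] by (simp add: inv_chart_def Int_absorb2)
    then show "openin (cspace n) (inv_into U f ` S)" using pre[OF S(1)] by simp }
  { assume S: "openin (cspace n) S" "S \<subseteq> inv_into U f ` f ` U"
    have "S \<subseteq> U" using S(2) inj by auto
    then have "{q \<in> f ` U. inv_into U f q \<in> S} = f ` S" using inj by auto
    then show "openin T {q \<in> f ` U. inv_into U f q \<in> S}" using im[OF S(1) \<open>S \<subseteq> U\<close>] by simp }
qed

end

context
  fixes M :: "'a cmanifold"
  assumes M: "complex_manifold M"
begin

lemma matlas_max_atlas: "c \<in> matlas M \<Longrightarrow> c \<in> max_atlas M"
  using M unfolding complex_manifold_def max_atlas_def by blast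

lemma max_atlas_cover:
  assumes "p \<in> points M"
  obtains c where "c \<in> matlas M" "c \<in> max_atlas M" "p \<in> fst c"
proof -
  have "p \<in> (\<Union>c\<in>matlas M. fst c)" using M assms by (simp add: complex_manifold_def)
  then show ?thesis using that matlas_max_atlas by blast
qed

text \<open>Members of the maximal atlas are by definition compatible only with charts of the atlas.
  Near each point the transition is factored through such a chart \<open>b\<close>.\<close>

lemma max_atlas_transition:
  assumes c: "c \<in> max_atlas M" and d: "d \<in> max_atlas M" and a: "a < mdim M"
  shows "hol_on (mdim M) (snd c ` (fst c \<inter> fst d)) (\<lambda>x. snd d (chart_inv c x) a)"
proof (rule hol_on_local)
  note cc = max_atlas_chart[OF c] and cd = max_atlas_chart[OF d]
  show o: "openin (cspace (mdim M)) (snd c ` (fst c \<inter> fst d))"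
    using chart_open_image[OF cc chart_open_dom[OF cd]] by (simp add: Int_commute)
  fix x assume "x \<in> snd c ` (fst c \<inter> fst d)"
  then obtain p where p: "x = snd c p" "p \<in> fst c" "p \<in> fst d" by blast
  then obtain b where b: "b \<in> matlas M" "b \<in> max_atlas M" "p \<in> fst b"
    using max_atlas_cover chart_dom_points[OF c] by blast
  note cb = max_atlas_chart[OF b(2)]
  define S where "S = fst c \<inter> fst d \<inter> fst b"
  have So: "openin (mtop M) S"
    unfolding S_def using chart_open_dom cc cd cb by blast
  have 1: "hol_on (mdim M) (snd c ` S) (\<lambda>x. snd b (chart_inv c x) i)" if "i < mdim M" for i
  proof -
    have "hol_on (mdim M) (snd c ` (fst c \<inter> fst b)) (\<lambda>x. snd b (chart_inv c x) i)"
      using c b that unfolding max_atlas_def compatible_def hol_transition_def by blast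
    then show ?thesis by (rule hol_on_subset) (auto simp: S_def)
  qed
  have 2: "hol_on (mdim M) (snd b ` S) (\<lambda>x. snd d (chart_inv b x) a)"
  proof -
    have "hol_on (mdim M) (snd b ` (fst b \<inter> fst d)) (\<lambda>x. snd d (chart_inv b x) a)"
      using d b a unfolding max_atlas_def compatible_def hol_transition_def by blast
    then show ?thesis by (rule hol_on_subset) (auto simp: S_def)
  qed
  have oS: "openin (cspace (mdim M)) (snd c ` S)" "openin (cspace (mdim M)) (snd b ` S)"
    using chart_open_image[OF cc So] chart_open_image[OF cb So] by (simp_all add: S_def Int_absorb2 inf_assoc inf_commute inf_left_commute)
  have "hol_on (mdim M) (snd c ` S) (\<lambda>x. snd d (chart_inv b (snd b (chart_inv c x))) a)"
    by (rule hol_on_compose[OF 2 oS(2) oS(1) _ 1]) (auto simp: S_def chart_inv_snd[OF cc])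
  then have "hol_on (mdim M) (snd c ` S) (\<lambda>x. snd d (chart_inv c x) a)"
    by (rule hol_on_cong[OF oS(1), rotated]) (auto simp: S_def chart_inv_snd[OF cc] chart_inv_snd[OF cb])
  moreover have "snd c ` S \<inter> snd c ` (fst c \<inter> fst d) = snd c ` S" by (auto simp: S_def)
  ultimately show "\<exists>U. openin (cspace (mdim M)) U \<and> x \<in> U \<and>
      hol_on (mdim M) (U \<inter> snd c ` (fst c \<inter> fst d)) (\<lambda>x. snd d (chart_inv c x) a)"
    using oS(1) p b(3) by (intro exI[of _ "snd c ` S"]) (auto simp: S_def)
qed

end

section \<open>Diagonal contractions\<close>

locale diagonal_hopf =
  fixes p :: nat and \<delta> :: complex
  assumes p: "1 \<le> p" and \<delta>0: "0 < cmod \<delta>" and \<delta>1: "cmod \<delta> < 1"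
begin

text \<open>Iterates with integer exponents, so that \<open>hopf_orbit\<close> becomes the orbit of
  a group action.\<close>

definition act :: "int \<Rightarrow> (nat \<Rightarrow> complex) \<Rightarrow> nat \<Rightarrow> complex" where
  "act k x = (\<lambda>i. 0)(0 := (\<delta> ^ p) powi k * x 0, 1 := \<delta> powi k * x 1)"

text \<open>\<open>act 1\<close> raises \<open>lev\<close> by one, so \<open>W\<close> is cut into fundamental domains by the integral levels.\<close>

definition lev :: "(nat \<Rightarrow> complex) \<Rightarrow> real" where
  "lev x = ln (cmod (x 0) ^ 2 + cmod (x 1) ^ (2 * p)) / (2 * p * ln (cmod \<delta>))"

abbreviation "orb \<equiv> hopf_orbit (hopf_III_map p \<delta>)"
abbreviation "hopfX \<equiv> hopf_quotient (hopf_III_map p \<delta>)"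
abbreviation "htop \<equiv> hopf_topology (hopf_III_map p \<delta>)"
abbreviation "W \<equiv> punctured_C2"

lemma \<delta>_nz [simp]: "\<delta> \<noteq> 0" using \<delta>0 by auto

lemma W_iff: "x \<in> W \<longleftrightarrow> x \<in> cvec 2 \<and> (x 0 \<noteq> 0 \<or> x 1 \<noteq> 0)"
proof -
  have "x = (\<lambda>i. 0) \<longleftrightarrow> x 0 = 0 \<and> x 1 = 0" if "x \<in> cvec 2"
    using that by (auto simp: cvec_def fun_eq_iff) (metis One_nat_def less_2_cases not_less)
  then show ?thesis by (auto simp: punctured_C2_def)
qed

lemma W_cvec: "x \<in> W \<Longrightarrow> x \<in> cvec 2" by (simp add: W_iff)

lemma openin_W: "openin (cspace 2) W"
proof -
  have 1: "continuous_on (cvec 2) (\<lambda>x::nat\<Rightarrow>complex. x i)" for i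
    by (rule continuous_on_coordinate)
  have op: "openin (cspace 2) (cvec 2)" by (metis openin_topspace topspace_cspace)
  have "openin (cspace 2) {x\<in>cvec 2. x i \<in> - {0}}" for i
    by (rule continuous_preimage_cspace[OF 1 op]) auto
  then have "openin (cspace 2) ({x\<in>cvec 2. x 0 \<in> - {0}} \<union> {x\<in>cvec 2. x 1 \<in> - {0}})" by blast
  moreover have "W = {x\<in>cvec 2. x 0 \<in> - {0}} \<union> {x\<in>cvec 2. x 1 \<in> - {0}}" by (auto simp: W_iff)
  ultimately show ?thesis by simp
qed

lemma act_coord [simp]: "act k x 0 = (\<delta> ^ p) powi k * x 0" "act k x (Suc 0) = \<delta> powi k * x (Suc 0)"
  by (auto simp: act_def)

lemma act_cvec: "act k x \<in> cvec 2" by (auto simp: act_def cvec_def)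

lemma cvec2_eqI: "x \<in> cvec 2 \<Longrightarrow> y \<in> cvec 2 \<Longrightarrow> x 0 = y 0 \<Longrightarrow> x 1 = y 1 \<Longrightarrow> x = y"
  by (rule cvec_eqI) (auto simp: less_2_cases_iff)

lemma act_0: "x \<in> cvec 2 \<Longrightarrow> act 0 x = x"
  by (rule cvec2_eqI) (auto intro: act_cvec)

lemma act_add: "act (j + k) x = act j (act k x)"
  by (rule cvec2_eqI) (auto intro: act_cvec simp: power_int_add)

lemma act_W: "x \<in> W \<Longrightarrow> act k x \<in> W"
  by (auto simp: W_iff act_cvec)

lemma act_inv: "x \<in> cvec 2 \<Longrightarrow> act (- k) (act k x) = x" "x \<in> cvec 2 \<Longrightarrow> act k (act (- k) x) = x"
  using act_add[of "-k" k x] act_add[of k "-k" x] act_0 by simp_all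

lemma act_funpow: "x \<in> cvec 2 \<Longrightarrow> (hopf_III_map p \<delta> ^^ k) x = act (int k) x"
proof (induction k)
  case (Suc k)
  have "hopf_III_map p \<delta> y = act 1 y" for y by (simp add: hopf_III_map_def act_def)
  then show ?case using Suc act_add[of 1 "int k" x] by simp
qed (simp add: act_0)

lemma orb_eq: "x \<in> W \<Longrightarrow> orb x = {y. \<exists>k. y = act k x}"
proof (intro set_eqI iffI)
  fix y assume x: "x \<in> W" and "y \<in> orb x"
  then obtain k where y: "y \<in> W" and "y = (hopf_III_map p \<delta> ^^ k) x \<or> x = (hopf_III_map p \<delta> ^^ k) y"
    unfolding hopf_orbit_def by blast
  then have "y = act (int k) x \<or> x = act (int k) y"
    using x by (simp add: act_funpow W_cvec)
  then show "y \<in> {y. \<exists>k. y = act k x}"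
    using act_inv(1)[OF W_cvec[OF y], of "int k"] by (metis (mono_tags) mem_Collect_eq)
next
  fix y assume x: "x \<in> W" and "y \<in> {y. \<exists>k. y = act k x}"
  then obtain k where k: "y = act k x" by blast
  have yW: "y \<in> W" unfolding k by (rule act_W[OF x])
  show "y \<in> orb x"
  proof (cases "k \<ge> 0")
    case True
    then have "y = (hopf_III_map p \<delta> ^^ nat k) x" using k x by (simp add: act_funpow W_cvec)
    with yW show ?thesis unfolding hopf_orbit_def by blast
  next
    case False
    then have "x = (hopf_III_map p \<delta> ^^ nat (- k)) y"
      using k x by (simp add: act_funpow act_cvec act_inv W_cvec)
    with yW show ?thesis unfolding hopf_orbit_def by blast
  qed
qed

lemma orb_act: "x \<in> W \<Longrightarrow> orb (act k x) = orb x"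
proof -
  assume x: "x \<in> W"
  have "(\<exists>j. y = act j (act k x)) \<longleftrightarrow> (\<exists>j. y = act j x)" for y
    by (metis act_add diff_add_cancel)
  then show ?thesis by (simp add: orb_eq x act_W)
qed

lemma orb_eq_iff: "x \<in> W \<Longrightarrow> y \<in> W \<Longrightarrow> orb x = orb y \<longleftrightarrow> (\<exists>k. y = act k x)"
proof
  assume xy: "x \<in> W" "y \<in> W" and "orb x = orb y"
  moreover have "y \<in> orb y" using xy(2) by (auto simp: orb_eq intro!: exI[of _ 0] simp: act_0 W_cvec)
  ultimately show "\<exists>k. y = act k x" by (auto simp: orb_eq)
qed (use orb_act in auto)

lemma norm_pos: "x \<in> W \<Longrightarrow> cmod (x 0) ^ 2 + cmod (x 1) ^ (2 * p) > 0"
  by (auto simp: W_iff intro: add_pos_nonneg add_nonneg_pos)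

text \<open>The exponents 2 and \<open>2 * p\<close> in \<open>lev\<close> balance the weights
  \<open>p\<close> and 1 of the coordinates: the contraction scales the whole sum by
  \<open>cmod \<delta> ^ (2 * p)\<close>, and the denominator is the logarithm of this
  factor.\<close>

lemma lev_act: "x \<in> W \<Longrightarrow> lev (act k x) = lev x + of_int k"
proof -
  assume x: "x \<in> W"
  let ?N = "\<lambda>x. cmod (x 0) ^ 2 + cmod (x 1) ^ (2 * p)"
  have lnd: "ln (cmod \<delta>) < 0" using \<delta>0 \<delta>1 by simp
  have *: "lev (act 1 x) = lev x + 1" if x: "x \<in> W" for x
  proof -
    have "?N (act 1 x) = cmod \<delta> ^ (2 * p) * ?N x"
      by (simp add: norm_mult norm_power power_mult_distrib power_mult[symmetric] mult.commute distrib_left)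
    then have "ln (?N (act 1 x)) = 2 * p * ln (cmod \<delta>) + ln (?N x)"
      using norm_pos[OF x] \<delta>0 by (simp add: ln_mult ln_realpow)
    then show ?thesis using lnd p by (simp add: lev_def add_divide_distrib)
  qed
  have nat: "lev (act (int m) x) = lev x + real m" if x: "x \<in> W" for x m
  proof (induction m)
    case (Suc m)
    then show ?case using *[OF act_W[OF x, of "int m"]] act_add[of 1 "int m" x] by simp
  qed (simp add: act_0 W_cvec x)
  show ?thesis
  proof (cases "k \<ge> 0")
    case True
    then show ?thesis using nat[OF x, of "nat k"] by simp
  next
    case False
    then show ?thesis using nat[OF act_W[OF x, of k], of "nat (-k)"] act_inv(1)[OF W_cvec[OF x], of k] by simp
  qed
qed

lemma continuous_lev: "continuous_on W lev"
  unfolding lev_def using norm_pos p \<delta>0 \<delta>1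
  by (intro continuous_intros continuous_on_coordinate ballI) (auto simp: less_imp_neq[THEN not_sym])

text \<open>Levels of distinct points of one orbit differ by nonzero integers, so a band of
  half-width 1/2 meets each orbit at most once.\<close>

definition nb :: "(nat \<Rightarrow> complex) \<Rightarrow> (nat \<Rightarrow> complex) set" where
  "nb x = {y \<in> W. lev y \<in> ball (lev x) (1/2)}"

lemma nb_open: "openin (cspace 2) (nb x)"
  unfolding nb_def by (rule continuous_preimage_cspace[OF continuous_lev openin_W]) auto

lemma nb_self: "x \<in> W \<Longrightarrow> x \<in> nb x" by (simp add: nb_def)

lemma nb_W: "nb x \<subseteq> W" by (auto simp: nb_def)

lemma inj_orb_nb: "inj_on orb (nb x)"
proof (rule inj_onI)
  fix y z assume y: "y \<in> nb x" and z: "z \<in> nb x" and "orb y = orb z"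
  then obtain k where k: "z = act k y" using orb_eq_iff nb_W by blast
  have "lev z = lev y + of_int k" using k lev_act y nb_W by blast
  moreover have "\<bar>lev z - lev x\<bar> < 1/2" "\<bar>lev y - lev x\<bar> < 1/2"
    using y z by (auto simp: nb_def dist_real_def abs_minus_commute)
  ultimately have "\<bar>real_of_int k\<bar> < 1" by linarith
  then have "k = 0" by linarith
  moreover have "y \<in> cvec 2" using y nb_W W_cvec by blast
  ultimately show "y = z" using k act_0 by simp
qed

lemma hol_on_act: "hol_on 2 V (\<lambda>x. act k x a)"
  unfolding act_def by (cases "a = 1"; cases "a = 0") (auto intro!: hol_on_intros)

section \<open>Topology and charts of the quotient\<close>

lemma openin_act_preimage:
  "openin (cspace 2) S \<Longrightarrow> openin (cspace 2) {x\<in>cvec 2. act k x \<in> S}"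
  by (rule hol_preimage_open[OF open_cvec act_cvec hol_on_act])

lemma openin_act_image: "openin (cspace 2) S \<Longrightarrow> openin (cspace 2) (act k ` S)"
proof -
  assume S: "openin (cspace 2) S"
  then have "S \<subseteq> cvec 2" by (rule openin_cspace_sub)
  have "act k ` S = {x\<in>cvec 2. act (-k) x \<in> S}"
  proof (intro set_eqI iffI)
    fix x assume "x \<in> act k ` S"
    then show "x \<in> {x\<in>cvec 2. act (-k) x \<in> S}" using act_cvec act_inv(1) \<open>S \<subseteq> cvec 2\<close> by auto
  next
    fix x assume x: "x \<in> {x\<in>cvec 2. act (-k) x \<in> S}"
    then have "x = act k (act (-k) x)" using act_inv(2) by simp
    then show "x \<in> act k ` S" using x by blast
  qed
  then show ?thesis using openin_act_preimage[OF S] by simp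
qed

text \<open>The saturation of \<open>S\<close> is the union of its translates under the group, each
  of which is open.\<close>

lemma openin_htop_image:
  assumes "openin (cspace 2) S" "S \<subseteq> W"
  shows "openin htop (orb ` S)"
  unfolding openin_hopf_topology
proof
  have "{x \<in> W. orb x \<in> orb ` S} = (\<Union>k. act k ` S)"
  proof (intro set_eqI iffI)
    fix x assume "x \<in> {x \<in> W. orb x \<in> orb ` S}"
    then obtain y where "x \<in> W" "y \<in> S" "orb y = orb x" by auto
    then show "x \<in> (\<Union>k. act k ` S)" using orb_eq_iff[of y x] assms(2) by auto
  next
    fix x assume "x \<in> (\<Union>k. act k ` S)"
    then show "x \<in> {x \<in> W. orb x \<in> orb ` S}" using assms(2) act_W orb_act by auto
  qed
  then show "openin (cspace 2) {x \<in> W. orb x \<in> orb ` S}"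
    using openin_act_image[OF assms(1)] by auto
qed (use assms in auto)

lemma htop_topspace: "topspace htop = orb ` W"
proof -
  have "openin htop (orb ` W)" by (rule openin_htop_image[OF openin_W]) simp
  then have "orb ` W \<subseteq> topspace htop" by (rule openin_subset)
  moreover have "topspace htop \<subseteq> orb ` W"
    using openin_hopf_topology[of "hopf_III_map p \<delta>" "topspace htop"] by simp
  ultimately show ?thesis by blast
qed

definition small :: "(nat \<Rightarrow> complex) set \<Rightarrow> bool" where
  "small U \<longleftrightarrow> openin (cspace 2) U \<and> U \<subseteq> W \<and> inj_on orb U"

lemma small_Int: "small U \<Longrightarrow> openin (cspace 2) V \<Longrightarrow> small (U \<inter> V)"
  unfolding small_def by (auto intro: inj_on_subset)

lemma small_nb: "small (nb x)"
  by (simp add: small_def nb_open nb_W inj_orb_nb)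

abbreviation ochart :: "(nat \<Rightarrow> complex) set \<Rightarrow> (nat \<Rightarrow> complex) set chart" where
  "ochart \<equiv> inv_chart orb"

lemmas ochart_def = inv_chart_def[of orb]

lemma hopfX_sel [simp]: "mdim hopfX = 2" "mtop hopfX = htop" "matlas hopfX = ochart ` {U. small U}"
  by (auto simp: hopf_quotient_def ochart_def small_def)

lemma ochart_snd: "small U \<Longrightarrow> x \<in> U \<Longrightarrow> inv_into U orb (orb x) = x"
  by (simp add: small_def)

lemma ochart_inv: "small U \<Longrightarrow> x \<in> U \<Longrightarrow> chart_inv (ochart U) x = orb x"
  by (simp add: small_def inv_chart_inv)

lemma ochart_is_chart:
  assumes "small U"
  shows "is_chart 2 htop (ochart U)"
proof (rule inv_chart_is_chart)
  show U: "inj_on orb U" "openin (cspace 2) U" using assms by (auto simp: small_def)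
  show "openin htop (orb ` S)" if "openin (cspace 2) S" "S \<subseteq> U" for S
    using that assms by (intro openin_htop_image) (auto simp: small_def)
  fix S assume "openin htop S"
  then have "openin (cspace 2) (U \<inter> {x\<in>W. orb x \<in> S})"
    using U(2) unfolding openin_hopf_topology by blast
  moreover have "U \<inter> {x\<in>W. orb x \<in> S} = {x\<in>U. orb x \<in> S}" using assms by (auto simp: small_def)
  ultimately show "openin (cspace 2) {x\<in>U. orb x \<in> S}" by simp
qed

text \<open>Near a given point the transition is a single \<open>act k\<close>. The exponent
  \<open>k\<close> may vary over the overlap, so holomorphy is proved locally.\<close>

lemma ochart_transition:
  assumes U: "small U" and V: "small V"
  shows "hol_transition 2 (ochart U) (ochart V)"
  unfolding hol_transition_def
proof (intro allI impI, rule hol_on_local)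
  fix a :: nat assume "a < 2"
  have rng: "snd (ochart U) ` (fst (ochart U) \<inter> fst (ochart V)) = {x\<in>U. orb x \<in> orb ` V}"
    using inv_chart_range[of orb U "orb ` V"] U by (simp add: ochart_def small_def Int_commute)
  have "{x\<in>U. orb x \<in> orb ` V} = U \<inter> {x\<in>W. orb x \<in> orb ` V}" using U by (auto simp: small_def)
  moreover have "openin htop (orb ` V)" using V openin_htop_image by (simp add: small_def)
  ultimately show o: "openin (cspace 2) (snd (ochart U) ` (fst (ochart U) \<inter> fst (ochart V)))"
    unfolding rng openin_hopf_topology using U by (auto simp: small_def)
  fix x assume "x \<in> snd (ochart U) ` (fst (ochart U) \<inter> fst (ochart V))"
  then have x: "x \<in> U" "orb x \<in> orb ` V" unfolding rng by auto
  then obtain y where y: "y \<in> V" "orb x = orb y" by auto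
  then obtain k where k: "y = act k x" using orb_eq_iff x U V unfolding small_def by blast
  define U' where "U' = U \<inter> {x\<in>cvec 2. act k x \<in> V}"
  have U'o: "openin (cspace 2) U'" unfolding U'_def using U V openin_act_preimage by (auto simp: small_def)
  have sub: "U' \<subseteq> {x\<in>U. orb x \<in> orb ` V}"
    using U orb_act by (auto simp: U'_def small_def intro: image_eqI[of _ _ "act k _"])
  have "hol_on 2 U' (\<lambda>x. snd (ochart V) (chart_inv (ochart U) x) a)"
  proof (rule hol_on_cong[OF U'o _ hol_on_act[of _ k a]])
    fix z assume z: "z \<in> U'"
    then have "chart_inv (ochart U) z = orb (act k z)"
      using U by (simp add: U'_def ochart_inv orb_act small_def subset_iff)
    then show "act k z a = snd (ochart V) (chart_inv (ochart U) z) a"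
      using z V by (simp add: ochart_def U'_def ochart_snd)
  qed
  moreover have "x \<in> U'" using x(1) y k U W_cvec by (auto simp: U'_def small_def)
  ultimately show "\<exists>T. openin (cspace 2) T \<and> x \<in> T \<and>
      hol_on 2 (T \<inter> snd (ochart U) ` (fst (ochart U) \<inter> fst (ochart V))) (\<lambda>x. snd (ochart V) (chart_inv (ochart U) x) a)"
    unfolding rng using U'o by (intro exI[of _ U'] conjI) (simp_all only: Int_absorb2[OF sub])
qed

lemma ochart_max_atlas: "small U \<Longrightarrow> ochart U \<in> max_atlas hopfX"
  by (auto simp: max_atlas_def ochart_is_chart compatible_def ochart_transition)

end

section \<open>Manifolds biholomorphic to a Hopf surface\<close>

locale hopf_target = diagonal_hopf p \<delta> for p :: nat and \<delta> :: complex +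
  fixes M :: "'e cmanifold" and \<iota> :: "(nat \<Rightarrow> complex) set \<Rightarrow> 'e"
  assumes M: "complex_manifold M" and iso: "biholomorphic_map hopfX M \<iota>"
begin

text \<open>The covering map from \<open>W\<close> to \<open>M\<close>; objects on \<open>M\<close>
  are studied through their pullbacks along it.\<close>

definition \<phi> :: "(nat \<Rightarrow> complex) \<Rightarrow> 'e" where
  "\<phi> x = \<iota> (orb x)"

lemma points_hopfX: "points hopfX = orb ` W"
  by (simp add: htop_topspace)

lemma \<iota>_bij: "bij_betw \<iota> (orb ` W) (points M)"
  using iso unfolding biholomorphic_map_def points_hopfX by blast

lemma \<iota>_inv: "x \<in> W \<Longrightarrow> inv_into (points hopfX) \<iota> (\<phi> x) = orb x"
  unfolding \<phi>_def points_hopfX using \<iota>_bij by (simp add: bij_betw_def)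

lemma \<phi>_points: "x \<in> W \<Longrightarrow> \<phi> x \<in> points M"
  unfolding \<phi>_def using \<iota>_bij bij_betwE by blast

lemma \<iota>_inj: "inj_on \<iota> (orb ` W)"
  using \<iota>_bij by (simp add: bij_betw_def)

lemma \<phi>_surj: "q \<in> points M \<Longrightarrow> \<exists>x\<in>W. \<phi> x = q"
proof -
  assume "q \<in> points M"
  then have "q \<in> \<iota> ` orb ` W" using \<iota>_bij by (simp add: bij_betw_def)
  then show ?thesis by (auto simp: \<phi>_def)
qed

lemma \<phi>_eq_iff: "x \<in> W \<Longrightarrow> y \<in> W \<Longrightarrow> \<phi> x = \<phi> y \<longleftrightarrow> (\<exists>k. y = act k x)"
  unfolding \<phi>_def orb_eq_iff[symmetric] by (rule inj_on_eq_iff[OF \<iota>_inj]) auto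

lemma \<phi>_act: "x \<in> W \<Longrightarrow> \<phi> (act k x) = \<phi> x"
  by (simp add: \<phi>_def orb_act)

lemma inj_\<phi>: "small U \<Longrightarrow> inj_on \<phi> U"
proof (rule inj_onI)
  fix x y assume U: "small U" and xy: "x \<in> U" "y \<in> U" "\<phi> x = \<phi> y"
  then have "orb x = orb y"
    unfolding \<phi>_def small_def by (intro inj_onD[OF \<iota>_inj]) auto
  then show "x = y" using U xy unfolding small_def by (auto dest: inj_onD)
qed

lemma \<phi>_inv: "small U \<Longrightarrow> x \<in> U \<Longrightarrow> inv_into U \<phi> (\<phi> x) = x"
  by (simp add: inj_\<phi>)

lemma small_W: "small U \<Longrightarrow> x \<in> U \<Longrightarrow> x \<in> W" by (auto simp: small_def)

lemma \<phi>_preimage_open: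
  assumes "openin (mtop M) S"
  shows "openin (cspace 2) {x\<in>W. \<phi> x \<in> S}"
proof -
  have "continuous_map htop (mtop M) \<iota>"
    using iso by (simp add: biholomorphic_map_def hol_map_def)
  then have "openin htop {q \<in> topspace htop. \<iota> q \<in> S}"
    using assms openin_continuous_map_preimage by blast
  then have "openin (cspace 2) {x\<in>W. orb x \<in> {q \<in> topspace htop. \<iota> q \<in> S}}"
    unfolding openin_hopf_topology by blast
  moreover have "{x\<in>W. orb x \<in> {q \<in> topspace htop. \<iota> q \<in> S}} = {x\<in>W. \<phi> x \<in> S}"
    by (auto simp: htop_topspace \<phi>_def)
  ultimately show ?thesis by simp
qed

lemma \<phi>_image_open_small:
  assumes U: "small U"
  shows "openin (mtop M) (\<phi> ` U)"
proof -
  have "continuous_map (mtop M) htop (inv_into (points hopfX) \<iota>)"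
    using iso by (simp add: biholomorphic_map_def hol_map_def)
  moreover have "openin htop (orb ` U)" using U openin_htop_image by (simp add: small_def)
  ultimately have "openin (mtop M) {q \<in> points M. inv_into (points hopfX) \<iota> q \<in> orb ` U}"
    using openin_continuous_map_preimage by blast
  moreover have "{q \<in> points M. inv_into (points hopfX) \<iota> q \<in> orb ` U} = \<phi> ` U"
  proof (intro set_eqI iffI)
    fix q assume "q \<in> {q \<in> points M. inv_into (points hopfX) \<iota> q \<in> orb ` U}"
    then obtain x y where "x \<in> W" "q = \<phi> x" "y \<in> U" "orb x = orb y" using \<phi>_surj \<iota>_inv by force
    then show "q \<in> \<phi> ` U" by (auto simp: \<phi>_def)
  qed (use \<phi>_points \<iota>_inv small_W[OF U] in auto)
  ultimately show ?thesis by simp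
qed

lemma \<phi>_image_open:
  assumes "openin (cspace 2) U" "U \<subseteq> W"
  shows "openin (mtop M) (\<phi> ` U)"
proof -
  have sm: "small (U \<inter> nb x)" for x
    using small_Int[OF small_nb assms(1)] by (simp add: Int_commute)
  have "\<phi> ` U = (\<Union>x\<in>U. \<phi> ` (U \<inter> nb x))" using nb_self assms(2) by blast
  moreover have "openin (mtop M) (\<Union>x\<in>U. \<phi> ` (U \<inter> nb x))" using \<phi>_image_open_small[OF sm] by blast
  ultimately show ?thesis by simp
qed

section \<open>Holomorphy of the covering map and of its local inverses\<close>

lemma coord_hol:
  assumes d: "d \<in> max_atlas M" and a: "a < mdim M"
  shows "hol_on 2 {x\<in>W. \<phi> x \<in> fst d} (\<lambda>x. snd d (\<phi> x) a)"
proof (rule hol_on_local)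
  show "openin (cspace 2) {x \<in> W. \<phi> x \<in> fst d}"
    by (rule \<phi>_preimage_open[OF chart_open_dom[OF max_atlas_chart[OF d]]])
  fix x assume x: "x \<in> {x \<in> W. \<phi> x \<in> fst d}"
  define U where "U = nb x \<inter> {x \<in> W. \<phi> x \<in> fst d}"
  have U: "small U" "openin (cspace 2) U"
    using small_Int[OF small_nb \<phi>_preimage_open[OF chart_open_dom[OF max_atlas_chart[OF d]]]]
    by (auto simp: U_def small_def)
  have "hol_fun hopfX {q \<in> points hopfX. \<iota> q \<in> fst d} (\<lambda>q. snd d (\<iota> q) a)"
    using iso d a unfolding biholomorphic_map_def hol_map_def by blast
  from bspec[OF this[unfolded hol_fun_def] ochart_max_atlas[OF U(1)]] have "hol_on 2 (snd (ochart U) ` ({q \<in> points hopfX. \<iota> q \<in> fst d} \<inter> fst (ochart U)))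
      (\<lambda>y. snd d (\<iota> (chart_inv (ochart U) y)) a)"
    unfolding hopfX_sel(1) .
  moreover have "snd (ochart U) ` ({q \<in> points hopfX. \<iota> q \<in> fst d} \<inter> fst (ochart U)) = U"
  proof -
    have "{q \<in> points hopfX. \<iota> q \<in> fst d} \<inter> fst (ochart U) = orb ` U"
      unfolding points_hopfX ochart_def by (auto simp: U_def \<phi>_def)
    then show ?thesis using ochart_snd[OF U(1)] by (auto simp: ochart_def image_image)
  qed
  ultimately have "hol_on 2 U (\<lambda>y. snd d (\<iota> (chart_inv (ochart U) y)) a)" by simp
  then have "hol_on 2 U (\<lambda>y. snd d (\<phi> y) a)"
    by (rule hol_on_cong[OF U(2), rotated]) (simp add: ochart_inv[OF U(1)] \<phi>_def)
  then show "\<exists>T. openin (cspace 2) T \<and> x \<in> T \<and> hol_on 2 (T \<inter> {x \<in> W. \<phi> x \<in> fst d}) (\<lambda>x. snd d (\<phi> x) a)"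
    using U(2) x nb_self[of x] unfolding U_def by (intro exI[of _ "nb x"]) (auto simp: nb_open)
qed

lemma inv_hol:
  assumes d: "d \<in> max_atlas M" and U: "small U" and a: "a < 2"
  shows "hol_on (mdim M) (snd d ` (\<phi> ` U \<inter> fst d)) (\<lambda>z. inv_into U \<phi> (chart_inv d z) a)"
proof -
  note cd = max_atlas_chart[OF d]
  let ?inv = "inv_into (points hopfX) \<iota>"
  have "hol_fun M {q \<in> points M. ?inv q \<in> fst (ochart U)} (\<lambda>q. snd (ochart U) (?inv q) a)"
  proof -
    have "\<forall>c\<in>max_atlas hopfX. \<forall>a<mdim hopfX.
        hol_fun M {q \<in> points M. ?inv q \<in> fst c} (\<lambda>q. snd c (?inv q) a)"
      using iso unfolding biholomorphic_map_def hol_map_def by blast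
    from bspec[OF this ochart_max_atlas[OF U]] show ?thesis using a unfolding hopfX_sel(1) by blast
  qed
  then have "hol_on (mdim M) (snd d ` ({q \<in> points M. ?inv q \<in> fst (ochart U)} \<inter> fst d))
      (\<lambda>z. snd (ochart U) (?inv (chart_inv d z)) a)"
    using d unfolding hol_fun_def by blast
  moreover have "{q \<in> points M. ?inv q \<in> fst (ochart U)} = \<phi> ` U"
  proof (intro set_eqI iffI)
    fix q assume "q \<in> {q \<in> points M. ?inv q \<in> fst (ochart U)}"
    then obtain x y where "x \<in> W" "q = \<phi> x" "y \<in> U" "orb x = orb y"
      using \<phi>_surj \<iota>_inv unfolding ochart_def by force
    then show "q \<in> \<phi> ` U" by (auto simp: \<phi>_def)
  qed (use \<phi>_points \<iota>_inv small_W[OF U] in \<open>auto simp: ochart_def\<close>)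
  ultimately have h: "hol_on (mdim M) (snd d ` (\<phi> ` U \<inter> fst d)) (\<lambda>z. snd (ochart U) (?inv (chart_inv d z)) a)"
    by simp
  show ?thesis
  proof (rule hol_on_cong[OF _ _ h])
    show "openin (cspace (mdim M)) (snd d ` (\<phi> ` U \<inter> fst d))"
      by (rule chart_open_image[OF cd \<phi>_image_open_small[OF U]])
    fix z assume "z \<in> snd d ` (\<phi> ` U \<inter> fst d)"
    then obtain x where x: "x \<in> U" "\<phi> x \<in> fst d" "z = snd d (\<phi> x)" by blast
    then show "snd (ochart U) (?inv (chart_inv d z)) a = inv_into U \<phi> (chart_inv d z) a"
      using chart_inv_snd[OF cd] \<iota>_inv small_W[OF U] \<phi>_inv[OF U] ochart_snd[OF U]
      by (simp add: ochart_def)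
  qed
qed

lemma inv_props:
  assumes d: "d \<in> max_atlas M" and U: "small U" and z: "z \<in> snd d ` (\<phi> ` U \<inter> fst d)"
  shows "inv_into U \<phi> (chart_inv d z) \<in> U" (is ?A) "\<phi> (inv_into U \<phi> (chart_inv d z)) = chart_inv d z" (is ?B)
    "chart_inv d z \<in> fst d" (is ?C) "snd d (chart_inv d z) = z" (is ?D)
proof -
  note cd = max_atlas_chart[OF d]
  obtain x where x: "x \<in> U" "\<phi> x \<in> fst d" "z = snd d (\<phi> x)" using z by blast
  then show ?A ?B ?C ?D
    using chart_inv_snd[OF cd] \<phi>_inv[OF U] by simp_all
qed

text \<open>The Jacobians of mutually inverse holomorphic maps are inverse matrices, and the trace of
  \<open>A B\<close> equals that of \<open>B A\<close>.\<close>

lemma mdim_2: "mdim M = 2"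
proof -
  define x :: "nat \<Rightarrow> complex" where "x = (\<lambda>i. 0)(0 := 1)"
  have x: "x \<in> W" by (auto simp: W_iff x_def cvec_def)
  obtain d where d: "d \<in> max_atlas M" "\<phi> x \<in> fst d" using max_atlas_cover[OF M \<phi>_points[OF x]] by blast
  note cd = max_atlas_chart[OF d(1)]
  define U where "U = nb x \<inter> {x \<in> W. \<phi> x \<in> fst d}"
  have U: "small U" "openin (cspace 2) U"
    using small_Int[OF small_nb \<phi>_preimage_open[OF chart_open_dom[OF cd]]]
    by (auto simp: U_def small_def)
  have xU: "x \<in> U" using d x nb_self by (auto simp: U_def)
  have \<phi>U: "\<phi> ` U \<inter> fst d = \<phi> ` U" by (auto simp: U_def)
  define S where "S = snd d ` (\<phi> ` U)"
  have S: "openin (cspace (mdim M)) S"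
    using chart_open_image[OF cd \<phi>_image_open_small[OF U(1)]] unfolding \<phi>U S_def .
  define h where "h = (\<lambda>y. snd d (\<phi> y))"
  define g where "g = (\<lambda>z. inv_into U \<phi> (chart_inv d z))"
  have h: "hol_on 2 U (\<lambda>y. h y a)" if "a < mdim M" for a
    unfolding h_def by (rule hol_on_subset[OF coord_hol[OF d(1) that]]) (auto simp: U_def)
  have g: "hol_on (mdim M) S (\<lambda>z. g z i)" if "i < 2" for i
    using inv_hol[OF d(1) U(1) that] unfolding \<phi>U g_def S_def .
  have hU: "h y \<in> S" "g (h y) = y" if "y \<in> U" for y
    using that chart_inv_snd[OF cd, of "\<phi> y"] \<phi>_inv[OF U(1) that] unfolding h_def g_def S_def U_def by auto
  have gS: "g z \<in> U" "h (g z) = z" if "z \<in> S" for z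
    using inv_props[OF d(1) U(1), of z] that unfolding \<phi>U g_def S_def h_def by auto
  have A: "(\<Sum>a<mdim M. pdv a (\<lambda>z. g z i) (h x) * pdv i (\<lambda>y. h y a) x) = 1" if i: "i < 2" for i
  proof -
    have "(\<Sum>a<mdim M. pdv a (\<lambda>z. g z i) (h x) * pdv i (\<lambda>y. h y a) x) = pdv i (\<lambda>y. g (h y) i) x"
      using pdv_compose[OF g[OF i] S U(2) hU(1) h xU i] by simp
    also have "\<dots> = pdv i (\<lambda>y. y i) x"
      by (rule pdv_cong[OF U(2) xU i]) (simp add: hU)
    finally show ?thesis by (simp add: pdv_coord)
  qed
  have B: "(\<Sum>i<2. pdv i (\<lambda>y. h y a) x * pdv a (\<lambda>z. g z i) (h x)) = 1" if a: "a < mdim M" for a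
  proof -
    have "(\<Sum>i<2. pdv i (\<lambda>y. h y a) (g (h x)) * pdv a (\<lambda>z. g z i) (h x)) = pdv a (\<lambda>z. h (g z) a) (h x)"
      using pdv_compose[OF h[OF a] U(2) S gS(1) g hU(1)[OF xU] a] by simp
    also have "\<dots> = pdv a (\<lambda>y. y a) (h x)"
      by (rule pdv_cong[OF S hU(1)[OF xU] a]) (simp add: gS)
    finally show ?thesis by (simp add: pdv_coord hU(2)[OF xU])
  qed
  have "of_nat (mdim M) = (\<Sum>a<mdim M. \<Sum>i<2. pdv i (\<lambda>y. h y a) x * pdv a (\<lambda>z. g z i) (h x))"
    using B by simp
  also have "\<dots> = (\<Sum>i<2. \<Sum>a<mdim M. pdv a (\<lambda>z. g z i) (h x) * pdv i (\<lambda>y. h y a) x)"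
    by (subst sum.swap) (simp add: mult.commute)
  also have "\<dots> = (\<Sum>i<(2::nat). (1::complex))" by (intro sum.cong refl A) simp
  also have "\<dots> = of_nat 2" by simp
  finally show ?thesis by (simp only: of_nat_eq_iff)
qed

section \<open>Linear coordinates as charts of the target\<close>

abbreviation kchart :: "(nat \<Rightarrow> complex) set \<Rightarrow> 'e chart" where
  "kchart \<equiv> inv_chart \<phi>"

lemmas kchart_def = inv_chart_def[of \<phi>]

lemma kchart_sel: "fst (kchart U) = \<phi> ` U" "small U \<Longrightarrow> x \<in> U \<Longrightarrow> snd (kchart U) (\<phi> x) = x"
  by (auto simp: kchart_def \<phi>_inv)

lemma kchart_inv: "small U \<Longrightarrow> x \<in> U \<Longrightarrow> chart_inv (kchart U) x = \<phi> x"
  by (rule inv_chart_inv[OF inj_\<phi>])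

lemma kchart_range: "small U \<Longrightarrow> snd (kchart U) ` (S \<inter> \<phi> ` U) = {x\<in>U. \<phi> x \<in> S}"
  by (rule inv_chart_range[OF inj_\<phi>])

lemma small_open: "small U \<Longrightarrow> openin (cspace 2) U" by (simp add: small_def)

lemma small_preimage_open:
  "small U \<Longrightarrow> openin (mtop M) S \<Longrightarrow> openin (cspace 2) {x\<in>U. \<phi> x \<in> S}"
proof -
  assume "small U" "openin (mtop M) S"
  then have "openin (cspace 2) (U \<inter> {x\<in>W. \<phi> x \<in> S})" using \<phi>_preimage_open by (auto simp: small_def)
  moreover have "U \<inter> {x\<in>W. \<phi> x \<in> S} = {x\<in>U. \<phi> x \<in> S}" using \<open>small U\<close> by (auto simp: small_def)
  ultimately show ?thesis by simp
qed

lemma kchart_is_chart: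
  assumes U: "small U"
  shows "is_chart 2 (mtop M) (kchart U)"
proof (rule inv_chart_is_chart[OF inj_\<phi>[OF U] small_open[OF U] _ small_preimage_open[OF U]])
  show "openin (mtop M) (\<phi> ` S)" if "openin (cspace 2) S" "S \<subseteq> U" for S
    using that U by (intro \<phi>_image_open) (auto simp: small_def)
qed

text \<open>Tensor fields are given by components in all charts of the maximal atlas; membership
  therefore allows them to be evaluated in the linear coordinates of \<open>W\<close>.\<close>

lemma kchart_max_atlas:
  assumes U: "small U"
  shows "kchart U \<in> max_atlas M"
  unfolding max_atlas_def mdim_2 mem_Collect_eq compatible_def hol_transition_def
proof (intro conjI ballI allI impI)
  show "is_chart 2 (mtop M) (kchart U)" by (rule kchart_is_chart[OF U])
  fix d and a :: nat assume "d \<in> matlas M" and a: "a < 2"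
  then have d: "d \<in> max_atlas M" using matlas_max_atlas[OF M] by blast
  note cd = max_atlas_chart[OF d]
  have rng: "snd (kchart U) ` (fst (kchart U) \<inter> fst d) = {x\<in>U. \<phi> x \<in> fst d}"
    using kchart_range[OF U, of "fst d"] by (simp add: kchart_sel Int_commute)
  show "hol_on 2 (snd (kchart U) ` (fst (kchart U) \<inter> fst d)) (\<lambda>x. snd d (chart_inv (kchart U) x) a)"
    unfolding rng
  proof (rule hol_on_cong[OF small_preimage_open[OF U chart_open_dom[OF cd]]])
    show "hol_on 2 {x \<in> U. \<phi> x \<in> fst d} (\<lambda>x. snd d (\<phi> x) a)"
      by (rule hol_on_subset[OF coord_hol[OF d]]) (use a mdim_2 small_W[OF U] in auto)
  qed (simp add: kchart_inv[OF U])
  show "hol_on 2 (snd d ` (fst d \<inter> fst (kchart U))) (\<lambda>x. snd (kchart U) (chart_inv d x) a)"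
    using inv_hol[OF d U a] by (simp add: mdim_2 kchart_def Int_commute)
qed

text \<open>Since \<open>\<phi>\<close> is locally biholomorphic, holomorphy on \<open>M\<close> can
  be tested on \<open>W\<close>, without reference to arbitrary charts.\<close>

lemma hol_fun_iff:
  assumes S: "openin (mtop M) S"
  shows "hol_fun M S u \<longleftrightarrow> hol_on 2 {x\<in>W. \<phi> x \<in> S} (\<lambda>x. u (\<phi> x))"
proof
  assume u: "hol_fun M S u"
  show "hol_on 2 {x\<in>W. \<phi> x \<in> S} (\<lambda>x. u (\<phi> x))"
  proof (rule hol_on_local[OF \<phi>_preimage_open[OF S]])
    fix x assume x: "x \<in> {x \<in> W. \<phi> x \<in> S}"
    note U = small_nb[of x]
    have "hol_on 2 (snd (kchart (nb x)) ` (S \<inter> fst (kchart (nb x)))) (\<lambda>y. u (chart_inv (kchart (nb x)) y))"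
      using u kchart_max_atlas[OF U] by (simp add: hol_fun_def mdim_2)
    then have "hol_on 2 {y\<in>nb x. \<phi> y \<in> S} (\<lambda>y. u (chart_inv (kchart (nb x)) y))"
      unfolding kchart_sel(1) kchart_range[OF U] .
    then have "hol_on 2 {y\<in>nb x. \<phi> y \<in> S} (\<lambda>y. u (\<phi> y))"
      by (rule hol_on_cong[OF small_preimage_open[OF U S], rotated]) (simp add: kchart_inv[OF U])
    then show "\<exists>T. openin (cspace 2) T \<and> x \<in> T \<and> hol_on 2 (T \<inter> {x \<in> W. \<phi> x \<in> S}) (\<lambda>x. u (\<phi> x))"
      using nb_open nb_self x
      by (intro exI[of _ "nb x"]) (auto elim: hol_on_subset)
  qed
next
  assume u: "hol_on 2 {x\<in>W. \<phi> x \<in> S} (\<lambda>x. u (\<phi> x))"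
  show "hol_fun M S u"
    unfolding hol_fun_def
  proof (intro ballI, rule hol_on_local)
    fix d assume d: "d \<in> max_atlas M"
    note cd = max_atlas_chart[OF d]
    show "openin (cspace (mdim M)) (snd d ` (S \<inter> fst d))" by (rule chart_open_image[OF cd S])
    fix z assume "z \<in> snd d ` (S \<inter> fst d)"
    then obtain q where q: "q \<in> S" "q \<in> fst d" "z = snd d q" by blast
    then obtain x where x: "x \<in> W" "\<phi> x = q" using \<phi>_surj openin_subset[OF S] by blast
    define U where "U = {y\<in>nb x. \<phi> y \<in> S}"
    have U: "small U"
      using small_nb[of x] small_preimage_open[OF small_nb S] unfolding U_def small_def
      by (auto intro: inj_on_subset)
    have o: "openin (cspace (mdim M)) (snd d ` (\<phi> ` U \<inter> fst d))"
      by (rule chart_open_image[OF cd \<phi>_image_open_small[OF U]])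
    have "hol_on (mdim M) (snd d ` (\<phi> ` U \<inter> fst d)) (\<lambda>z. u (\<phi> (inv_into U \<phi> (chart_inv d z))))"
    proof (rule hol_on_compose[OF u \<phi>_preimage_open[OF S] o])
      show "inv_into U \<phi> (chart_inv d z) \<in> {x\<in>W. \<phi> x \<in> S}" if "z \<in> snd d ` (\<phi> ` U \<inter> fst d)" for z
        using inv_props[OF d U that] small_W[OF U] by (auto simp: U_def)
    qed (rule inv_hol[OF d U])
    then have h: "hol_on (mdim M) (snd d ` (\<phi> ` U \<inter> fst d)) (\<lambda>z. u (chart_inv d z))"
      by (rule hol_on_cong[OF o, rotated]) (simp add: inv_props[OF d U])
    have "\<phi> x \<in> \<phi> ` U" using x q nb_self by (auto simp: U_def)
    then show "\<exists>T. openin (cspace (mdim M)) T \<and> z \<in> T \<and> hol_on (mdim M) (T \<inter> snd d ` (S \<inter> fst d)) (\<lambda>x. u (chart_inv d x))"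
      using o q x h by (intro exI[of _ "snd d ` (\<phi> ` U \<inter> fst d)"]) (auto elim: hol_on_subset)
  qed
qed

lemma pd_kchart:
  assumes U: "small U" and x: "x \<in> U" and i: "i < 2"
  shows "pd (kchart U) i u (\<phi> x) = pdv i (\<lambda>y. u (\<phi> y)) x"
  unfolding pd_pdv kchart_sel(2)[OF U x]
  by (rule pdv_cong[OF small_open[OF U] x i]) (simp add: kchart_inv[OF U])

lemma pd_chain:
  assumes d: "d \<in> max_atlas M" and S: "openin (mtop M) S" and u: "hol_fun M S u"
    and x: "x \<in> W" "\<phi> x \<in> fst d" "\<phi> x \<in> S" and i: "i < 2"
  shows "pdv i (\<lambda>y. u (\<phi> y)) x = (\<Sum>a<2. pd d a u (\<phi> x) * pdv i (\<lambda>y. snd d (\<phi> y) a) x)"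
proof -
  note cd = max_atlas_chart[OF d]
  define V where "V = {y\<in>W. \<phi> y \<in> S \<inter> fst d}"
  have V: "openin (cspace 2) V" unfolding V_def
    using \<phi>_preimage_open[of "S \<inter> fst d"] S chart_open_dom[OF cd] by blast
  have xV: "x \<in> V" using x by (simp add: V_def)
  have o: "openin (cspace 2) (snd d ` (S \<inter> fst d))" using chart_open_image[OF cd S] mdim_2 by simp
  have u': "hol_on 2 (snd d ` (S \<inter> fst d)) (\<lambda>z. u (chart_inv d z))"
    using u d mdim_2 by (simp add: hol_fun_def)
  have "pdv i (\<lambda>y. u (\<phi> y)) x = pdv i (\<lambda>y. u (chart_inv d (snd d (\<phi> y)))) x"
    by (rule pdv_cong[OF V xV i]) (simp add: V_def chart_inv_snd[OF cd])
  also have "\<dots> = (\<Sum>a<2. pdv a (\<lambda>z. u (chart_inv d z)) (snd d (\<phi> x)) * pdv i (\<lambda>y. snd d (\<phi> y) a) x)"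
  proof (rule pdv_compose[OF u' o V _ _ xV i])
    show "hol_on 2 V (\<lambda>y. snd d (\<phi> y) a)" if "a < 2" for a
      by (rule hol_on_subset[OF coord_hol[OF d]]) (use that mdim_2 in \<open>auto simp: V_def\<close>)
  qed (auto simp: V_def)
  finally show ?thesis by (simp add: pd_pdv)
qed

end

section \<open>A first order deformation that cannot be extended\<close>

context diagonal_hopf
begin

text \<open>For \<open>i < 2\<close> these are the diagonal entries of the Jacobian matrix of
  \<open>act k\<close>.\<close>

definition \<mu> :: "int \<Rightarrow> nat \<Rightarrow> complex" where
  "\<mu> k i = (if i = 0 then \<delta> ^ p else \<delta>) powi k"

lemma \<mu>_nz [simp]: "\<mu> k i \<noteq> 0" by (simp add: \<mu>_def)

lemma sum_lessThan_2: "(\<Sum>i<(2::nat). f i) = f 0 + f 1"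
  by (simp add: numeral_2_eq_2)

lemma pdv_act: "i < 2 \<Longrightarrow> l < 2 \<Longrightarrow> pdv i (\<lambda>y. act k y l) x = (if i = l then \<mu> k l else 0)"
proof -
  assume i: "i < 2" and l: "l < 2"
  have "(\<lambda>y. act k y l) = (\<lambda>y. \<mu> k l * y l)"
    using l by (auto simp: less_2_cases_iff \<mu>_def fun_eq_iff)
  moreover have "pdv i (\<lambda>y. \<mu> k l * y l) x = \<mu> k l * pdv i (\<lambda>y. y l) x"
    by (rule pdv_cmult[OF hol_on_coord _ i, of x UNIV]) simp
  ultimately show ?thesis by (simp add: pdv_coord)
qed

lemma act_chain:
  assumes h: "hol_on 2 T h" and T: "openin (cspace 2) T" and x: "act k x \<in> T" "x \<in> cvec 2" and i: "i < 2"
  shows "pdv i (\<lambda>y. h (act k y)) x = \<mu> k i * pdv i h (act k x)"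
proof -
  have "pdv i (\<lambda>y. h (act k y)) x = (\<Sum>l<2. pdv l h (act k x) * pdv i (\<lambda>y. act k y l) x)"
    by (rule pdv_compose[OF h T openin_act_preimage[OF T]]) (use x i in \<open>auto intro: hol_on_act\<close>)
  also have "\<dots> = (\<Sum>l<2. pdv l h (act k x) * (if i = l then \<mu> k l else 0))"
    using i by (intro sum.cong refl) (simp add: pdv_act)
  finally show ?thesis using i by (auto simp: sum_lessThan_2 less_2_cases_iff)
qed

lemma weight_eq: "(\<delta> ^ p) powi k = (\<delta> powi k) ^ p"
proof -
  have "(\<delta> ^ p) powi k = (\<delta> powi int p) powi k" by simp
  also have "\<dots> = \<delta> powi (int p * k)" by (simp only: power_int_mult)
  also have "\<dots> = \<delta> powi (k * int p)" by (simp only: mult.commute)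
  also have "\<dots> = (\<delta> powi k) powi int p" by (simp only: power_int_mult)
  finally show ?thesis by simp
qed

text \<open>For even and for odd indices, \<open>Us j\<close> is \<open>W\<close> without the levels in \<open>\<int>\<close> and in \<open>\<int> + 1/2\<close>; the
  differences \<open>m k - m j\<close> are invariant under \<open>act\<close> and form the integral cocycle \<open>n\<close>.\<close>

definition sh :: "nat \<Rightarrow> real" where "sh j = (if even j then 0 else 1/2)"

definition Us :: "nat \<Rightarrow> (nat \<Rightarrow> complex) set" where
  "Us j = {x\<in>W. lev x + sh j \<in> - \<int>}"

definition m :: "nat \<Rightarrow> (nat \<Rightarrow> complex) \<Rightarrow> int" where "m j x = \<lfloor>lev x + sh j\<rfloor>"

lemma m_act: "x \<in> W \<Longrightarrow> m j (act k x) = m j x + k"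
proof -
  assume "x \<in> W"
  then have "lev (act k x) + sh j = (lev x + sh j) + of_int k" by (simp add: lev_act)
  then show ?thesis unfolding m_def by (simp only: floor_add_int)
qed

lemma Us_act: "x \<in> W \<Longrightarrow> act k x \<in> Us j \<longleftrightarrow> x \<in> Us j"
proof -
  assume x: "x \<in> W"
  have "lev (act k x) + sh j = (lev x + sh j) + of_int k" using x by (simp add: lev_act)
  then have "lev (act k x) + sh j \<in> \<int> \<longleftrightarrow> lev x + sh j \<in> \<int>"
    by (metis Ints_add Ints_diff Ints_of_int add_diff_cancel_right')
  then show ?thesis using x act_W by (simp add: Us_def)
qed

lemma Us_open: "openin (cspace 2) (Us j)"
  unfolding Us_def
  by (rule continuous_preimage_cspace[OF _ openin_W])
    (intro continuous_intros continuous_lev closed_Ints open_Compl)+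

lemma Us_cover: "x \<in> W \<Longrightarrow> x \<in> Us 0 \<or> x \<in> Us 1"
proof (rule ccontr)
  assume x: "x \<in> W" and "\<not> (x \<in> Us 0 \<or> x \<in> Us 1)"
  then have "lev x \<in> \<int>" "lev x + 1/2 \<in> \<int>" by (auto simp: Us_def sh_def)
  then have "(lev x + 1/2) - lev x \<in> \<int>" by (intro Ints_diff)
  then have "(1/2 :: real) \<in> \<int>" by simp
  then obtain n where "(1/2 :: real) = of_int n" by (rule Ints_cases)
  then have "of_int (2 * n) = (of_int 1 :: real)" by simp
  then have "2 * n = 1" by (simp only: of_int_eq_iff)
  then show False by presburger
qed

lemma m_local:
  assumes x: "x \<in> Us j"
  shows "\<exists>U. openin (cspace 2) U \<and> x \<in> U \<and> U \<subseteq> W \<and> (\<forall>y\<in>U. m j y = m j x)"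
proof (intro exI[of _ "{y\<in>W. lev y + sh j \<in> {of_int (m j x)<..<of_int (m j x) + 1}}"] conjI ballI)
  show "openin (cspace 2) {y\<in>W. lev y + sh j \<in> {of_int (m j x)<..<of_int (m j x) + 1}}"
    by (rule continuous_preimage_cspace[OF _ openin_W]) (auto intro!: continuous_intros continuous_lev)
  have "of_int (m j x) \<noteq> lev x + sh j"
  proof
    assume e: "of_int (m j x) = lev x + sh j"
    have "of_int (m j x) \<in> (\<int> :: real set)" by simp
    then have "lev x + sh j \<in> \<int>" unfolding e .
    then show False using x by (simp add: Us_def)
  qed
  moreover have "of_int (m j x) \<le> lev x + sh j" "lev x + sh j < of_int (m j x) + 1"
    unfolding m_def by linarith+
  ultimately show "x \<in> {y\<in>W. lev y + sh j \<in> {of_int (m j x)<..<of_int (m j x) + 1}}"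
    using x by (auto simp: Us_def)
  fix y assume "y \<in> {y\<in>W. lev y + sh j \<in> {of_int (m j x)<..<of_int (m j x) + 1}}"
  then show "m j y = m j x" unfolding m_def[of j y] by (auto simp: floor_eq_iff)
qed auto

lemma m_hol: "hol_on 2 (Us j) (\<lambda>x. of_int (m j x))"
proof (rule hol_on_local[OF Us_open])
  fix x assume "x \<in> Us j"
  then obtain U where U: "openin (cspace 2) U" "x \<in> U" "\<forall>y\<in>U. m j y = m j x" using m_local by blast
  have "hol_on 2 U (\<lambda>x. of_int (m j x))"
    by (rule hol_on_cong[OF U(1) _ hol_on_const[of 2 U "of_int (m j x)"]]) (simp only: bspec[OF U(3)])
  then show "\<exists>U. openin (cspace 2) U \<and> x \<in> U \<and> hol_on 2 (U \<inter> Us j) (\<lambda>x. of_int (m j x))"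
    using U by (intro exI[of _ U]) (auto elim: hol_on_subset)
qed

end

context hopf_target
begin

text \<open>The Jacobian matrix of the chart \<open>c\<close> with respect to the linear coordinates
  of \<open>W\<close>: row \<open>a\<close>, column \<open>i\<close>.\<close>

definition dphi :: "'e chart \<Rightarrow> nat \<Rightarrow> nat \<Rightarrow> (nat \<Rightarrow> complex) \<Rightarrow> complex" where
  "dphi c a i x = pdv i (\<lambda>y. snd c (\<phi> y) a) x"

lemma dom_open: "c \<in> max_atlas M \<Longrightarrow> openin (cspace 2) {x\<in>W. \<phi> x \<in> fst c}"
  by (rule \<phi>_preimage_open[OF chart_open_dom[OF max_atlas_chart]])

lemma coord_hol2: "c \<in> max_atlas M \<Longrightarrow> a < 2 \<Longrightarrow> hol_on 2 {x\<in>W. \<phi> x \<in> fst c} (\<lambda>x. snd c (\<phi> x) a)"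
  using coord_hol mdim_2 by simp

lemma dphi_hol: "c \<in> max_atlas M \<Longrightarrow> a < 2 \<Longrightarrow> i < 2 \<Longrightarrow> hol_on 2 {x\<in>W. \<phi> x \<in> fst c} (dphi c a i)"
  unfolding dphi_def[abs_def] by (rule hol_on_pdv_hol[OF coord_hol2 dom_open])

text \<open>Differentiation of the identity \<open>\<phi> (act k y) = \<phi> y\<close>.\<close>

lemma dphi_act:
  assumes c: "c \<in> max_atlas M" and x: "x \<in> W" "\<phi> x \<in> fst c" and a: "a < 2" and i: "i < 2"
  shows "dphi c a i x = \<mu> k i * dphi c a i (act k x)"
proof -
  have "dphi c a i x = pdv i (\<lambda>y. snd c (\<phi> (act k y)) a) x"
    unfolding dphi_def by (rule pdv_cong[OF openin_W x(1) i]) (simp add: \<phi>_act)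
  also have "\<dots> = \<mu> k i * dphi c a i (act k x)"
    unfolding dphi_def
    by (rule act_chain[OF coord_hol2[OF c a] dom_open[OF c]])
      (use x i act_W \<phi>_act W_cvec in auto)
  finally show ?thesis .
qed

lemma hol_fun_coord: "d \<in> max_atlas M \<Longrightarrow> a < 2 \<Longrightarrow> hol_fun M (fst d) (\<lambda>q. snd d q a)"
  using hol_fun_iff[OF chart_open_dom[OF max_atlas_chart]] coord_hol2 by blast

lemma dphi_trans:
  assumes "c \<in> max_atlas M" "d \<in> max_atlas M" "x \<in> W" "\<phi> x \<in> fst c" "\<phi> x \<in> fst d" "a < 2" "i < 2"
  shows "dphi d a i x = (\<Sum>l<2. pd c l (\<lambda>q. snd d q a) (\<phi> x) * dphi c l i x)"
  unfolding dphi_def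
  by (rule pd_chain[OF assms(1) chart_open_dom[OF max_atlas_chart[OF assms(2)]] hol_fun_coord[OF assms(2,6)]])
    (use assms in auto)

text \<open>Fields on the manifold are given by their components on \<open>W\<close>, evaluated at an arbitrary
  preimage \<open>lft q\<close>: \<open>Vc\<close> are the components of \<open>z \<partial>/\<partial>z\<close> and \<open>Pc\<close> those of \<open>w ^ (p + 1) \<partial>/\<partial>z \<and> \<partial>/\<partial>w\<close> in
  the chart \<open>c\<close>.\<close>

definition lft :: "'e \<Rightarrow> nat \<Rightarrow> complex" where "lft q = inv_into W \<phi> q"

lemma lft_act: "x \<in> W \<Longrightarrow> \<exists>k. lft (\<phi> x) = act k x"
proof -
  assume x: "x \<in> W"
  then have "lft (\<phi> x) \<in> W" "\<phi> (lft (\<phi> x)) = \<phi> x"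
    unfolding lft_def using inv_into_into[of "\<phi> x" \<phi> W] f_inv_into_f[of "\<phi> x" \<phi> W] by auto
  then show ?thesis using \<phi>_eq_iff[of x "lft (\<phi> x)"] x by auto
qed

lemma descend: "x \<in> W \<Longrightarrow> (\<And>k. \<Psi> (act k x) = \<Psi> x) \<Longrightarrow> \<Psi> (lft (\<phi> x)) = \<Psi> x"
  using lft_act by metis

definition Vc :: "'e chart \<Rightarrow> nat \<Rightarrow> (nat \<Rightarrow> complex) \<Rightarrow> complex" where
  "Vc c a x = x 0 * dphi c a 0 x"

definition Pc :: "'e chart \<Rightarrow> nat \<Rightarrow> nat \<Rightarrow> (nat \<Rightarrow> complex) \<Rightarrow> complex" where
  "Pc c a b x = x 1 ^ (p + 1) * (dphi c a 0 x * dphi c b 1 x - dphi c a 1 x * dphi c b 0 x)"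

lemma Vc_act:
  assumes "c \<in> max_atlas M" "x \<in> W" "\<phi> x \<in> fst c" "a < 2"
  shows "Vc c a (act k x) = Vc c a x"
  using dphi_act[OF assms(1-4), of 0 k] by (simp add: Vc_def \<mu>_def mult_ac)

text \<open>The weight \<open>p + 1\<close> of the power of \<open>x 1\<close> cancels the weights
  \<open>p\<close> and 1 of the two columns of the Jacobian matrix.\<close>

lemma Pc_act:
  assumes "c \<in> max_atlas M" "x \<in> W" "\<phi> x \<in> fst c" "a < 2" "b < 2"
  shows "Pc c a b (act k x) = Pc c a b x"
proof -
  let ?x = "act k x" and ?w = "\<delta> powi k"
  have e: "dphi c a 0 x = ?w ^ p * dphi c a 0 ?x" "dphi c a 1 x = ?w * dphi c a 1 ?x" if "a < 2" for a
    using dphi_act[OF assms(1-3) that, of 0 k] dphi_act[OF assms(1-3) that, of 1 k]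
    by (simp_all add: \<mu>_def weight_eq)
  have "Pc c a b x = x 1 ^ (p + 1) * (?w ^ p * dphi c a 0 ?x * (?w * dphi c b 1 ?x) - ?w * dphi c a 1 ?x * (?w ^ p * dphi c b 0 ?x))"
    by (simp only: Pc_def e[OF assms(4)] e[OF assms(5)])
  also have "\<dots> = (?w * x 1) ^ (p + 1) * (dphi c a 0 ?x * dphi c b 1 ?x - dphi c a 1 ?x * dphi c b 0 ?x)"
    by (simp add: power_mult_distrib algebra_simps)
  also have "\<dots> = Pc c a b ?x"
    by (simp only: Pc_def One_nat_def act_coord)
  finally show ?thesis by (rule sym)
qed

definition \<theta>c :: "nat \<Rightarrow> nat \<Rightarrow> 'e vfield" where
  "\<theta>c j k = (\<lambda>c a q. of_int (m k (lft q) - m j (lft q)) * Vc c a (lft q))"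

definition \<pi>c :: "'e bivfield" where "\<pi>c = (\<lambda>c a b q. Pc c a b (lft q))"

definition Uc :: "nat \<Rightarrow> 'e set" where "Uc j = \<phi> ` Us j"

lemma \<theta>c_\<phi>:
  assumes "c \<in> max_atlas M" "x \<in> W" "\<phi> x \<in> fst c" "a < 2"
  shows "\<theta>c j k c a (\<phi> x) = of_int (m k x - m j x) * Vc c a x"
  unfolding \<theta>c_def
  by (rule descend[where \<Psi> = "\<lambda>y. of_int (m k y - m j y) * Vc c a y"]) (use assms in \<open>auto simp: m_act Vc_act\<close>)

lemma \<pi>c_\<phi>:
  assumes "c \<in> max_atlas M" "x \<in> W" "\<phi> x \<in> fst c" "a < 2" "b < 2"
  shows "\<pi>c c a b (\<phi> x) = Pc c a b x"
  unfolding \<pi>c_def by (rule descend) (use assms in \<open>auto simp: Pc_act\<close>)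

lemma \<phi>_Uc: "x \<in> W \<Longrightarrow> \<phi> x \<in> Uc j \<longleftrightarrow> x \<in> Us j"
proof
  assume x: "x \<in> W" and "\<phi> x \<in> Uc j"
  then obtain y where y: "y \<in> Us j" "\<phi> y = \<phi> x" by (auto simp: Uc_def)
  then obtain k where "x = act k y" using \<phi>_eq_iff[of y x] x by (auto simp: Us_def)
  then show "x \<in> Us j" using y Us_act by (auto simp: Us_def)
qed (auto simp: Uc_def)

lemma Uc_open: "openin (mtop M) (Uc j)"
  unfolding Uc_def by (rule \<phi>_image_open[OF Us_open]) (auto simp: Us_def)

context
  fixes L :: "'e bivfield"
  assumes L: "\<And>c q a b. c \<in> max_atlas M \<Longrightarrow> q \<in> fst c \<Longrightarrow> a < 2 \<Longrightarrow> b < 2 \<Longrightarrow> L c a b q = 0"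
begin

lemma pd_zero:
  assumes c: "c \<in> max_atlas M" and q: "q \<in> fst c" and "l < 2" "a < 2" "b < 2"
  shows "pd c l (L c a b) q = 0"
proof -
  note cc = max_atlas_chart[OF c]
  have "pd c l (L c a b) q = pd c l (\<lambda>q. 0) q"
    by (rule pd_cong[OF cc q q chart_open_dom[OF cc]]) (use assms mdim_2 L[OF c] in auto)
  then show ?thesis by (simp add: pd_pdv)
qed

text \<open>For the zero Poisson structure the differential of the complex vanishes, so only the
  Cech direction contributes to cocycle conditions and coboundaries.\<close>

lemma lie_deriv_zero:
  assumes "c \<in> max_atlas M" "q \<in> fst c" "i < 2" "j < 2"
  shows "lie_deriv M X L c i j q = 0"
  using L[OF assms(1,2)] pd_zero[OF assms(1,2)] assms(3,4) by (simp add: lie_deriv_def mdim_2)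

lemma schouten_zero: "schouten_bb_zero M S L Q"
  unfolding schouten_bb_zero_def mdim_2 using L pd_zero by (simp add: schouten_bb_def mdim_2)

end

section \<open>The hypercocycle\<close>

lemma \<theta>c_vfield: "hol_vfield M (Uc j \<inter> Uc k) (\<theta>c j k)"
  unfolding hol_vfield_def mdim_2
proof (intro conjI ballI allI impI)
  fix c and i :: nat assume c: "c \<in> max_atlas M" and i: "i < 2"
  have o: "openin (mtop M) (Uc j \<inter> Uc k \<inter> fst c)"
    using Uc_open chart_open_dom[OF max_atlas_chart[OF c]] by blast
  let ?T = "{x\<in>W. \<phi> x \<in> Uc j \<inter> Uc k \<inter> fst c}"
  have "hol_on 2 ?T (\<lambda>x. of_int (m k x) - of_int (m j x))"
    by (intro hol_on_diff hol_on_subset[OF m_hol]) (auto simp: \<phi>_Uc)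
  moreover have "hol_on 2 ?T (Vc c i)" unfolding Vc_def[abs_def]
    by (intro hol_on_mult hol_on_coord hol_on_subset[OF dphi_hol[OF c i]]) auto
  ultimately have "hol_on 2 ?T (\<lambda>x. (of_int (m k x) - of_int (m j x)) * Vc c i x)"
    by (rule hol_on_mult)
  then show "hol_fun M (Uc j \<inter> Uc k \<inter> fst c) (\<theta>c j k c i)"
    unfolding hol_fun_iff[OF o]
    by (rule hol_on_cong[OF \<phi>_preimage_open[OF o], rotated]) (use c i in \<open>auto simp: \<theta>c_\<phi>\<close>)
next
  fix c d q and a :: nat
  assume c: "c \<in> max_atlas M" and d: "d \<in> max_atlas M" and q: "q \<in> Uc j \<inter> Uc k \<inter> fst c \<inter> fst d" and a: "a < 2"
  have "q \<in> points M" using q openin_subset[OF Uc_open] by blast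
  then obtain x where x: "x \<in> W" "q = \<phi> x" using \<phi>_surj by blast
  have A: "Vc d a x = (\<Sum>i<2. Vc c i x * pd c i (\<lambda>q. snd d q a) q)"
    using dphi_trans[OF c d x(1) _ _ a, of 0] q x(2) by (simp add: Vc_def sum_lessThan_2 algebra_simps)
  have B: "\<theta>c j k d a q = of_int (m k x - m j x) * Vc d a x"
    using \<theta>c_\<phi>[OF d x(1) _ a] q x(2) by simp
  have C: "\<theta>c j k c i q = of_int (m k x - m j x) * Vc c i x" if "i < 2" for i
    using \<theta>c_\<phi>[OF c x(1) _ that] q x(2) by simp
  have "(\<Sum>i<2. \<theta>c j k c i q * pd c i (\<lambda>q. snd d q a) q) =
      (\<Sum>i<2. of_int (m k x - m j x) * Vc c i x * pd c i (\<lambda>q. snd d q a) q)"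
    by (intro sum.cong refl) (simp only: C lessThan_iff)
  then show "\<theta>c j k d a q = (\<Sum>i<2. \<theta>c j k c i q * pd c i (\<lambda>q. snd d q a) q)"
    unfolding A B by (simp only: sum_distrib_left mult.assoc)
qed

lemma \<pi>c_bivfield: "hol_bivfield M (Uc j) \<pi>c"
  unfolding hol_bivfield_def mdim_2
proof (intro conjI ballI allI impI)
  fix c and i l :: nat assume c: "c \<in> max_atlas M" and i: "i < 2" "l < 2"
  have o: "openin (mtop M) (Uc j \<inter> fst c)"
    using Uc_open chart_open_dom[OF max_atlas_chart[OF c]] by blast
  have "hol_on 2 {x\<in>W. \<phi> x \<in> Uc j \<inter> fst c} (Pc c i l)" unfolding Pc_def[abs_def]
    by (intro hol_on_mult hol_on_power hol_on_coord hol_on_diff hol_on_subset[OF dphi_hol[OF c]]) (use i in auto)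
  then show "hol_fun M (Uc j \<inter> fst c) (\<pi>c c i l)"
    unfolding hol_fun_iff[OF o]
    by (rule hol_on_cong[OF \<phi>_preimage_open[OF o], rotated]) (use c i in \<open>auto simp: \<pi>c_\<phi>\<close>)
next
  fix c q and i l :: nat
  show "\<pi>c c i l q = - \<pi>c c l i q" by (simp add: \<pi>c_def Pc_def algebra_simps)
next
  fix c d q and a b :: nat
  assume c: "c \<in> max_atlas M" and d: "d \<in> max_atlas M" and q: "q \<in> Uc j \<inter> fst c \<inter> fst d" and a: "a < 2" and b: "b < 2"
  have "q \<in> points M" using q openin_subset[OF Uc_open] by blast
  then obtain x where x: "x \<in> W" "q = \<phi> x" using \<phi>_surj by blast
  have e: "dphi d a i x = pd c 0 (\<lambda>q. snd d q a) q * dphi c 0 i x + pd c 1 (\<lambda>q. snd d q a) q * dphi c 1 i x"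
    if "a < 2" "i < 2" for a i
    using dphi_trans[OF c d x(1) _ _ that] q x(2) by (simp add: sum_lessThan_2)
  have "Pc d a b x = (\<Sum>i<2. \<Sum>l<2. Pc c i l x * pd c i (\<lambda>q. snd d q a) q * pd c l (\<lambda>q. snd d q b) q)"
    unfolding Pc_def sum_lessThan_2 using e[OF a, of 0] e[OF a, of 1] e[OF b, of 0] e[OF b, of 1]
    by (simp add: algebra_simps)
  moreover have "\<pi>c d a b q = Pc d a b x"
    using \<pi>c_\<phi>[OF d x(1) _ a b] q x(2) by simp
  moreover have "\<pi>c c i l q = Pc c i l x" if "i < 2" "l < 2" for i l
    using \<pi>c_\<phi>[OF c x(1) _ that] q x(2) by simp
  ultimately show "\<pi>c d a b q = (\<Sum>i<2. \<Sum>l<2. \<pi>c c i l q * pd c i (\<lambda>q. snd d q a) q * pd c l (\<lambda>q. snd d q b) q)"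
    by (simp add: sum_lessThan_2)
qed

text \<open>The bivector part is the same global field on every set. The vector part is additive
  because it is a difference of multiples \<open>m j\<close> of \<open>V\<close>, although a single
  \<open>m j\<close> is not invariant and does not descend to \<open>M\<close>.\<close>

lemma cocycle_Z1:
  assumes L: "\<And>c q a b. c \<in> max_atlas M \<Longrightarrow> q \<in> fst c \<Longrightarrow> a < 2 \<Longrightarrow> b < 2 \<Longrightarrow> L c a b q = 0"
  shows "(Uc, \<theta>c, \<lambda>j. \<pi>c) \<in> hyper_Z1 M L"
  unfolding hyper_Z1_def mem_Collect_eq prod.case
proof (intro conjI allI)
  show "open_cover M Uc"
    unfolding open_cover_def
  proof (intro conjI allI Uc_open)
    show "(\<Union>j. Uc j) = points M"
    proof (intro set_eqI iffI)
      fix q assume "q \<in> points M"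
      then obtain x where "x \<in> W" "q = \<phi> x" using \<phi>_surj by blast
      then show "q \<in> (\<Union>j. Uc j)" using Us_cover[of x] by (auto simp: Uc_def)
    qed (use openin_subset[OF Uc_open] in blast)
  qed
  show "vf_eq M (Uc i \<inter> Uc j \<inter> Uc k) (\<theta>c i k) (vf_add (\<theta>c i j) (\<theta>c j k))" for i j k
    by (simp add: vf_eq_def vf_add_def \<theta>c_def algebra_simps)
  show "bf_eq M (Uc j \<inter> Uc k) (bf_add (bf_diff \<pi>c \<pi>c) (schouten_bv M L (\<theta>c j k))) bf_zero" for j k
    by (auto simp: bf_eq_def bf_add_def bf_diff_def schouten_bv_def bf_scale_def bf_zero_def mdim_2 lie_deriv_zero[OF L])
qed (use \<theta>c_vfield \<pi>c_bivfield schouten_zero[OF L] in auto)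

subsection \<open>Components of vector fields with respect to the linear coordinates\<close>

text \<open>The chart varies with the point; by \<open>Yw_eq\<close> every other small neighbourhood
  of the point gives the same value.\<close>

definition Yw :: "'e vfield \<Rightarrow> nat \<Rightarrow> (nat \<Rightarrow> complex) \<Rightarrow> complex" where
  "Yw Y i x = Y (kchart (nb x)) i (\<phi> x)"

lemma dphi_kchart:
  assumes U: "small U" and x: "x \<in> U" and "i < 2"
  shows "dphi (kchart U) a i x = (if i = a then 1 else 0)"
proof -
  have "dphi (kchart U) a i x = pdv i (\<lambda>y. y a) x"
    unfolding dphi_def by (rule pdv_cong[OF small_open[OF U] x]) (use assms kchart_sel(2) in auto)
  then show ?thesis by (simp add: pdv_coord)
qed

context
  fixes S :: "'e set" and Y :: "'e vfield"
  assumes S: "openin (mtop M) S" and Y: "hol_vfield M S Y"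
begin

lemma Yw_comp:
  assumes x: "x \<in> W" "\<phi> x \<in> S" and d: "d \<in> max_atlas M" "\<phi> x \<in> fst d" and a: "a < 2"
  shows "Y d a (\<phi> x) = (\<Sum>i<2. Yw Y i x * dphi d a i x)"
proof -
  have "Y d a (\<phi> x) = (\<Sum>i<2. Y (kchart (nb x)) i (\<phi> x) * pd (kchart (nb x)) i (\<lambda>q. snd d q a) (\<phi> x))"
    using Y kchart_max_atlas[OF small_nb, of x] d x a nb_self[OF x(1)]
    unfolding hol_vfield_def mdim_2 kchart_def by auto
  then show ?thesis
    using pd_kchart[OF small_nb nb_self[OF x(1)]] by (simp add: Yw_def dphi_def sum_lessThan_2)
qed

lemma Yw_eq:
  assumes U: "small U" "x \<in> U" and x: "\<phi> x \<in> S" and i: "i < 2"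
  shows "Y (kchart U) i (\<phi> x) = Yw Y i x"
proof -
  have "Y (kchart U) i (\<phi> x) = (\<Sum>l<2. Yw Y l x * dphi (kchart U) i l x)"
    by (rule Yw_comp) (use assms small_W kchart_max_atlas in \<open>auto simp: kchart_sel\<close>)
  then show ?thesis using i dphi_kchart[OF U] by (auto simp: sum_lessThan_2 less_2_cases_iff)
qed

lemma Yw_hol:
  assumes i: "i < 2"
  shows "hol_on 2 {x\<in>W. \<phi> x \<in> S} (Yw Y i)"
proof (rule hol_on_local[OF \<phi>_preimage_open[OF S]])
  fix x assume x: "x \<in> {x \<in> W. \<phi> x \<in> S}"
  let ?U = "nb x"
  have o: "openin (mtop M) (S \<inter> \<phi> ` ?U)" using S \<phi>_image_open_small[OF small_nb] by blast
  have "hol_fun M (S \<inter> \<phi> ` ?U) (Y (kchart ?U) i)"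
    using Y kchart_max_atlas[OF small_nb, of x] i unfolding hol_vfield_def mdim_2 by (metis kchart_sel(1))
  then have "hol_on 2 {y\<in>W. \<phi> y \<in> S \<inter> \<phi> ` ?U} (\<lambda>y. Y (kchart ?U) i (\<phi> y))"
    unfolding hol_fun_iff[OF o] .
  then have "hol_on 2 {y\<in>?U. \<phi> y \<in> S} (\<lambda>y. Y (kchart ?U) i (\<phi> y))"
    by (rule hol_on_subset) (auto simp: nb_def)
  then have "hol_on 2 {y\<in>?U. \<phi> y \<in> S} (Yw Y i)"
    by (rule hol_on_cong[OF small_preimage_open[OF small_nb S], rotated]) (auto intro: Yw_eq[OF small_nb] i)
  then show "\<exists>T. openin (cspace 2) T \<and> x \<in> T \<and> hol_on 2 (T \<inter> {x \<in> W. \<phi> x \<in> S}) (Yw Y i)"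
    using nb_open nb_self x by (intro exI[of _ ?U]) (auto elim: hol_on_subset)
qed

text \<open>The lift of a vector field to \<open>W\<close> is invariant under the action, so its
  component \<open>i\<close> scales like the coordinate \<open>i\<close>.\<close>

lemma Yw_act:
  assumes x: "x \<in> W" "\<phi> x \<in> S" and i: "i < 2"
  shows "Yw Y i (act k x) = \<mu> k i * Yw Y i x"
proof -
  let ?d = "kchart (nb (act k x))"
  have mem: "act k x \<in> nb (act k x)" using x act_W nb_self by blast
  have dom: "\<phi> x \<in> fst ?d" unfolding kchart_sel(1) using mem \<phi>_act[OF x(1)] by (metis imageI)
  have "Yw Y i (act k x) = Y ?d i (\<phi> x)" by (simp add: Yw_def \<phi>_act x)
  also have "\<dots> = (\<Sum>l<2. Yw Y l x * dphi ?d i l x)"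
    by (rule Yw_comp[OF x kchart_max_atlas[OF small_nb] dom i])
  also have "\<dots> = (\<Sum>l<2. Yw Y l x * (\<mu> k l * dphi ?d i l (act k x)))"
    using dphi_act[OF kchart_max_atlas[OF small_nb] x(1) dom i] by (simp add: sum_lessThan_2)
  also have "\<dots> = \<mu> k i * Yw Y i x"
    using i dphi_kchart[OF small_nb mem] by (auto simp: sum_lessThan_2 less_2_cases_iff)
  finally show ?thesis .
qed

end

end

section \<open>Second order expansions\<close>

definition mk3 :: "complex \<Rightarrow> complex \<Rightarrow> complex \<Rightarrow> nat \<Rightarrow> complex" where
  "mk3 a b s = (\<lambda>i. 0)(0 := a, 1 := b, 2 := s)"

lemma mk3_simps [simp]: "mk3 a b s 0 = a" "mk3 a b s (Suc 0) = b" "mk3 a b s 2 = s" "mk3 a b s \<in> cvec 3"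
  by (auto simp: mk3_def cvec_def)

lemma sum_lessThan_3: "(\<Sum>i<(3::nat). f i) = f 0 + f 1 + (f 2 :: 'a::comm_monoid_add)"
  by (simp add: numeral_3_eq_3 numeral_2_eq_2)

lemma less_3_cases: "i < (3::nat) \<Longrightarrow> i = 0 \<or> i = 1 \<or> i = 2" by auto

lemma hol_on_mk3:
  assumes "hol_on n V a" "hol_on n V b" "hol_on n V s"
  shows "hol_on n V (\<lambda>y. mk3 (a y) (b y) (s y) i)"
  by (cases "i = 2"; cases "i = 1"; cases "i = 0") (use assms in \<open>auto simp: mk3_def\<close>)

lemma restrict_cvec: "y \<in> cvec 3 \<Longrightarrow> y(2 := 0) \<in> cvec 2"
  unfolding cvec_def mem_Collect_eq
proof (intro allI impI)
  fix i :: nat assume "\<forall>i\<ge>3. y i = 0" "2 \<le> i"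
  then show "(y(2 := 0)) i = 0" by (cases "i = 2") auto
qed

lemma cvec_2_3: "x \<in> cvec 2 \<Longrightarrow> x \<in> cvec 3" by (auto simp: cvec_def)

lemma cvec_2_restrict: "x \<in> cvec 2 \<Longrightarrow> x(2 := 0) = x" by (auto simp: cvec_def)

lemma restrict_open:
  assumes "openin (cspace 2) T"
  shows "openin (cspace 3) {y\<in>cvec 3. y(2 := 0) \<in> T}"
  by (rule hol_preimage_open[OF open_cvec restrict_cvec _ assms]) (auto simp: fun_upd_def)

lemma restrict_hol:
  assumes f: "hol_on 2 T f" and T: "openin (cspace 2) T"
  shows "hol_on 3 {y\<in>cvec 3. y(2 := 0) \<in> T} (\<lambda>y. f (y(2 := 0)))"
  by (rule hol_on_compose[OF f T restrict_open[OF T]]) auto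

lemma restrict_pdv: "i < 2 \<Longrightarrow> pdv i (\<lambda>y. f (y(2 := 0))) y = pdv i f (y(2 := 0))"
  unfolding pdv_def by (simp add: fun_upd_twist)

lemma restrict_pdv_2: "pdv 2 (\<lambda>y. f (y(2 := 0))) y = 0"
  unfolding pdv_def by simp

lemma pdv_vanishing:
  assumes "openin (cspace 3) D" "\<And>y. y \<in> D \<Longrightarrow> y 2 = 0 \<Longrightarrow> f y = 0" "z \<in> D" "z 2 = 0" "i < 2"
  shows "pdv i f z = 0"
proof -
  have "pdv i f z = pdv i (\<lambda>y. 0) z"
  proof (rule pdv_cong_ev)
    show "eventually (\<lambda>s. f (z(i := s)) = 0) (nhds (z i))"
      using slice_nhd[OF assms(1,3), of i] assms(4,5) by (auto elim!: eventually_mono intro!: assms(2))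
  qed
  then show ?thesis by simp
qed

text \<open>Model of one overlap, with \<open>y 2\<close> the parameter \<open>s\<close>:
  \<open>B\<close> and \<open>A\<close> are coefficients of one bivector field in two charts,
  \<open>(H0, H1)\<close> the coordinates in the first chart, \<open>K\<close> and \<open>J\<close>
  Jacobian determinants. Both sides of \<open>eq\<close> are differentiated twice in
  \<open>s\<close>. At \<open>s = 0\<close> the vanishing of \<open>B\<close> and \<open>A\<close>
  removes the second derivatives of \<open>H0\<close>, \<open>H1\<close> and \<open>J\<close>; each
  mixed term occurs twice.\<close>

lemma second_order_transformation:
  assumes B: "hol_on 3 \<Omega> B" and \<Omega>: "openin (cspace 3) \<Omega>" and B0: "\<And>y. y \<in> \<Omega> \<Longrightarrow> y 2 = 0 \<Longrightarrow> B y = 0"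
    and D: "openin (cspace 3) D" and H0: "hol_on 3 D H0" and H1: "hol_on 3 D H1"
    and H\<Omega>: "\<And>y. y \<in> D \<Longrightarrow> mk3 (H0 y) (H1 y) (y 2) \<in> \<Omega>"
    and A: "hol_on 3 D A" and A0: "\<And>y. y \<in> D \<Longrightarrow> y 2 = 0 \<Longrightarrow> A y = 0"
    and K: "hol_on 3 D K" and K2: "\<And>y. y \<in> D \<Longrightarrow> pdv 2 K y = 0"
    and J: "hol_on 3 D J"
    and eq: "\<And>y. y \<in> D \<Longrightarrow> B (mk3 (H0 y) (H1 y) (y 2)) * K y = J y * A y"
    and x: "x \<in> D" "x 2 = 0" and z: "z = mk3 (H0 x) (H1 x) 0"
  shows "(pdv 2 (pdv 2 B) z + 2 * (pdv 0 (pdv 2 B) z * pdv 2 H0 x + pdv 1 (pdv 2 B) z * pdv 2 H1 x)) * K x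
    = J x * pdv 2 (pdv 2 A) x + 2 * pdv 2 J x * pdv 2 A x"
proof -
  define G where "G y = mk3 (H0 y) (H1 y) (y 2)" for y
  have Gz: "G x = z" using x z by (simp add: G_def)
  have z\<Omega>: "z \<in> \<Omega>" "z 2 = 0" using H\<Omega>[OF x(1)] Gz z by (auto simp: G_def)
  have Gh: "hol_on 3 D (\<lambda>y. G y i)" for i
    unfolding G_def by (rule hol_on_mk3[OF H0 H1 hol_on_coord])
  have G\<Omega>: "G y \<in> \<Omega>" if "y \<in> D" for y using H\<Omega>[OF that] by (simp add: G_def)
  have comp: "hol_on 3 D (\<lambda>y. f (G y))" if "hol_on 3 \<Omega> f" for f
    by (rule hol_on_compose[OF that \<Omega> D G\<Omega> Gh])
  have chain: "pdv 2 (\<lambda>y. f (G y)) y = pdv 0 f (G y) * pdv 2 H0 y + pdv 1 f (G y) * pdv 2 H1 y + pdv 2 f (G y)"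
    if f: "hol_on 3 \<Omega> f" and y: "y \<in> D" for f y
  proof -
    have "pdv 2 (\<lambda>y. f (G y)) y = (\<Sum>i<3. pdv i f (G y) * pdv 2 (\<lambda>y. G y i) y)"
      by (rule pdv_compose[OF f \<Omega> D G\<Omega> Gh y]) simp_all
    then show ?thesis by (simp add: sum_lessThan_3 G_def pdv_coord)
  qed
  have hB: "hol_on 3 \<Omega> (pdv i B)" if "i < 3" for i using hol_on_pdv_hol[OF B \<Omega> that] .
  \<comment> \<open>The directions 0 and 1 are tangent to the hyperplane \<open>y 2 = 0\<close>, on
    which \<open>B\<close> vanishes.\<close>
  have zero1: "pdv i B y = 0" if "i < 2" "y \<in> \<Omega>" "y 2 = 0" for i y
    using pdv_vanishing[OF \<Omega> B0 that(2,3,1)] by simp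
  have zero2: "pdv l (pdv i B) z = 0" if "i < 2" "l < 2" for i l
    using pdv_vanishing[OF \<Omega> zero1[OF that(1)] z\<Omega> that(2)] by simp
  have comm: "pdv 2 (pdv i B) z = pdv i (pdv 2 B) z" if "i < 2" for i
    using pdv_commute[OF B \<Omega> z\<Omega>(1), of i 2] that by simp
  define BG where "BG = (\<lambda>y. B (G y))"
  have hBG: "hol_on 3 D BG" unfolding BG_def by (rule comp[OF B])
  have h2: "hol_on 3 D (pdv 2 f)" if "hol_on 3 D f" for f using hol_on_pdv_hol[OF that D] by simp
  have d2: "pdv 2 (\<lambda>y. f y * g y) y = pdv 2 f y * g y + f y * pdv 2 g y"
    if "hol_on 3 D f" "hol_on 3 D g" "y \<in> D" for f g y using pdv_mult[OF that, of 2] by simp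
  have a2: "pdv 2 (\<lambda>y. f y + g y) y = pdv 2 f y + pdv 2 g y"
    if "hol_on 3 D f" "hol_on 3 D g" "y \<in> D" for f g y using pdv_add[OF that, of 2] by simp
  have BG2: "pdv 2 (pdv 2 BG) x = pdv 2 (pdv 2 B) z + 2 * (pdv 0 (pdv 2 B) z * pdv 2 H0 x + pdv 1 (pdv 2 B) z * pdv 2 H1 x)"
  proof -
    let ?P = "\<lambda>i y. pdv i B (G y)"
    have "pdv 2 (pdv 2 BG) x = pdv 2 (\<lambda>y. ?P 0 y * pdv 2 H0 y + ?P 1 y * pdv 2 H1 y + ?P 2 y) x"
      by (rule pdv_cong[OF D x(1)]) (simp_all add: BG_def chain[OF B])
    also have "\<dots> = (pdv 2 (?P 0) x * pdv 2 H0 x + ?P 0 x * pdv 2 (pdv 2 H0) x)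
        + (pdv 2 (?P 1) x * pdv 2 H1 x + ?P 1 x * pdv 2 (pdv 2 H1) x) + pdv 2 (?P 2) x"
    proof -
      have h: "hol_on 3 D (?P 0)" "hol_on 3 D (?P 1)" "hol_on 3 D (?P 2)" by (rule comp[OF hB]; simp)+
      note m0 = hol_on_mult[OF h(1) h2[OF H0]] and m1 = hol_on_mult[OF h(2) h2[OF H1]]
      show ?thesis
        using a2[OF hol_on_add[OF m0 m1] h(3) x(1)] a2[OF m0 m1 x(1)]
          d2[OF h(1) h2[OF H0] x(1)] d2[OF h(2) h2[OF H1] x(1)] by simp
    qed
    also have "?P 0 x = 0" using zero1[of 0] z\<Omega> Gz by simp
    also have "?P 1 x = 0" using zero1[of 1] z\<Omega> Gz by simp
    also have "pdv 2 (?P 0) x = pdv 0 (pdv 2 B) z"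
      using chain[OF hB x(1), of 0] zero2[of 0] comm[of 0] Gz by simp
    also have "pdv 2 (?P 1) x = pdv 1 (pdv 2 B) z"
      using chain[OF hB x(1), of 1] zero2[of 1] comm[of 1] Gz by simp
    also have "pdv 2 (?P 2) x = pdv 0 (pdv 2 B) z * pdv 2 H0 x + pdv 1 (pdv 2 B) z * pdv 2 H1 x + pdv 2 (pdv 2 B) z"
      using chain[OF hB x(1), of 2] Gz by simp
    finally show ?thesis by (simp add: algebra_simps)
  qed
  have "pdv 2 (pdv 2 (\<lambda>y. BG y * K y)) x = pdv 2 (\<lambda>y. pdv 2 BG y * K y) x"
    by (rule pdv_cong[OF D x(1)]) (simp_all add: d2[OF hBG K] K2)
  also have "\<dots> = pdv 2 (pdv 2 BG) x * K x"
    using d2[OF h2[OF hBG] K x(1)] K2[OF x(1)] by simp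
  finally have L: "pdv 2 (pdv 2 (\<lambda>y. BG y * K y)) x = pdv 2 (pdv 2 BG) x * K x" .
  have "pdv 2 (pdv 2 (\<lambda>y. J y * A y)) x = pdv 2 (\<lambda>y. pdv 2 J y * A y + J y * pdv 2 A y) x"
    by (rule pdv_cong[OF D x(1)]) (simp_all add: d2[OF J A])
  also have "\<dots> = (pdv 2 (pdv 2 J) x * A x + pdv 2 J x * pdv 2 A x) + (pdv 2 J x * pdv 2 A x + J x * pdv 2 (pdv 2 A) x)"
    using a2[OF hol_on_mult[OF h2[OF J] A] hol_on_mult[OF J h2[OF A]] x(1)]
      d2[OF h2[OF J] A x(1)] d2[OF J h2[OF A] x(1)] by simp
  finally have R: "pdv 2 (pdv 2 (\<lambda>y. J y * A y)) x = J x * pdv 2 (pdv 2 A) x + 2 * pdv 2 J x * pdv 2 A x"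
    using A0[OF x] by simp
  have e1: "pdv 2 (\<lambda>y. BG y * K y) y = pdv 2 (\<lambda>y. J y * A y) y" if "y \<in> D" for y
    by (rule pdv_cong[OF D that]) (simp_all add: BG_def G_def eq)
  have "pdv 2 (pdv 2 (\<lambda>y. BG y * K y)) x = pdv 2 (pdv 2 (\<lambda>y. J y * A y)) x"
    by (rule pdv_cong[OF D x(1)]) (simp_all add: e1)
  then show ?thesis unfolding L R BG2 .
qed

text \<open>Both identities express that the Lie derivative of a bivector field in two variables does not
  depend on the coordinates: \<open>J\<close> is the Jacobian determinant of the coordinate change \<open>(h0, h1)\<close>,
  which carries the vector field \<open>\<tau>\<close> to \<open>\<theta>\<close>.\<close>

context
  fixes T :: "(nat \<Rightarrow> complex) set" and h0 h1 g \<tau>0 \<tau>1 J \<theta>0 \<theta>1 :: "(nat \<Rightarrow> complex) \<Rightarrow> complex"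
  assumes T: "openin (cspace 2) T" and h0: "hol_on 2 T h0" and h1: "hol_on 2 T h1"
    and g: "hol_on 2 T g" and \<tau>0: "hol_on 2 T \<tau>0" and \<tau>1: "hol_on 2 T \<tau>1"
    and J: "\<And>y. y \<in> T \<Longrightarrow> J y = pdv 0 h0 y * pdv 1 h1 y - pdv 1 h0 y * pdv 0 h1 y"
    and \<theta>0: "\<And>y. y \<in> T \<Longrightarrow> \<theta>0 y = \<tau>0 y * pdv 0 h0 y + \<tau>1 y * pdv 1 h0 y"
    and \<theta>1: "\<And>y. y \<in> T \<Longrightarrow> \<theta>1 y = \<tau>0 y * pdv 0 h1 y + \<tau>1 y * pdv 1 h1 y"
begin

private lemma hp: "hol_on 2 T f \<Longrightarrow> hol_on 2 T (pdv 0 f)" "hol_on 2 T f \<Longrightarrow> hol_on 2 T (pdv 1 f)"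
  using hol_on_pdv_hol[OF _ T] by auto

private lemma dm: "hol_on 2 T f \<Longrightarrow> hol_on 2 T k \<Longrightarrow> y \<in> T \<Longrightarrow> i < 2 \<Longrightarrow>
    pdv i (\<lambda>y. f y * k y) y = pdv i f y * k y + f y * pdv i k y"
  by (rule pdv_mult)

private lemma dJ: "y \<in> T \<Longrightarrow> i < 2 \<Longrightarrow> pdv i J y =
    pdv i (pdv 0 h0) y * pdv 1 h1 y + pdv 0 h0 y * pdv i (pdv 1 h1) y
    - (pdv i (pdv 1 h0) y * pdv 0 h1 y + pdv 1 h0 y * pdv i (pdv 0 h1) y)"
proof -
  assume y: "y \<in> T" and i: "i < 2"
  have "pdv i J y = pdv i (\<lambda>y. pdv 0 h0 y * pdv 1 h1 y - pdv 1 h0 y * pdv 0 h1 y) y"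
    by (rule pdv_cong[OF T y i J])
  then show ?thesis
    using pdv_diff[OF hol_on_mult[OF hp(1)[OF h0] hp(2)[OF h1]] hol_on_mult[OF hp(2)[OF h0] hp(1)[OF h1]] y i]
      dm[OF hp(1)[OF h0] hp(2)[OF h1] y i] dm[OF hp(2)[OF h0] hp(1)[OF h1] y i] by simp
qed

private lemma hJ: "hol_on 2 T J"
  by (rule hol_on_cong[OF T J[symmetric]], assumption) (intro hol_on_diff hol_on_mult hp h0 h1)

lemma derivative_of_density:
  assumes b: "hol_on 3 \<Omega> b" and \<Omega>: "openin (cspace 3) \<Omega>"
    and h\<Omega>: "\<And>y. y \<in> T \<Longrightarrow> mk3 (h0 y) (h1 y) 0 \<in> \<Omega>"
    and bg: "\<And>y. y \<in> T \<Longrightarrow> b (mk3 (h0 y) (h1 y) 0) = g y * J y"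
    and x: "x \<in> T" and z: "z = mk3 (h0 x) (h1 x) 0"
  shows "pdv 0 b z * \<theta>0 x + pdv 1 b z * \<theta>1 x
    = (\<tau>0 x * pdv 0 g x + \<tau>1 x * pdv 1 g x) * J x + g x * (\<tau>0 x * pdv 0 J x + \<tau>1 x * pdv 1 J x)"
proof -
  have e: "pdv i g x * J x + g x * pdv i J x = pdv 0 b z * pdv i h0 x + pdv 1 b z * pdv i h1 x" if i: "i < 2" for i
  proof -
    have "pdv i (\<lambda>y. b (mk3 (h0 y) (h1 y) 0)) x = (\<Sum>l<3. pdv l b z * pdv i (\<lambda>y. mk3 (h0 y) (h1 y) 0 l) x)"
      unfolding z by (rule pdv_compose[OF b \<Omega> T h\<Omega> hol_on_mk3[OF h0 h1 hol_on_const] x i])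
    moreover have "pdv i (\<lambda>y. b (mk3 (h0 y) (h1 y) 0)) x = pdv i (\<lambda>y. g y * J y) x"
      by (rule pdv_cong[OF T x i bg])
    ultimately show ?thesis using dm[OF g hJ x i] by (simp add: sum_lessThan_3)
  qed
  have "(\<tau>0 x * pdv 0 g x + \<tau>1 x * pdv 1 g x) * J x + g x * (\<tau>0 x * pdv 0 J x + \<tau>1 x * pdv 1 J x)
      = \<tau>0 x * (pdv 0 g x * J x + g x * pdv 0 J x) + \<tau>1 x * (pdv 1 g x * J x + g x * pdv 1 J x)"
    by (simp only: algebra_simps)
  also have "\<dots> = \<tau>0 x * (pdv 0 b z * pdv 0 h0 x + pdv 1 b z * pdv 0 h1 x)
      + \<tau>1 x * (pdv 0 b z * pdv 1 h0 x + pdv 1 b z * pdv 1 h1 x)"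
    using e[of 0] e[of 1] by simp
  also have "\<dots> = pdv 0 b z * \<theta>0 x + pdv 1 b z * \<theta>1 x"
    by (simp only: \<theta>0[OF x] \<theta>1[OF x] algebra_simps)
  finally show ?thesis by (rule sym)
qed

lemma derivative_of_jacobian:
  assumes x: "x \<in> T"
  shows "pdv 0 \<theta>0 x * pdv 1 h1 x + pdv 0 h0 x * pdv 1 \<theta>1 x - (pdv 1 \<theta>0 x * pdv 0 h1 x + pdv 1 h0 x * pdv 0 \<theta>1 x)
    = (pdv 0 \<tau>0 x + pdv 1 \<tau>1 x) * J x + \<tau>0 x * pdv 0 J x + \<tau>1 x * pdv 1 J x"
proof -
  have d\<theta>: "pdv i (\<lambda>y. \<tau>0 y * pdv 0 h y + \<tau>1 y * pdv 1 h y) x =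
      pdv i \<tau>0 x * pdv 0 h x + \<tau>0 x * pdv i (pdv 0 h) x + (pdv i \<tau>1 x * pdv 1 h x + \<tau>1 x * pdv i (pdv 1 h) x)"
    if h: "hol_on 2 T h" and i: "i < 2" for h i
    using pdv_add[OF hol_on_mult[OF \<tau>0 hp(1)[OF h]] hol_on_mult[OF \<tau>1 hp(2)[OF h]] x i]
      dm[OF \<tau>0 hp(1)[OF h] x i] dm[OF \<tau>1 hp(2)[OF h] x i] by simp
  have c0: "pdv i \<theta>0 x = pdv i (\<lambda>y. \<tau>0 y * pdv 0 h0 y + \<tau>1 y * pdv 1 h0 y) x" if "i < 2" for i
    by (rule pdv_cong[OF T x that \<theta>0])
  have c1: "pdv i \<theta>1 x = pdv i (\<lambda>y. \<tau>0 y * pdv 0 h1 y + \<tau>1 y * pdv 1 h1 y) x" if "i < 2" for i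
    by (rule pdv_cong[OF T x that \<theta>1])
  have s: "pdv 0 (pdv 1 h) x = pdv 1 (pdv 0 h) x" if "hol_on 2 T h" for h
    using pdv_commute[OF that T x, of 1 0] by simp
  have d: "pdv 0 J x = pdv 0 (pdv 0 h0) x * pdv 1 h1 x + pdv 0 h0 x * pdv 0 (pdv 1 h1) x
    - (pdv 0 (pdv 1 h0) x * pdv 0 h1 x + pdv 1 h0 x * pdv 0 (pdv 0 h1) x)"
    "pdv 1 J x = pdv 1 (pdv 0 h0) x * pdv 1 h1 x + pdv 0 h0 x * pdv 1 (pdv 1 h1) x
    - (pdv 1 (pdv 1 h0) x * pdv 0 h1 x + pdv 1 h0 x * pdv 1 (pdv 0 h1) x)"
    using dJ[OF x, of 0] dJ[OF x, of 1] by simp_all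
  have t: "(0::nat) < 2" "(1::nat) < 2" by auto
  show ?thesis
    unfolding c0[OF t(1)] c0[OF t(2)] c1[OF t(1)] c1[OF t(2)] d\<theta>[OF h0 t(1)] d\<theta>[OF h0 t(2)]
      d\<theta>[OF h1 t(1)] d\<theta>[OF h1 t(2)] d J[OF x] s[OF h0] s[OF h1]
    by (simp only: algebra_simps)
qed

end

section \<open>Poisson families near a Hopf surface\<close>

lemma mk3_of_cvec:
  assumes w: "w \<in> cvec 2"
  shows "mk3 (w 0) (w 1) 0 = w"
proof (rule cvec_eqI[OF mk3_simps(4) cvec_2_3[OF w]])
  fix i :: nat assume "i < 3"
  then show "mk3 (w 0) (w 1) 0 i = w i" using w by (auto simp: cvec_def dest!: less_3_cases)
qed

text \<open>The central fibre as target of the Hopf surface, together with a tangent vector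
  \<open>v\<close> of the base; the family is examined only along the line spanned by
  \<open>v\<close>.\<close>

locale hopf_family = hopf_target p \<delta> "fibre F (\<lambda>i. 0)" \<iota>
  for p :: nat and \<delta> :: complex and F :: "'e poisson_fam" and \<iota> +
  fixes v :: "nat \<Rightarrow> complex"
  assumes fam: "poisson_analytic_family F" and v: "v \<in> cvec (pardim F)"
    and ind0: "induces_on_fibre F (\<lambda>i. 0) (fibre_biv F (\<lambda>i. 0))"
    and L0: "\<And>c q a b. c \<in> max_atlas (fibre F (\<lambda>i. 0)) \<Longrightarrow> q \<in> fst c \<Longrightarrow> a < 2 \<Longrightarrow> b < 2 \<Longrightarrow>
      fibre_biv F (\<lambda>i. 0) c a b q = 0"
begin

abbreviation "M0 \<equiv> fibre F (\<lambda>i. 0)"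
abbreviation "r \<equiv> pardim F"
abbreviation "e \<equiv> fibre_chart F (\<lambda>i. 0)"
abbreviation "ad \<equiv> adapted_chart F"

lemma totM: "complex_manifold (tot F)" and tot_biv: "hol_bivfield (tot F) (points (tot F)) (totbiv F)"
  using fam by (auto simp: poisson_analytic_family_def poisson_manifold_def)

lemma fdim_2: "fdim F = 2"
  using mdim_2 by (simp add: fibre_def)

lemma N_eq: "mdim (tot F) = 2 + r"
  using fdim_2 by (simp add: fdim_def)

lemma points_fibre: "points (fibre F t) = fibre_set F t"
  by (auto simp: fibre_def fibre_set_def)

lemma mtop_fibre: "mtop (fibre F t) = subtopology (mtop (tot F)) (fibre_set F t)"
  by (simp add: fibre_def)

lemma proj_high: "q \<in> points (tot F) \<Longrightarrow> r \<le> i \<Longrightarrow> proj F q i = 0"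
proof -
  assume q: "q \<in> points (tot F)" and i: "r \<le> i"
  have "proj F q \<in> base F" "openin (cspace r) (base F)"
    using fam q by (auto simp: poisson_analytic_family_def)
  then have "proj F q \<in> cvec r" using openin_cspace_sub by blast
  then show ?thesis using i by (simp add: cvec_def)
qed

lemma sum_N: "(\<Sum>i<2+r. f i) = f 0 + f 1 + (\<Sum>i<r. f (2 + i) :: complex)"
  by (simp add: numeral_2_eq_2 sum.lessThan_Suc_shift add.assoc del: sum.lessThan_Suc)

lemma ad_max: "ad c \<Longrightarrow> c \<in> max_atlas (tot F)"
  by (simp add: adapted_chart_def)

lemma ad_chart: "ad c \<Longrightarrow> is_chart (2 + r) (mtop (tot F)) c"
  using max_atlas_chart[OF ad_max] N_eq by simp

lemma ad_proj: "ad c \<Longrightarrow> q \<in> fst c \<Longrightarrow> i < r \<Longrightarrow> snd c q (2 + i) = proj F q i"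
  using fdim_2 by (simp add: adapted_chart_def)

lemma ad_points: "ad c \<Longrightarrow> q \<in> fst c \<Longrightarrow> q \<in> points (tot F)"
  using chart_dom_points[OF ad_max] by blast

lemma ad_in_fibre:
  assumes c: "ad c" "q \<in> fst c" and z: "\<And>i. i < r \<Longrightarrow> snd c q (2 + i) = 0"
  shows "q \<in> points M0"
proof -
  have "proj F q = (\<lambda>i. 0)"
  proof
    fix i show "proj F q i = 0"
      using ad_proj[OF c, of i] z[of i] proj_high[OF ad_points[OF c], of i] by (cases "i < r") auto
  qed
  then show ?thesis using ad_points[OF c] by (simp add: points_fibre fibre_set_def)
qed

lemma e_matlas: "ad c \<Longrightarrow> e c \<in> max_atlas M0"
  by (rule matlas_max_atlas[OF M]) (simp add: fibre_def)

lemma e_dom: "fst (e c) = fst c \<inter> points M0"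
  by (simp add: fibre_chart_def points_fibre)

lemma e_snd_lt: "i < 2 \<Longrightarrow> snd (e c) q i = snd c q i"
  by (simp add: fibre_chart_def fdim_2)

text \<open>The coordinates dropped by \<open>fibre_chart\<close> are those of the base, which are
  zero on the central fibre.\<close>

lemma e_snd:
  assumes c: "ad c" and q: "q \<in> fst c" "q \<in> points M0"
  shows "snd (e c) q = snd c q"
proof
  fix i
  consider "i < 2" | "2 \<le> i" "i < 2 + r" | "2 + r \<le> i" by linarith
  then show "snd (e c) q i = snd c q i"
  proof cases
    case 2
    have "snd c q (2 + (i - 2)) = proj F q (i - 2)" by (rule ad_proj[OF c q(1)]) (use 2 in auto)
    moreover have "2 + (i - 2) = i" using 2 by simp
    moreover have "proj F q = (\<lambda>i. 0)" using q(2) by (simp add: points_fibre fibre_set_def)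
    ultimately have "snd c q i = 0" by metis
    then show ?thesis using 2 by (simp add: fibre_chart_def fdim_2)
  next
    case 3
    then show ?thesis
      using chart_range_cvec[OF ad_chart[OF c] q(1)] by (auto simp: fibre_chart_def fdim_2 cvec_def)
  qed (simp add: e_snd_lt)
qed

section \<open>The bivector field of the family in adapted charts\<close>

lemma totbiv_zero:
  assumes c: "ad c" and q: "q \<in> fst c" "q \<in> points M0" and ab: "a < 2 + r" "b < 2 + r"
  shows "totbiv F c a b q = 0"
proof -
  \<comment> \<open>The inclusion of the central fibre is a Poisson map, so along that fibre the
    total bivector field is the pushforward of zero.\<close>
  have "poisson_map M0 (fibre_biv F (\<lambda>i. 0)) (tot F) (totbiv F) (\<lambda>p. p)"
    using ind0 by (simp add: induces_on_fibre_def)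
  moreover have "e c \<in> max_atlas M0" "q \<in> fst (e c)" using e_matlas[OF c] q e_dom by auto
  ultimately have "totbiv F c a b q = (\<Sum>i<mdim M0. \<Sum>j<mdim M0.
      fibre_biv F (\<lambda>i. 0) (e c) i j q * pd (e c) i (\<lambda>q. snd c q a) q * pd (e c) j (\<lambda>q. snd c q b) q)"
    using ad_max[OF c] q ab N_eq unfolding poisson_map_def by auto
  also have "\<dots> = 0"
    unfolding mdim_2 by (intro sum.neutral ballI) (simp add: L0[OF e_matlas[OF c] \<open>q \<in> fst (e c)\<close>])
  finally show ?thesis .
qed

lemma totbiv_antisym:
  assumes c: "ad c" and q: "q \<in> fst c" and ab: "a < 2 + r" "b < 2 + r"
  shows "totbiv F c a b q = - totbiv F c b a q"
  using tot_biv ad_max[OF c] ad_points[OF c q] q ab unfolding hol_bivfield_def N_eq by blast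

text \<open>The fibre through \<open>q\<close> is a Poisson submanifold on which the base
  coordinates are constant; a bivector pushed forward from it has no components in their
  directions.\<close>

lemma totbiv_tangent:
  assumes c: "ad c" and q: "q \<in> fst c" and i: "i < r" and b: "b < 2 + r"
  shows "totbiv F c (2 + i) b q = 0" "totbiv F c b (2 + i) q = 0"
proof -
  let ?t = "proj F q"
  have qt: "q \<in> points (tot F)" by (rule ad_points[OF c q])
  then have "?t \<in> base F" using fam by (auto simp: poisson_analytic_family_def)
  moreover have "\<forall>t\<in>base F. \<exists>L. induces_on_fibre F t L"
    using fam unfolding poisson_analytic_family_def by blast
  ultimately obtain L where L: "induces_on_fibre F ?t L" by blast
  then have Mt: "complex_manifold (fibre F ?t)" by (simp add: induces_on_fibre_def poisson_manifold_def)
  have "q \<in> points (fibre F ?t)" using qt by (simp add: points_fibre fibre_set_def)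
  then obtain d where d: "d \<in> max_atlas (fibre F ?t)" "q \<in> fst d" using max_atlas_cover[OF Mt] by blast
  have o: "openin (mtop (fibre F ?t)) (fst c \<inter> fibre_set F ?t)"
    unfolding mtop_fibre openin_subtopology using chart_open_dom[OF ad_chart[OF c]] by blast
  have z: "pd d l (\<lambda>q. snd c q (2 + i)) q = 0" if l: "l < mdim (fibre F ?t)" for l
  proof -
    have "pd d l (\<lambda>q. snd c q (2 + i)) q = pd d l (\<lambda>q. ?t i) q"
    proof (rule pd_cong[OF max_atlas_chart[OF d(1)] _ d(2) o l])
      show "q \<in> fst c \<inter> fibre_set F ?t" using q qt by (simp add: fibre_set_def)
      fix q' assume "q' \<in> fst c \<inter> fibre_set F ?t"
      then show "snd c q' (2 + i) = ?t i" using ad_proj[OF c _ i] by (simp add: fibre_set_def)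
    qed
    then show ?thesis by (simp add: pd_pdv)
  qed
  have "poisson_map (fibre F ?t) L (tot F) (totbiv F) (\<lambda>p. p)"
    using L by (simp add: induces_on_fibre_def)
  moreover have "2 + i < 2 + r" using i by simp
  ultimately have "totbiv F c (2 + i) b q = (\<Sum>k<mdim (fibre F ?t). \<Sum>j<mdim (fibre F ?t).
      L d k j q * pd d k (\<lambda>q. snd c q (2 + i)) q * pd d j (\<lambda>q. snd c q b) q)"
    using ad_max[OF c] q b d unfolding poisson_map_def N_eq by blast
  also have "\<dots> = 0" by (intro sum.neutral ballI) (simp add: z del: add_2_eq_Suc add_2_eq_Suc')
  finally show 1: "totbiv F c (2 + i) b q = 0" .
  show "totbiv F c b (2 + i) q = 0" using totbiv_antisym[OF c q b, of "2 + i"] i 1 by simp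
qed

text \<open>By tangency only the fibre block of the transformation law survives. As the fibre has
  dimension two, this block is one number, multiplied by the vertical Jacobian determinant.\<close>

lemma totbiv_trans:
  assumes c: "ad c" and d: "ad d" and q: "q \<in> fst c" "q \<in> fst d"
  shows "totbiv F d 0 1 q = totbiv F c 0 1 q *
    (pd c 0 (\<lambda>q. snd d q 0) q * pd c 1 (\<lambda>q. snd d q 1) q - pd c 1 (\<lambda>q. snd d q 0) q * pd c 0 (\<lambda>q. snd d q 1) q)"
proof -
  let ?f = "\<lambda>i j. totbiv F c i j q * pd c i (\<lambda>q. snd d q 0) q * pd c j (\<lambda>q. snd d q 1) q"
  have "totbiv F d 0 1 q = (\<Sum>i<2+r. \<Sum>j<2+r. ?f i j)"
  proof -
    have "q \<in> points (tot F) \<inter> fst c \<inter> fst d" "0 < 2 + r" "1 < 2 + r" using ad_points[OF c q(1)] q by auto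
    then show ?thesis using tot_biv ad_max[OF c] ad_max[OF d] unfolding hol_bivfield_def N_eq by blast
  qed
  also have "\<dots> = ?f 0 0 + ?f 0 1 + (?f 1 0 + ?f 1 1)"
  proof -
    have col: "(\<Sum>j<r. ?f i (2 + j)) = 0" if "i < 2 + r" for i
      by (intro sum.neutral ballI) (simp add: totbiv_tangent(2)[OF c q(1) _ that] del: add_2_eq_Suc add_2_eq_Suc')
    have row: "(\<Sum>i<r. \<Sum>j<2+r. ?f (2 + i) j) = 0"
      by (intro sum.neutral ballI) (simp add: totbiv_tangent(1)[OF c q(1)] del: add_2_eq_Suc add_2_eq_Suc')
    have "0 < 2 + r" "1 < 2 + r" by auto
    note c01 = col[OF this(1)] col[OF this(2)]
    show ?thesis unfolding sum_N[of "\<lambda>i. \<Sum>j<2+r. ?f i j"] row unfolding sum_N c01 by (simp only: add_0_right)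
  qed
  also have "?f 0 0 = 0" using totbiv_antisym[OF c q(1), of 0 0] by simp
  also have "?f 1 1 = 0" using totbiv_antisym[OF c q(1), of 1 1] by simp
  also have "totbiv F c 1 0 q = - totbiv F c 0 1 q" by (rule totbiv_antisym[OF c q(1)]) auto
  finally show ?thesis by (simp add: algebra_simps)
qed

subsection \<open>Restriction to a line through the origin of the base\<close>

text \<open>\<open>em (z, w, s)\<close> are the coordinates \<open>(z, w, s v)\<close> in an adapted chart.\<close>

definition em :: "(nat \<Rightarrow> complex) \<Rightarrow> nat \<Rightarrow> complex" where
  "em y = (\<lambda>i. if i < 2 then y i else y 2 * v (i - 2))"

lemma em_cvec: "em y \<in> cvec (2 + r)"
  using v by (auto simp: cvec_def em_def)

lemma em_hol: "hol_on 3 V (\<lambda>y. em y i)"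
  by (cases "i < 2") (auto simp: em_def intro!: hol_on_intros)

lemma em_upd: "l < 2 \<Longrightarrow> em (y(l := s)) = (em y)(l := s)"
  by (auto simp: em_def fun_eq_iff)

definition Om :: "'e chart \<Rightarrow> 'e set \<Rightarrow> (nat \<Rightarrow> complex) set" where
  "Om c S = {y\<in>cvec 3. em y \<in> snd c ` (S \<inter> fst c)}"

lemma Om_open: "ad c \<Longrightarrow> openin (mtop (tot F)) S \<Longrightarrow> openin (cspace 3) (Om c S)"
  unfolding Om_def
  by (rule hol_preimage_open[OF open_cvec em_cvec em_hol chart_open_image[OF ad_chart]])

lemma Om_props:
  assumes c: "ad c" and y: "y \<in> Om c S"
  shows "chart_inv c (em y) \<in> S" (is ?A) "chart_inv c (em y) \<in> fst c" (is ?B)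
    "snd c (chart_inv c (em y)) = em y" (is ?C)
proof -
  obtain q where q: "q \<in> S" "q \<in> fst c" "em y = snd c q" using y by (auto simp: Om_def)
  then have "chart_inv c (em y) = q" using chart_inv_snd[OF ad_chart[OF c]] by simp
  then show ?A ?B ?C
    using q by simp_all
qed

lemma lift_hol:
  assumes c: "ad c" and S: "openin (mtop (tot F)) S"
    and f: "hol_on (2 + r) (snd c ` (S \<inter> fst c)) (\<lambda>z. f (chart_inv c z))"
  shows "hol_on 3 (Om c S) (\<lambda>y. f (chart_inv c (em y)))"
  by (rule hol_on_compose[OF f chart_open_image[OF ad_chart[OF c] S] Om_open[OF c S]])
    (auto simp: Om_def intro: em_hol)

lemma lift_pdv:
  assumes "ad c" "y \<in> Om c S" "l < 2"
  shows "pdv l (\<lambda>y. f (chart_inv c (em y))) y = pd c l f (chart_inv c (em y))"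
  unfolding pd_pdv Om_props(3)[OF assms(1,2)]
  using assms(3) by (simp add: pdv_def em_upd) (simp add: em_def)

text \<open>Differentiation in \<open>s\<close> is differentiation along \<open>v\<close>. This is
  how the first order data of the restricted family become the entries of
  \<open>ks_cocycle\<close>.\<close>

lemma lift_pdv_2:
  assumes c: "ad c" and S: "openin (mtop (tot F)) S"
    and f: "hol_on (2 + r) (snd c ` (S \<inter> fst c)) (\<lambda>z. f (chart_inv c z))"
    and y: "y \<in> Om c S"
  shows "pdv 2 (\<lambda>y. f (chart_inv c (em y))) y = (\<Sum>i<r. v i * pd c (2 + i) f (chart_inv c (em y)))"
proof -
  have "pdv 2 (\<lambda>y. f (chart_inv c (em y))) y = (\<Sum>i<2+r. pdv i (\<lambda>z. f (chart_inv c z)) (em y) * pdv 2 (\<lambda>y. em y i) y)"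
    by (rule pdv_compose[OF f chart_open_image[OF ad_chart[OF c] S] Om_open[OF c S] _ em_hol y])
      (auto simp: Om_def)
  moreover have "pdv 2 (\<lambda>y. em y (2 + i)) y = v i" for i
    by (rule pdv_eqI) (auto simp: em_def intro!: derivative_eq_intros)
  moreover have "pdv 2 (\<lambda>y. em y 0) y = 0" "pdv 2 (\<lambda>y. em y 1) y = 0"
    by (simp_all add: em_def pdv_coord)
  ultimately show ?thesis
    unfolding sum_N pd_pdv Om_props(3)[OF c y] by (simp add: mult.commute)
qed

text \<open>On two-dimensional fibres this one component determines the bivector field; it is viewed
  as a function of \<open>(z, w, s)\<close>.\<close>

definition Bf :: "'e chart \<Rightarrow> (nat \<Rightarrow> complex) \<Rightarrow> complex" where
  "Bf c y = totbiv F c 0 1 (chart_inv c (em y))"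

lemma totbiv_hol:
  assumes "ad c"
  shows "hol_on (2 + r) (snd c ` (fst c \<inter> fst c)) (\<lambda>z. totbiv F c 0 1 (chart_inv c z))"
proof -
  have "hol_fun (tot F) (points (tot F) \<inter> fst c) (totbiv F c 0 1)"
    using tot_biv ad_max[OF assms] N_eq unfolding hol_bivfield_def by auto
  then have "hol_on (2 + r) (snd c ` (points (tot F) \<inter> fst c \<inter> fst c)) (\<lambda>z. totbiv F c 0 1 (chart_inv c z))"
    using ad_max[OF assms] N_eq unfolding hol_fun_def by auto
  moreover have "points (tot F) \<inter> fst c \<inter> fst c = fst c \<inter> fst c" using ad_points[OF assms] by auto
  ultimately show ?thesis by simp
qed

lemma Om_dom_open: "ad c \<Longrightarrow> ad d \<Longrightarrow> openin (cspace 3) (Om c (fst d))"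
  by (rule Om_open[OF _ chart_open_dom[OF ad_chart]])

lemma Bf_hol: "ad c \<Longrightarrow> hol_on 3 (Om c (fst c)) (Bf c)"
  unfolding Bf_def[abs_def] by (rule lift_hol[OF _ chart_open_dom[OF ad_chart] totbiv_hol])

lemma Om_zero:
  assumes c: "ad c" and y: "y \<in> Om c S" "y 2 = 0"
  shows "chart_inv c (em y) \<in> points M0"
proof (rule ad_in_fibre[OF c Om_props(2)[OF c y(1)]])
  show "snd c (chart_inv c (em y)) (2 + i) = 0" for i
    unfolding Om_props(3)[OF c y(1)] using y(2) by (simp add: em_def)
qed

lemma Bf_zero: "ad c \<Longrightarrow> y \<in> Om c (fst c) \<Longrightarrow> y 2 = 0 \<Longrightarrow> Bf c y = 0"
  unfolding Bf_def by (rule totbiv_zero) (auto intro: Om_props Om_zero)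

lemma em_fibre:
  assumes c: "ad c" and x: "x \<in> W" "\<phi> x \<in> fst c"
  shows "em (snd (e c) (\<phi> x)) = snd c (\<phi> x)" "chart_inv c (em (snd (e c) (\<phi> x))) = \<phi> x"
    "snd (e c) (\<phi> x) \<in> cvec 2"
proof -
  note es = e_snd[OF c x(2) \<phi>_points[OF x(1)]]
  have "\<phi> x \<in> fst (e c)" using x \<phi>_points by (simp add: e_dom)
  then show c2: "snd (e c) (\<phi> x) \<in> cvec 2"
    using chart_range_cvec[OF max_atlas_chart[OF e_matlas[OF c]]] mdim_2 by simp
  then have "em (snd (e c) (\<phi> x)) = snd (e c) (\<phi> x)"
    by (auto simp: em_def fun_eq_iff cvec_def)
  then show 1: "em (snd (e c) (\<phi> x)) = snd c (\<phi> x)" using es by simp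
  show "chart_inv c (em (snd (e c) (\<phi> x))) = \<phi> x"
    unfolding 1 by (rule chart_inv_snd[OF ad_chart[OF c] x(2)])
qed

lemma fibre_Om: "ad c \<Longrightarrow> x \<in> W \<Longrightarrow> \<phi> x \<in> fst c \<Longrightarrow> \<phi> x \<in> S \<Longrightarrow> snd (e c) (\<phi> x) \<in> Om c S"
  unfolding Om_def using em_fibre cvec_2_3 by auto

section \<open>Comparison of second order coefficients in two charts\<close>

definition Jc :: "'e chart \<Rightarrow> (nat \<Rightarrow> complex) \<Rightarrow> complex" where
  "Jc c x = dphi (e c) 0 0 x * dphi (e c) 1 1 x - dphi (e c) 0 1 x * dphi (e c) 1 0 x"

text \<open>The transition from \<open>e c\<close> to the linear chart at \<open>x\<close> inverts
  the Jacobian matrix, so the product of the two determinants is 1.\<close>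

lemma Jc_nz:
  assumes c: "ad c" and x: "x \<in> W" "\<phi> x \<in> fst c"
  shows "Jc c x \<noteq> 0"
proof
  assume J: "Jc c x = 0"
  let ?k = "kchart (nb x)"
  have dom: "\<phi> x \<in> fst (e c)" "\<phi> x \<in> fst ?k" using x \<phi>_points nb_self by (auto simp: e_dom kchart_sel)
  let ?P = "\<lambda>a l. pd (e c) l (\<lambda>q. snd ?k q a) (\<phi> x)"
  have t: "(\<Sum>l<2. ?P a l * dphi (e c) l i x) = (if i = a then 1 else 0)" if "a < 2" "i < 2" for a i
    using dphi_trans[OF e_matlas[OF c] kchart_max_atlas[OF small_nb] x(1) dom that]
      dphi_kchart[OF small_nb nb_self[OF x(1)] that(2), of a] by simp
  have eqs: "?P 0 0 * dphi (e c) 0 0 x + ?P 0 1 * dphi (e c) 1 0 x = 1"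
    "?P 0 0 * dphi (e c) 0 1 x + ?P 0 1 * dphi (e c) 1 1 x = 0"
    "?P 1 0 * dphi (e c) 0 0 x + ?P 1 1 * dphi (e c) 1 0 x = 0"
    "?P 1 0 * dphi (e c) 0 1 x + ?P 1 1 * dphi (e c) 1 1 x = 1"
    using t[of 0 0] t[of 0 1] t[of 1 0] t[of 1 1] by (simp_all add: sum_lessThan_2)
  have "(?P 0 0 * ?P 1 1 - ?P 0 1 * ?P 1 0) * Jc c x =
    (?P 0 0 * dphi (e c) 0 0 x + ?P 0 1 * dphi (e c) 1 0 x) * (?P 1 0 * dphi (e c) 0 1 x + ?P 1 1 * dphi (e c) 1 1 x)
    - (?P 0 0 * dphi (e c) 0 1 x + ?P 0 1 * dphi (e c) 1 1 x) * (?P 1 0 * dphi (e c) 0 0 x + ?P 1 1 * dphi (e c) 1 0 x)"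
    unfolding Jc_def by (simp only: algebra_simps)
  then show False unfolding eqs using J by simp
qed

text \<open>In the linear coordinates \<open>g\<close> is the first order coefficient of the
  bivector field and \<open>\<tau>\<close> the first order change of charts. The second order
  coefficients in \<open>c\<close> and \<open>d\<close> differ by twice the Lie derivative along
  \<open>\<tau>\<close> of the bivector field with coefficient \<open>g\<close>; the divergence term
  stems from the action on the two coordinate fields.\<close>

lemma local_transformation:
  fixes S :: "'e set" and \<tau> :: "nat \<Rightarrow> (nat \<Rightarrow> complex) \<Rightarrow> complex" and g :: "(nat \<Rightarrow> complex) \<Rightarrow> complex"
  defines "TS \<equiv> {y\<in>W. \<phi> y \<in> S}"
  assumes c: "ad c" and d: "ad d" and S: "openin (mtop M0) S" and Ssub: "S \<subseteq> fst c \<inter> fst d"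
    and \<tau>: "\<And>i. i < 2 \<Longrightarrow> hol_on 2 TS (\<tau> i)" and g: "hol_on 2 TS g"
    and gc: "\<And>y. y \<in> TS \<Longrightarrow> pdv 2 (Bf c) (snd (e c) (\<phi> y)) = g y * Jc c y"
    and gd: "\<And>y. y \<in> TS \<Longrightarrow> pdv 2 (Bf d) (snd (e d) (\<phi> y)) = g y * Jc d y"
    and \<Theta>: "\<And>y a. y \<in> TS \<Longrightarrow> a < 2 \<Longrightarrow> (\<Sum>i<r. v i * pd d (2 + i) (\<lambda>q. snd c q a) (\<phi> y))
      = \<tau> 0 y * dphi (e c) a 0 y + \<tau> 1 y * dphi (e c) a 1 y"
    and x: "x \<in> TS"
  shows "pdv 2 (pdv 2 (Bf c)) (snd (e c) (\<phi> x)) / Jc c x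
      + 2 * (\<tau> 0 x * pdv 0 g x + \<tau> 1 x * pdv 1 g x - (pdv 0 (\<tau> 0) x + pdv 1 (\<tau> 1) x) * g x)
    = pdv 2 (pdv 2 (Bf d)) (snd (e d) (\<phi> x)) / Jc d x"
proof -
  have TSo: "openin (cspace 2) TS" unfolding TS_def by (rule \<phi>_preimage_open[OF S])
  have TSp: "y \<in> W" "\<phi> y \<in> fst c" "\<phi> y \<in> fst d" "y \<in> cvec 2" "y \<in> cvec 3" "y 2 = 0" "y(2 := 0) = y"
    if "y \<in> TS" for y
    using that Ssub W_cvec cvec_2_3 cvec_2_restrict by (auto simp: TS_def cvec_def)
  define V where "V = {y\<in>cvec 3. y(2 := 0) \<in> TS}"
  have Vo: "openin (cspace 3) V" unfolding V_def by (rule restrict_open[OF TSo])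
  \<comment> \<open>Points are moved off the central fibre with their fibre coordinates in
    \<open>d\<close> held fixed. This trivialises the family locally, and only the coordinates in
    \<open>c\<close> change nontrivially with \<open>s\<close>.\<close>
  define h where "h y = mk3 (snd (e d) (\<phi> (y(2 := 0))) 0) (snd (e d) (\<phi> (y(2 := 0))) 1) (y 2)" for y
  have cd: "hol_on 2 TS (\<lambda>y. snd (e d) (\<phi> y) a)" if "a < 2" for a
    by (rule hol_on_subset[OF coord_hol2[OF e_matlas[OF d] that]]) (use TSp \<phi>_points in \<open>auto simp: e_dom\<close>)
  have cc: "hol_on 2 TS (\<lambda>y. snd (e c) (\<phi> y) a)" if "a < 2" for a
    by (rule hol_on_subset[OF coord_hol2[OF e_matlas[OF c] that]]) (use TSp \<phi>_points in \<open>auto simp: e_dom\<close>)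
  have hh: "hol_on 3 V (\<lambda>y. h y i)" for i
    unfolding h_def V_def by (intro hol_on_mk3 hol_on_coord restrict_hol[OF cd TSo]) auto
  have hc: "h y \<in> cvec 3" for y by (simp add: h_def)
  have h_fibre: "h y = snd (e d) (\<phi> y)" if y: "y \<in> TS" for y
  proof -
    have "snd (e d) (\<phi> y) \<in> cvec 2" using em_fibre(3)[OF d] TSp[OF y] by blast
    then show ?thesis unfolding h_def TSp(7)[OF y] TSp(6)[OF y] by (rule mk3_of_cvec)
  qed
  define O' where "O' = Om d (fst c)"
  have O'o: "openin (cspace 3) O'" unfolding O'_def by (rule Om_dom_open[OF d c])
  define D where "D = {y\<in>V. h y \<in> O'}"
  have Do: "openin (cspace 3) D" unfolding D_def by (rule hol_preimage_open[OF Vo hc hh O'o])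
  have DV: "D \<subseteq> V" by (auto simp: D_def)
  have hD: "hol_on 3 D (\<lambda>y. h y i)" for i by (rule hol_on_subset[OF hh DV])
  have hO: "h y \<in> O'" if "y \<in> D" for y using that by (simp add: D_def)
  have TSD: "y \<in> D" if y: "y \<in> TS" for y
  proof -
    have "h y \<in> O'" unfolding h_fibre[OF y] O'_def using fibre_Om[OF d] TSp[OF y] by blast
    then show ?thesis using y TSp[OF y] by (simp add: D_def V_def)
  qed
  define q where "q y = chart_inv d (em (h y))" for y
  have q: "q y \<in> fst c" "q y \<in> fst d" "snd d (q y) = em (h y)" if "y \<in> D" for y
    using Om_props[OF d hO[OF that, unfolded O'_def]] by (simp_all add: q_def)
  have qTS: "q y = \<phi> y" if "y \<in> TS" for y
    unfolding q_def h_fibre[OF that] by (rule em_fibre(2)[OF d]) (use TSp[OF that] in auto)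

  have hchain: "pdv i (\<lambda>y. k (h y)) y = (\<Sum>l<2. pdv l k (h y) * dphi (e d) l i (y(2 := 0)))"
    if k: "hol_on 3 O' k" and y: "y \<in> D" and i: "i < 2" for k y i
  proof -
    have "pdv i (\<lambda>y. k (h y)) y = (\<Sum>l<3. pdv l k (h y) * pdv i (\<lambda>y. h y l) y)"
      by (rule pdv_compose[OF k O'o Do hO hD y]) (use i in auto)
    moreover have "pdv i (\<lambda>y. h y 2) y = 0" using i by (simp add: h_def pdv_coord)
    moreover have "pdv i (\<lambda>y. h y 0) y = dphi (e d) 0 i (y(2 := 0))"
      using restrict_pdv[OF i, of "\<lambda>y. snd (e d) (\<phi> y) 0" y] by (simp add: h_def dphi_def)
    moreover have "pdv i (\<lambda>y. h y 1) y = dphi (e d) 1 i (y(2 := 0))"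
      using restrict_pdv[OF i, of "\<lambda>y. snd (e d) (\<phi> y) 1" y] by (simp add: h_def dphi_def)
    ultimately show ?thesis by (simp add: sum_lessThan_3 sum_lessThan_2)
  qed
  have hchain2: "pdv 2 (\<lambda>y. k (h y)) y = pdv 2 k (h y)" if k: "hol_on 3 O' k" and y: "y \<in> D" for k y
  proof -
    have "pdv 2 (\<lambda>y. k (h y)) y = (\<Sum>l<3. pdv l k (h y) * pdv 2 (\<lambda>y. h y l) y)"
      by (rule pdv_compose[OF k O'o Do hO hD y]) auto
    moreover have "pdv 2 (\<lambda>y. h y 2) y = 1" by (simp add: h_def pdv_coord)
    moreover have "pdv 2 (\<lambda>y. h y 0) y = 0" "pdv 2 (\<lambda>y. h y 1) y = 0"
      using restrict_pdv_2[of "\<lambda>y. snd (e d) (\<phi> y) 0" y] restrict_pdv_2[of "\<lambda>y. snd (e d) (\<phi> y) 1" y]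
      by (simp_all add: h_def)
    ultimately show ?thesis by (simp add: sum_lessThan_3)
  qed

  \<comment> \<open>The coordinates in \<open>c\<close> of the moving point, as functions of the
    linear coordinates and \<open>s\<close>.\<close>
  define H where "H a y = snd c (q y) a" for a y
  define k where "k a z = snd c (chart_inv d (em z)) a" for a z
  have tr: "hol_on (2 + r) (snd d ` (fst c \<inter> fst d)) (\<lambda>z. snd c (chart_inv d z) a)" if "a < 2" for a
    using max_atlas_transition[OF totM ad_max[OF d] ad_max[OF c], of a] that N_eq by (simp add: Int_commute)
  have kh: "hol_on 3 O' (k a)" if "a < 2" for a
    unfolding k_def[abs_def] O'_def
    by (rule lift_hol[OF d chart_open_dom[OF ad_chart[OF c]] tr[OF that]])
  have Hk: "H a = (\<lambda>y. k a (h y))" for a by (simp add: fun_eq_iff H_def k_def q_def)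
  have Hh: "hol_on 3 D (H a)" if "a < 2" for a
    unfolding Hk by (rule hol_on_compose[OF kh[OF that] O'o Do hO hD])
  have Hpd: "pdv i (H a) y = (\<Sum>l<2. pd d l (\<lambda>q. snd c q a) (q y) * dphi (e d) l i (y(2 := 0)))"
    if "a < 2" "i < 2" "y \<in> D" for a i y
    unfolding Hk hchain[OF kh[OF that(1)] that(3,2)]
    using lift_pdv[OF d hO[OF that(3), unfolded O'_def], where f = "\<lambda>q. snd c q a"]
    by (simp add: k_def[abs_def] q_def sum_lessThan_2)
  define \<theta> where "\<theta> a y = \<tau> 0 y * dphi (e c) a 0 y + \<tau> 1 y * dphi (e c) a 1 y" for a y
  \<comment> \<open>The velocity of the \<open>c\<close> coordinates on the central fibre is the
    vector part of the Kodaira-Spencer cocycle on this overlap.\<close>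
  have Hpd2: "pdv 2 (H a) y = \<theta> a y" if a: "a < 2" and y: "y \<in> TS" for a y
  proof -
    have "pdv 2 (H a) y = pdv 2 (k a) (h y)"
      unfolding Hk by (rule hchain2[OF kh[OF a] TSD[OF y]])
    also have "\<dots> = (\<Sum>i<r. v i * pd d (2 + i) (\<lambda>q. snd c q a) (q y))"
      unfolding k_def[abs_def] q_def
      by (rule lift_pdv_2[OF d chart_open_dom[OF ad_chart[OF c]] tr[OF a] hO[OF TSD[OF y], unfolded O'_def]])
    also have "\<dots> = \<theta> a y" unfolding qTS[OF y] \<theta>_def by (rule \<Theta>[OF y a])
    finally show ?thesis .
  qed
  have HTS: "H a y = snd (e c) (\<phi> y) a" if "a < 2" "y \<in> TS" for a y
    using qTS[OF that(2)] e_snd_lt[OF that(1)] by (simp add: H_def)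

  have emH: "em (mk3 (H 0 y) (H 1 y) (y 2)) = snd c (q y)" if y: "y \<in> D" for y
  proof (rule cvec_eqI[OF em_cvec chart_range_cvec[OF ad_chart[OF c] q(1)[OF y]]])
    fix i :: nat assume i: "i < 2 + r"
    show "em (mk3 (H 0 y) (H 1 y) (y 2)) i = snd c (q y) i"
    proof (cases "i < 2")
      case True
      then show ?thesis by (auto simp: em_def H_def less_2_cases_iff)
    next
      case False
      then obtain l where l: "i = 2 + l" "l < r" using i by (metis add_less_cancel_left le_Suc_ex not_less)
      \<comment> \<open>Both charts are adapted, so they share the base coordinates.\<close>
      have "snd c (q y) i = snd d (q y) i"
        using ad_proj[OF c q(1)[OF y] l(2)] ad_proj[OF d q(2)[OF y] l(2)] l(1) by simp
      then show ?thesis using q(3)[OF y] l(1) by (simp add: em_def h_def)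
    qed
  qed
  define \<Omega> where "\<Omega> = Om c (fst c)"
  have \<Omega>o: "openin (cspace 3) \<Omega>" unfolding \<Omega>_def by (rule Om_dom_open[OF c c])
  have H\<Omega>: "mk3 (H 0 y) (H 1 y) (y 2) \<in> \<Omega>" if "y \<in> D" for y
    using emH[OF that] q(1)[OF that] by (simp add: \<Omega>_def Om_def)
  have BH: "Bf c (mk3 (H 0 y) (H 1 y) (y 2)) = totbiv F c 0 1 (q y)" if "y \<in> D" for y
    unfolding Bf_def emH[OF that] chart_inv_snd[OF ad_chart[OF c] q(1)[OF that]] ..

  define A where "A = (\<lambda>y. Bf d (h y))"
  have O'sub: "O' \<subseteq> Om d (fst d)" by (auto simp: O'_def Om_def)
  have Bd: "hol_on 3 O' (Bf d)" by (rule hol_on_subset[OF Bf_hol[OF d] O'sub])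
  have Bd2: "hol_on 3 O' (pdv 2 (Bf d))" using hol_on_pdv_hol[OF Bd O'o] by simp
  have Ah: "hol_on 3 D A" unfolding A_def by (rule hol_on_compose[OF Bd O'o Do hO hD])
  have A0: "A y = 0" if "y \<in> D" "y 2 = 0" for y
    unfolding A_def by (rule Bf_zero[OF d]) (use hO[OF that(1)] O'sub that(2) in \<open>auto simp: h_def\<close>)
  have A2: "pdv 2 A y = pdv 2 (Bf d) (h y)" if "y \<in> D" for y
    unfolding A_def by (rule hchain2[OF Bd that])
  have A22: "pdv 2 (pdv 2 A) x = pdv 2 (pdv 2 (Bf d)) (snd (e d) (\<phi> x))"
  proof -
    have "pdv 2 (pdv 2 A) x = pdv 2 (\<lambda>y. pdv 2 (Bf d) (h y)) x"
      by (rule pdv_cong[OF Do TSD[OF x] _ A2]) auto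
    also have "\<dots> = pdv 2 (pdv 2 (Bf d)) (h x)" by (rule hchain2[OF Bd2 TSD[OF x]])
    finally show ?thesis unfolding h_fibre[OF x] .
  qed

  have dh: "hol_on 2 TS (dphi (e c) a i)" "hol_on 2 TS (dphi (e d) a i)" if "a < 2" "i < 2" for a i
    unfolding dphi_def[abs_def] using hol_on_pdv_hol[OF cc[OF that(1)] TSo that(2)]
      hol_on_pdv_hol[OF cd[OF that(1)] TSo that(2)] by auto
  have Jd: "hol_on 2 TS (Jc d)" unfolding Jc_def[abs_def] by (intro hol_on_diff hol_on_mult dh) auto
  \<comment> \<open>Jacobian determinant of the \<open>d\<close> coordinates; it is constant in
    \<open>s\<close> because \<open>h\<close> keeps them fixed.\<close>
  define K where "K y = Jc d (y(2 := 0))" for y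
  have Kh: "hol_on 3 D K" unfolding K_def[abs_def]
    by (rule hol_on_subset[OF restrict_hol[OF Jd TSo]]) (use DV in \<open>auto simp: V_def\<close>)
  have K2: "pdv 2 K y = 0" for y unfolding K_def[abs_def] by (rule restrict_pdv_2)

  \<comment> \<open>Jacobian determinant of the \<open>c\<close> coordinates at parameter
    \<open>s\<close>: by the chain rule it is \<open>K\<close> times that of the transition from
    \<open>d\<close> to \<open>c\<close>.\<close>
  define J where "J y = pdv 0 (H 0) y * pdv 1 (H 1) y - pdv 1 (H 0) y * pdv 0 (H 1) y" for y
  have Hi: "hol_on 3 D (pdv i (H a))" if "a < 2" "i < 3" for a i
    by (rule hol_on_pdv_hol[OF Hh[OF that(1)] Do that(2)])
  have Jh: "hol_on 3 D J" unfolding J_def[abs_def] by (intro hol_on_diff hol_on_mult Hi) auto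
  have eq: "Bf c (mk3 (H 0 y) (H 1 y) (y 2)) * K y = J y * A y" if y: "y \<in> D" for y
  proof -
    have "Bf c (mk3 (H 0 y) (H 1 y) (y 2)) = A y * (pd d 0 (\<lambda>q. snd c q 0) (q y) * pd d 1 (\<lambda>q. snd c q 1) (q y)
        - pd d 1 (\<lambda>q. snd c q 0) (q y) * pd d 0 (\<lambda>q. snd c q 1) (q y))"
    proof -
      have "A y = totbiv F d 0 1 (q y)" by (simp only: A_def Bf_def q_def)
      then show ?thesis unfolding BH[OF y] using totbiv_trans[OF d c q(2)[OF y] q(1)[OF y]] by simp
    qed
    moreover have "J y = (pd d 0 (\<lambda>q. snd c q 0) (q y) * pd d 1 (\<lambda>q. snd c q 1) (q y)
        - pd d 1 (\<lambda>q. snd c q 0) (q y) * pd d 0 (\<lambda>q. snd c q 1) (q y)) * K y"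
      using Hpd[OF _ _ y, of 0 0] Hpd[OF _ _ y, of 0 1] Hpd[OF _ _ y, of 1 0] Hpd[OF _ _ y, of 1 1]
      unfolding J_def K_def Jc_def by (simp add: sum_lessThan_2 algebra_simps)
    ultimately show ?thesis by (simp only: mult_ac)
  qed

  have x0: "x 2 = 0" and xD: "x \<in> D" using TSp[OF x] TSD[OF x] by auto
  define z where "z = snd (e c) (\<phi> x)"
  have zc: "mk3 (snd (e c) (\<phi> y) 0) (snd (e c) (\<phi> y) 1) 0 = snd (e c) (\<phi> y)" if y: "y \<in> TS" for y
  proof -
    have "snd (e c) (\<phi> y) \<in> cvec 2" using em_fibre(3)[OF c] TSp[OF y] by blast
    then show ?thesis by (rule mk3_of_cvec)
  qed
  have zH: "z = mk3 (H 0 x) (H 1 x) 0" using zc[OF x] HTS[OF _ x] by (simp add: z_def)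
  have main: "(pdv 2 (pdv 2 (Bf c)) z + 2 * (pdv 0 (pdv 2 (Bf c)) z * pdv 2 (H 0) x + pdv 1 (pdv 2 (Bf c)) z * pdv 2 (H 1) x)) * K x
    = J x * pdv 2 (pdv 2 A) x + 2 * pdv 2 J x * pdv 2 A x"
    by (rule second_order_transformation[OF Bf_hol[OF c, folded \<Omega>_def] \<Omega>o _ Do Hh Hh H\<Omega> Ah A0 Kh K2 Jh eq xD x0 zH])
      (auto simp: \<Omega>_def intro: Bf_zero[OF c])

  have slice: "eventually (\<lambda>s. x(i := s) \<in> TS) (nhds (x i))" if "i < 2" for i
    by (rule slice_nhd[OF TSo x that])
  have HiTS: "pdv i (H a) x = dphi (e c) a i x" if a: "a < 2" and i: "i < 2" for a i
    unfolding dphi_def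
    by (rule pdv_cong_ev, rule eventually_mono[OF slice[OF i]]) (rule HTS[OF a])
  have H2i: "pdv i (pdv 2 (H a)) x = pdv i (\<theta> a) x" if a: "a < 2" and i: "i < 2" for a i
    by (rule pdv_cong_ev, rule eventually_mono[OF slice[OF i]]) (rule Hpd2[OF a])
  \<comment> \<open>Exchanging derivatives expresses the rate of change of the Jacobian determinant
    through derivatives of the vector field \<open>\<theta>\<close>.\<close>
  have comm: "pdv 2 (pdv i (H a)) x = pdv i (\<theta> a) x" if a: "a < 2" and i: "i < 2" for a i
    using pdv_commute[OF Hh[OF a] Do xD, of i 2] i H2i[OF a i] by simp
  have Jx: "J x = Jc c x" unfolding J_def Jc_def by (simp add: HiTS)
  have Kx: "K x = Jc d x" unfolding K_def TSp(7)[OF x] ..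
  have J2: "pdv 2 J x = pdv 0 (\<theta> 0) x * dphi (e c) 1 1 x + dphi (e c) 0 0 x * pdv 1 (\<theta> 1) x
      - (pdv 1 (\<theta> 0) x * dphi (e c) 1 0 x + dphi (e c) 0 1 x * pdv 0 (\<theta> 1) x)"
  proof -
    have m: "pdv 2 (\<lambda>y. pdv i (H a) y * pdv l (H b) y) x =
        pdv i (\<theta> a) x * dphi (e c) b l x + dphi (e c) a i x * pdv l (\<theta> b) x"
      if "i < 2" "l < 2" "a < 2" "b < 2" for i l a b
      using pdv_mult[OF Hi[of a i] Hi[of b l] xD, of 2] that by (simp add: comm HiTS)
    have "pdv 2 J x = pdv 2 (\<lambda>y. pdv 0 (H 0) y * pdv 1 (H 1) y) x - pdv 2 (\<lambda>y. pdv 1 (H 0) y * pdv 0 (H 1) y) x"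
      unfolding J_def[abs_def] by (rule pdv_diff[OF hol_on_mult[OF Hi Hi] hol_on_mult[OF Hi Hi] xD]) auto
    then show ?thesis using m[of 0 1 0 1] m[of 1 0 0 1] by simp
  qed

  define JJ where "JJ = (\<lambda>y. pdv 0 (\<lambda>y. snd (e c) (\<phi> y) 0) y * pdv 1 (\<lambda>y. snd (e c) (\<phi> y) 1) y
      - pdv 1 (\<lambda>y. snd (e c) (\<phi> y) 0) y * pdv 0 (\<lambda>y. snd (e c) (\<phi> y) 1) y)"
  have JJ: "Jc c = JJ" by (simp add: fun_eq_iff JJ_def Jc_def dphi_def)
  have t: "(0::nat) < 2" "(1::nat) < 2" by auto
  note brk = TSo cc[OF t(1)] cc[OF t(2)] g \<tau>[OF t(1)] \<tau>[OF t(2)]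
  have \<theta>': "\<theta> a y = \<tau> 0 y * pdv 0 (\<lambda>y. snd (e c) (\<phi> y) a) y + \<tau> 1 y * pdv 1 (\<lambda>y. snd (e c) (\<phi> y) a) y" for a y
    by (simp add: \<theta>_def dphi_def)
  have E1: "pdv 0 (pdv 2 (Bf c)) z * \<theta> 0 x + pdv 1 (pdv 2 (Bf c)) z * \<theta> 1 x
    = (\<tau> 0 x * pdv 0 g x + \<tau> 1 x * pdv 1 g x) * Jc c x + g x * (\<tau> 0 x * pdv 0 (Jc c) x + \<tau> 1 x * pdv 1 (Jc c) x)"
    unfolding JJ
  proof (rule derivative_of_density[OF brk _ \<theta>' \<theta>' _ \<Omega>o _ _ x])
    show "z = mk3 (snd (e c) (\<phi> x) 0) (snd (e c) (\<phi> x) 1) 0" unfolding zc[OF x] z_def ..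
    show "hol_on 3 \<Omega> (pdv 2 (Bf c))" using hol_on_pdv_hol[OF Bf_hol[OF c, folded \<Omega>_def] \<Omega>o] by simp
    fix y assume y: "y \<in> TS"
    show "mk3 (snd (e c) (\<phi> y) 0) (snd (e c) (\<phi> y) 1) 0 \<in> \<Omega>"
      unfolding zc[OF y] \<Omega>_def using fibre_Om[OF c] TSp[OF y] by blast
    show "pdv 2 (Bf c) (mk3 (snd (e c) (\<phi> y) 0) (snd (e c) (\<phi> y) 1) 0) = g y * JJ y"
      unfolding zc[OF y] gc[OF y] JJ ..
  qed (simp add: JJ_def)
  have E2: "pdv 2 J x = (pdv 0 (\<tau> 0) x + pdv 1 (\<tau> 1) x) * Jc c x + \<tau> 0 x * pdv 0 (Jc c) x + \<tau> 1 x * pdv 1 (Jc c) x"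
    unfolding J2 JJ dphi_def
    by (rule derivative_of_jacobian[OF brk _ \<theta>' \<theta>' x]) (simp add: JJ_def)
  have "(pdv 2 (pdv 2 (Bf c)) z + 2 * (pdv 0 (pdv 2 (Bf c)) z * \<theta> 0 x + pdv 1 (pdv 2 (Bf c)) z * \<theta> 1 x)) * Jc d x
    = Jc c x * pdv 2 (pdv 2 (Bf d)) (snd (e d) (\<phi> x)) + 2 * pdv 2 J x * (g x * Jc d x)"
    using main Hpd2[OF t(1) x] Hpd2[OF t(2) x] A22 A2[OF xD] h_fibre[OF x] gd[OF x] Jx Kx by simp
  \<comment> \<open>The derivatives of \<open>Jc c\<close> along \<open>\<tau>\<close> occur in both
    \<open>E1\<close> and \<open>E2\<close> with factor \<open>g x\<close> and cancel; the Lie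
    derivative remains.\<close>
  then have "pdv 2 (pdv 2 (Bf c)) z * Jc d x
      + 2 * (\<tau> 0 x * pdv 0 g x + \<tau> 1 x * pdv 1 g x - (pdv 0 (\<tau> 0) x + pdv 1 (\<tau> 1) x) * g x) * (Jc c x * Jc d x)
    = Jc c x * pdv 2 (pdv 2 (Bf d)) (snd (e d) (\<phi> x))"
    unfolding E1 E2 by (simp add: algebra_simps)
  moreover have "Jc c x \<noteq> 0" "Jc d x \<noteq> 0" using Jc_nz[OF c] Jc_nz[OF d] TSp[OF x] by auto
  ultimately show ?thesis by (simp add: z_def field_simps)
qed

end

section \<open>The contradiction\<close>

text \<open>In the coordinate \<open>\<zeta> = ln w\<close> the mean of \<open>h\<close> over a circle becomes the increment of a
  primitive over the period \<open>2 \<pi> i\<close>; it does not depend on the radius, whereas the functional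
  equation shifts it by \<open>\<kappa>\<close>.\<close>

lemma no_additive_multiplier:
  fixes h :: "complex \<Rightarrow> complex"
  assumes h: "h holomorphic_on - {0}" and \<delta>: "\<delta> \<noteq> 0"
    and eq: "\<And>w. w \<noteq> 0 \<Longrightarrow> h (\<delta> * w) = h w + \<kappa>"
  shows "\<kappa> = 0"
proof -
  have hol: "(h \<circ> exp) holomorphic_on UNIV"
    by (rule holomorphic_on_compose_gen[OF holomorphic_on_exp h]) auto
  obtain K where "\<And>z. z \<in> UNIV \<Longrightarrow> (K has_field_derivative (h \<circ> exp) z) (at z within UNIV)"
    by (rule holomorphic_convex_primitive'[OF convex_UNIV open_UNIV hol]) (rule that)
  then have K: "\<And>z. (K has_field_derivative h (exp z)) (at z)" by simp
  have const: "f x = f y" if "\<And>z. (f has_field_derivative 0) (at z)" for f :: "complex \<Rightarrow> complex" and x y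
    using has_field_derivative_zero_constant[of UNIV f] that by (metis UNIV_I convex_UNIV)
  define l where "l = Ln \<delta>"
  define t where "t = 2 * of_real pi * \<i>"
  have 1: "K (l + t) - K l = K (0 + t) - K 0"
  proof (rule const[of "\<lambda>s. K (s + t) - K s"])
    fix z
    have "((\<lambda>s. K (s + t)) has_field_derivative h (exp (z + t))) (at z)"
      using K[of "z + t"] by (simp add: DERIV_shift)
    moreover have "exp (z + t) = exp z" by (simp add: exp_add t_def)
    ultimately show "((\<lambda>s. K (s + t) - K s) has_field_derivative 0) (at z)"
      using DERIV_diff[OF _ K[of z]] by fastforce
  qed
  have 2: "K (t + l) - K t - \<kappa> * t = K (0 + l) - K 0 - \<kappa> * 0"
  proof (rule const[of "\<lambda>s. K (s + l) - K s - \<kappa> * s"])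
    fix z
    have "((\<lambda>s. K (s + l)) has_field_derivative h (exp (z + l))) (at z)"
      using K[of "z + l"] by (simp add: DERIV_shift)
    moreover have "h (exp (z + l)) = h (exp z) + \<kappa>"
      using eq[of "exp z"] \<delta> by (simp add: exp_add l_def mult.commute)
    ultimately show "((\<lambda>s. K (s + l) - K s - \<kappa> * s) has_field_derivative 0) (at z)"
      by (auto intro!: derivative_eq_intros K)
  qed
  have "\<kappa> * t = 0" using 1 2 by (simp add: add.commute algebra_simps)
  then show ?thesis by (simp add: t_def)
qed

context hopf_family
begin

section \<open>Holomorphy and weights of the second order terms\<close>

definition gg :: "(nat \<Rightarrow> complex) \<Rightarrow> complex" where "gg y = y 1 ^ (p + 1)"

lemma gg_hol: "hol_on n T gg"
  unfolding gg_def[abs_def] by (intro hol_on_power hol_on_coord)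

lemma gg_pdv: "pdv 0 gg x = 0" "pdv 1 gg x = of_nat (p + 1) * x 1 ^ p"
proof -
  show "pdv 0 gg x = 0" by (simp add: gg_def[abs_def] pdv_def)
  show "pdv 1 gg x = of_nat (p + 1) * x 1 ^ p"
    unfolding gg_def[abs_def] by (rule pdv_eqI) (use DERIV_power[OF DERIV_ident, of "p + 1" "x 1" UNIV] in simp)
qed

text \<open>Identifies the first order coefficient along the line with the bivector part of the
  Kodaira-Spencer cocycle.\<close>

lemma Bf_vector:
  assumes c: "ad c" and y: "y \<in> W" "\<phi> y \<in> fst c"
  shows "pdv 2 (Bf c) (snd (e c) (\<phi> y)) = (\<Sum>i<r. v i * pd c (2 + i) (totbiv F c 0 1) (\<phi> y))"
  using lift_pdv_2[OF c chart_open_dom[OF ad_chart[OF c]] totbiv_hol[OF c] fibre_Om[OF c y y(2)]]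
  unfolding em_fibre(2)[OF c y] Bf_def[abs_def] .

text \<open>Twice the coefficient of \<open>s\<^sup>2\<close> in the bivector field over \<open>s v\<close>, expressed in the linear
  coordinates of \<open>W\<close>.\<close>

definition Eq2 :: "'e chart \<Rightarrow> (nat \<Rightarrow> complex) \<Rightarrow> complex" where
  "Eq2 c x = pdv 2 (pdv 2 (Bf c)) (snd (e c) (\<phi> x)) / Jc c x"

lemma e_dom_open: "ad c \<Longrightarrow> openin (cspace 2) {x\<in>W. \<phi> x \<in> fst (e c)}"
  by (rule dom_open[OF e_matlas])

lemma Eq2_hol:
  assumes c: "ad c"
  shows "hol_on 2 {x\<in>W. \<phi> x \<in> fst (e c)} (Eq2 c)"
proof -
  let ?T = "{x\<in>W. \<phi> x \<in> fst (e c)}"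
  have fc: "\<phi> x \<in> fst c" if "x \<in> ?T" for x using that by (simp add: e_dom)
  note O = Om_dom_open[OF c c]
  have "hol_on 3 (Om c (fst c)) (pdv 2 (pdv 2 (Bf c)))"
    by (intro hol_on_pdv_hol Bf_hol c O) auto
  then have 1: "hol_on 2 ?T (\<lambda>x. pdv 2 (pdv 2 (Bf c)) (snd (e c) (\<phi> x)))"
  proof (rule hol_on_compose[OF _ O e_dom_open[OF c]])
    show "snd (e c) (\<phi> x) \<in> Om c (fst c)" if "x \<in> ?T" for x
      using fibre_Om[OF c] fc[OF that] that by blast
    fix i :: nat assume "i < 3"
    show "hol_on 2 ?T (\<lambda>x. snd (e c) (\<phi> x) i)"
    proof (cases "i < 2")
      case True
      then show ?thesis by (rule coord_hol2[OF e_matlas[OF c]])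
    next
      case False
      then have "snd (e c) q i = 0" for q by (simp add: fibre_chart_def fdim_2)
      then show ?thesis by (simp add: hol_on_const)
    qed
  qed
  have "hol_on 2 ?T (Jc c)" unfolding Jc_def[abs_def]
    by (intro hol_on_diff hol_on_mult dphi_hol[OF e_matlas[OF c]]) auto
  then show ?thesis
    unfolding Eq2_def[abs_def] by (rule hol_on_divide[OF 1]) (use Jc_nz[OF c] fc in auto)
qed

text \<open>The numerator depends on \<open>x\<close> only through \<open>\<phi> x\<close>, so the
  whole weight comes from \<open>Jc\<close>.\<close>

lemma Eq2_act:
  assumes c: "ad c" and x: "x \<in> W" "\<phi> x \<in> fst (e c)"
  shows "Eq2 c (act k x) = \<mu> k 0 * \<mu> k 1 * Eq2 c x"
proof -
  have "Jc c x = \<mu> k 0 * \<mu> k 1 * Jc c (act k x)"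
    using dphi_act[OF e_matlas[OF c] x, of 0 0 k] dphi_act[OF e_matlas[OF c] x, of 0 1 k]
      dphi_act[OF e_matlas[OF c] x, of 1 0 k] dphi_act[OF e_matlas[OF c] x, of 1 1 k]
    unfolding Jc_def by (simp add: algebra_simps)
  moreover have "Jc c x \<noteq> 0" using Jc_nz[OF c x(1)] x(2) by (simp add: e_dom)
  ultimately show ?thesis unfolding Eq2_def by (simp add: \<phi>_act x)
qed

text \<open>The coefficient of the Lie derivative of \<open>gg \<partial>\<^sub>0 \<and> \<partial>\<^sub>1\<close> along \<open>Y\<close>; the term with \<open>pdv 0 gg\<close>
  vanishes.\<close>

definition Lg :: "'e vfield \<Rightarrow> (nat \<Rightarrow> complex) \<Rightarrow> complex" where
  "Lg Y x = Yw Y 1 x * pdv 1 gg x - (pdv 0 (Yw Y 0) x + pdv 1 (Yw Y 1) x) * gg x"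

context
  fixes S :: "'e set" and Y :: "'e vfield"
  assumes S: "openin (mtop M0) S" and Y: "hol_vfield M0 S Y"
begin

lemma Lg_hol: "hol_on 2 {x\<in>W. \<phi> x \<in> S} (Lg Y)"
proof -
  note o = \<phi>_preimage_open[OF S]
  show ?thesis unfolding Lg_def[abs_def]
    by (intro hol_on_diff hol_on_mult hol_on_add hol_on_pdv_hol[OF _ o] gg_hol Yw_hol[OF S Y]) auto
qed

text \<open>The divergence of an invariant field is invariant, and differentiating \<open>gg\<close>
  along such a field preserves its weight.\<close>

lemma Lg_act:
  assumes x: "x \<in> W" "\<phi> x \<in> S"
  shows "Lg Y (act k x) = \<mu> k 0 * \<mu> k 1 * Lg Y x"
proof -
  let ?T = "{x\<in>W. \<phi> x \<in> S}"
  note o = \<phi>_preimage_open[OF S]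
  have xT: "x \<in> ?T" "act k x \<in> ?T" using x act_W \<phi>_act by auto
  have d: "pdv i (Yw Y i) (act k x) = pdv i (Yw Y i) x" if i: "i < 2" for i
  proof -
    have "\<mu> k i * pdv i (Yw Y i) (act k x) = pdv i (\<lambda>y. Yw Y i (act k y)) x"
      using act_chain[OF Yw_hol[OF S Y i] o xT(2) W_cvec[OF x(1)] i] by simp
    also have "\<dots> = pdv i (\<lambda>y. \<mu> k i * Yw Y i y) x"
      by (rule pdv_cong[OF o xT(1) i]) (use Yw_act[OF S Y _ _ i] in auto)
    also have "\<dots> = \<mu> k i * pdv i (Yw Y i) x"
      by (rule pdv_cmult[OF Yw_hol[OF S Y i] xT(1) i])
    finally show ?thesis by simp
  qed
  have gk: "gg (act k x) = \<mu> k 0 * \<mu> k 1 * gg x"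
    by (simp add: gg_def \<mu>_def weight_eq power_mult_distrib)
  have gk1: "\<mu> k 1 * pdv 1 gg (act k x) = \<mu> k 0 * \<mu> k 1 * pdv 1 gg x"
    unfolding gg_pdv by (simp add: \<mu>_def weight_eq power_mult_distrib)
  have "Lg Y (act k x) = Yw Y 1 x * (\<mu> k 1 * pdv 1 gg (act k x)) - (pdv 0 (Yw Y 0) x + pdv 1 (Yw Y 1) x) * gg (act k x)"
    unfolding Lg_def using Yw_act[OF S Y x, of 1 k] d[of 0] d[of 1] by simp
  then show ?thesis unfolding gk1 gk Lg_def by (simp add: algebra_simps)
qed

end

text \<open>The second order coefficient of each chart, corrected by the Lie derivative of
  \<open>P\<close> along \<open>X j\<close> and by the branch \<open>m (ss j)\<close>, agrees with
  its neighbours on overlaps. The functions so obtained glue on \<open>W\<close>, but the branch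
  grows by one under the contraction, and this increment is what
  \<open>no_additive_multiplier\<close> excludes.\<close>

lemma no_ks_preimage:
  assumes cs: "\<And>j. ad (cs j)"
    and rel: "(ks_cocycle F cs v, (Uc, \<theta>c, \<lambda>j. \<pi>c)) \<in> hyper_rel M0 (fibre_biv F (\<lambda>i. 0))"
  shows False
proof -
  define \<theta>k where "\<theta>k j k = vf_of_comps M0 (e (cs j))
    (\<lambda>a q. \<Sum>i<r. v i * pd (cs k) (2 + i) (\<lambda>q. snd (cs j) q a) q)" for j k
  define Pk where "Pk j = bf_of_comps M0 (e (cs j))
    (\<lambda>a b q. \<Sum>i<r. v i * pd (cs j) (2 + i) (totbiv F (cs j) a b) q)" for j
  have ks: "ks_cocycle F cs v = (\<lambda>j. fst (e (cs j)), \<theta>k, Pk)"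
    unfolding ks_cocycle_def Let_def \<theta>k_def[abs_def] Pk_def[abs_def] fdim_2 ..
  obtain V rr ss X where oc: "open_cover M0 V"
    and sub: "\<And>j. V j \<subseteq> fst (e (cs (rr j)))" "\<And>j. V j \<subseteq> Uc (ss j)"
    and Xh: "\<And>j. hol_vfield M0 (V j) (X j)"
    and vfe: "\<And>j k. vf_eq M0 (V j \<inter> V k)
      (vf_diff (\<theta>k (rr j) (rr k)) (\<theta>c (ss j) (ss k))) (vf_diff (X k) (X j))"
    and bfe: "\<And>j. bf_eq M0 (V j) (bf_diff (Pk (rr j)) \<pi>c)
      (bf_scale (- 1) (schouten_bv M0 (fibre_biv F (\<lambda>i. 0)) (X j)))"
    using rel unfolding ks hyper_rel_def by blast
  have Vo: "openin (mtop M0) (V j)" for j using oc by (simp add: open_cover_def)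
  define C where "C j = cs (rr j)" for j
  have C: "ad (C j)" for j using cs by (simp add: C_def)
  have VC: "q \<in> fst (e (C j))" "q \<in> fst (C j)" if "q \<in> V j" for q j
    using sub(1)[of j] that by (auto simp: C_def e_dom)
  have VU: "y \<in> Us (ss j)" if "y \<in> W" "\<phi> y \<in> V j" for y j
    using sub(2)[of j] \<phi>_Uc[OF that(1)] that(2) by blast

  have pc: "pd (e (C j)) i (\<lambda>q. snd (e (C j)) q a) q = (if i = a then 1 else 0)"
    if "q \<in> fst (e (C j))" "i < 2" for q j i a
    using pd_coord[OF max_atlas_chart[OF e_matlas[OF C]] that(1)] that(2) mdim_2 by simp

  \<comment> \<open>For the zero structure coboundaries have no bivector part, so the first order
    term of the bivector field equals \<open>P\<close> itself, not only up to a coboundary.\<close>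
  have P: "pdv 2 (Bf (C j)) (snd (e (C j)) (\<phi> y)) = gg y * Jc (C j) y"
    if y: "y \<in> W" "\<phi> y \<in> V j" for j y
  proof -
    let ?e = "e (C j)"
    note em = e_matlas[OF C[of j]] and ye = VC(1)[OF y(2)] and yc = VC(2)[OF y(2)]
    have t: "(0::nat) < 2" "(1::nat) < 2" by auto
    have "bf_diff (Pk (rr j)) \<pi>c ?e 0 1 (\<phi> y) = bf_scale (- 1) (schouten_bv M0 (fibre_biv F (\<lambda>i. 0)) (X j)) ?e 0 1 (\<phi> y)"
      using bfe[of j] em ye y(2) t unfolding bf_eq_def mdim_2 by blast
    also have "\<dots> = 0"
      by (simp add: bf_scale_def schouten_bv_def lie_deriv_zero[OF L0 em ye])
    finally have "Pk (rr j) ?e 0 1 (\<phi> y) = \<pi>c ?e 0 1 (\<phi> y)" by (simp add: bf_diff_def)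
    also have "\<dots> = gg y * Jc (C j) y"
      unfolding \<pi>c_\<phi>[OF em y(1) ye t] Pc_def Jc_def gg_def ..
    also have "Pk (rr j) ?e 0 1 (\<phi> y) = (\<Sum>i<r. v i * pd (C j) (2 + i) (totbiv F (C j) 0 1) (\<phi> y))"
    proof -
      show ?thesis
        unfolding Pk_def bf_of_comps_def mdim_2 sum_lessThan_2 C_def[symmetric]
          pc[OF ye t(1)] pc[OF ye t(2)] by simp
    qed
    finally show ?thesis using Bf_vector[OF C y(1) yc] by simp
  qed

  \<comment> \<open>The vector part is \<open>n V\<close> corrected by \<open>X k - X j\<close>,
    expressed in linear coordinates; the sign of the correction is the one in
    \<open>hyper_rel\<close>.\<close>
  have \<Theta>: "(\<Sum>i<r. v i * pd (C k) (2 + i) (\<lambda>q. snd (C j) q a) (\<phi> y)) =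
      (Yw (X k) 0 y - Yw (X j) 0 y + of_int (m (ss k) y - m (ss j) y) * y 0) * dphi (e (C j)) a 0 y
      + (Yw (X k) 1 y - Yw (X j) 1 y) * dphi (e (C j)) a 1 y"
    if y: "y \<in> W" "\<phi> y \<in> V j" "\<phi> y \<in> V k" and a: "a < 2" for j k y a
  proof -
    let ?e = "e (C j)"
    note em = e_matlas[OF C[of j]] and ye = VC(1)[OF y(2)]
    have "vf_diff (\<theta>k (rr j) (rr k)) (\<theta>c (ss j) (ss k)) ?e a (\<phi> y) = vf_diff (X k) (X j) ?e a (\<phi> y)"
      using vfe[of j k] em ye y(2,3) a unfolding vf_eq_def mdim_2 by blast
    then have "\<theta>k (rr j) (rr k) ?e a (\<phi> y) = \<theta>c (ss j) (ss k) ?e a (\<phi> y) + X k ?e a (\<phi> y) - X j ?e a (\<phi> y)"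
      by (simp add: vf_diff_def algebra_simps)
    also have "\<theta>c (ss j) (ss k) ?e a (\<phi> y) = of_int (m (ss k) y - m (ss j) y) * (y 0 * dphi ?e a 0 y)"
      unfolding \<theta>c_\<phi>[OF em y(1) ye a] Vc_def ..
    also have "X k ?e a (\<phi> y) = Yw (X k) 0 y * dphi ?e a 0 y + Yw (X k) 1 y * dphi ?e a 1 y"
      using Yw_comp[OF Vo Xh y(1,3) em ye a] by (simp add: sum_lessThan_2)
    also have "X j ?e a (\<phi> y) = Yw (X j) 0 y * dphi ?e a 0 y + Yw (X j) 1 y * dphi ?e a 1 y"
      using Yw_comp[OF Vo Xh y(1,2) em ye a] by (simp add: sum_lessThan_2)
    also have "\<theta>k (rr j) (rr k) ?e a (\<phi> y) = (\<Sum>i<r. v i * pd (C k) (2 + i) (\<lambda>q. snd (C j) q a) (\<phi> y))"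
    proof -
      have t: "(0::nat) < 2" "(1::nat) < 2" by auto
      show ?thesis
        unfolding \<theta>k_def vf_of_comps_def mdim_2 sum_lessThan_2 C_def[symmetric] pc[OF ye t(1)] pc[OF ye t(2)]
        using less_2_cases[OF a] by auto
    qed
    finally show ?thesis by (simp only: algebra_simps)
  qed

  \<comment> \<open>The last term enters with a plus sign because the Lie derivative of
    \<open>P\<close> along \<open>V\<close> is \<open>- P\<close>.\<close>
  define R where "R j x = Eq2 (C j) x - 2 * Lg (X j) x + 2 * of_int (m (ss j) x) * gg x" for j x
  define T where "T j = {x\<in>W. \<phi> x \<in> V j}" for j
  have To: "openin (cspace 2) (T j)" for j unfolding T_def by (rule \<phi>_preimage_open[OF Vo])

  have R_indep: "R j x = R k x" if x: "x \<in> W" "\<phi> x \<in> V j" "\<phi> x \<in> V k" for j k x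
  proof -
    let ?TS = "{y\<in>W. \<phi> y \<in> V j \<inter> V k}"
    have So: "openin (mtop M0) (V j \<inter> V k)" using Vo by blast
    note o = \<phi>_preimage_open[OF So]
    have xT: "x \<in> ?TS" using x by simp
    define n where "n y = (of_int (m (ss k) y - m (ss j) y) :: complex)" for y
    define \<tau> where "\<tau> i y = Yw (X k) i y - Yw (X j) i y + (if i = 0 then n y * y 0 else 0)" for i y
    have Yk: "hol_on 2 ?TS (Yw (X k) i)" "hol_on 2 ?TS (Yw (X j) i)" if "i < 2" for i
      by (rule hol_on_subset[OF Yw_hol[OF Vo Xh that]]; auto)+
    have mh: "hol_on 2 ?TS (\<lambda>y. of_int (m (ss l) y))" if "l = j \<or> l = k" for l
      by (rule hol_on_subset[OF m_hol]) (use that VU in auto)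
    have nh: "hol_on 2 ?TS n" unfolding n_def[abs_def] of_int_diff
      by (intro hol_on_diff mh) auto
    have nh0: "hol_on 2 ?TS (\<lambda>y. n y * y 0)" by (intro hol_on_mult nh hol_on_coord)
    have \<tau>h: "hol_on 2 ?TS (\<tau> i)" if "i < 2" for i
      unfolding \<tau>_def[abs_def] using nh0 Yk[OF that]
      by (cases "i = 0") (auto intro!: hol_on_add hol_on_diff)
    \<comment> \<open>Local constancy of \<open>n\<close> makes the divergence of \<open>n V\<close>
      equal to \<open>n\<close>.\<close>
    have n0: "pdv i n x = 0" if "i < 2" for i
    proof -
      obtain U1 U2 where U: "openin (cspace 2) U1" "x \<in> U1" "\<forall>y\<in>U1. m (ss j) y = m (ss j) x"
        "openin (cspace 2) U2" "x \<in> U2" "\<forall>y\<in>U2. m (ss k) y = m (ss k) x"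
        using m_local[OF VU[OF x(1,2)]] m_local[OF VU[OF x(1,3)]] by metis
      have "pdv i n x = pdv i (\<lambda>y. n x) x"
      proof (rule pdv_cong[of 2 "U1 \<inter> U2"])
        fix y assume "y \<in> U1 \<inter> U2"
        then show "n y = n x" using bspec[OF U(3), of y] bspec[OF U(6), of y] by (simp add: n_def)
      qed (use U that in auto)
      then show ?thesis by simp
    qed
    have main: "pdv 2 (pdv 2 (Bf (C j))) (snd (e (C j)) (\<phi> x)) / Jc (C j) x
      + 2 * (\<tau> 0 x * pdv 0 gg x + \<tau> 1 x * pdv 1 gg x - (pdv 0 (\<tau> 0) x + pdv 1 (\<tau> 1) x) * gg x)
      = pdv 2 (pdv 2 (Bf (C k))) (snd (e (C k)) (\<phi> x)) / Jc (C k) x"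
    proof (rule local_transformation[OF C C So _ \<tau>h gg_hol _ _ _ xT])
      show "V j \<inter> V k \<subseteq> fst (C j) \<inter> fst (C k)" using VC by blast
      fix y assume y: "y \<in> ?TS"
      show "pdv 2 (Bf (C j)) (snd (e (C j)) (\<phi> y)) = gg y * Jc (C j) y"
        "pdv 2 (Bf (C k)) (snd (e (C k)) (\<phi> y)) = gg y * Jc (C k) y" using P y by auto
      fix a :: nat assume "a < 2"
      then show "(\<Sum>i<r. v i * pd (C k) (2 + i) (\<lambda>q. snd (C j) q a) (\<phi> y)) =
        \<tau> 0 y * dphi (e (C j)) a 0 y + \<tau> 1 y * dphi (e (C j)) a 1 y"
        using \<Theta>[of y j k a] y by (simp add: \<tau>_def n_def)
    qed
    have d0: "pdv 0 (\<tau> 0) x = pdv 0 (Yw (X k) 0) x - pdv 0 (Yw (X j) 0) x + n x"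
    proof -
      have "pdv 0 (\<tau> 0) x = pdv 0 (\<lambda>y. Yw (X k) 0 y - Yw (X j) 0 y) x + pdv 0 (\<lambda>y. n y * y 0) x"
        unfolding \<tau>_def[abs_def] using pdv_add[OF hol_on_diff[OF Yk] nh0 xT, of 0 0] by simp
      also have "pdv 0 (\<lambda>y. Yw (X k) 0 y - Yw (X j) 0 y) x = pdv 0 (Yw (X k) 0) x - pdv 0 (Yw (X j) 0) x"
        using pdv_diff[OF Yk xT, of 0 0] by simp
      also have "pdv 0 (\<lambda>y. n y * y 0) x = n x"
        using pdv_mult[OF nh hol_on_coord xT, of 0 0] n0[of 0] by (simp add: pdv_coord)
      finally show ?thesis .
    qed
    have d1: "pdv 1 (\<tau> 1) x = pdv 1 (Yw (X k) 1) x - pdv 1 (Yw (X j) 1) x"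
      unfolding \<tau>_def[abs_def] using pdv_diff[OF Yk xT, of 1 1] by simp
    have t1: "\<tau> 1 x = Yw (X k) 1 x - Yw (X j) 1 x" by (simp add: \<tau>_def)
    have nx: "n x = of_int (m (ss k) x) - of_int (m (ss j) x)" by (simp add: n_def)
    have "Eq2 (C j) x + 2 * (Lg (X k) x - Lg (X j) x
        - (of_int (m (ss k) x) - of_int (m (ss j) x)) * gg x) = Eq2 (C k) x"
      using main[folded Eq2_def] unfolding d0 d1 t1 nx Lg_def gg_pdv(1) by (simp add: algebra_simps)
    then show ?thesis unfolding R_def by (simp add: algebra_simps)
  qed

  have R_hol: "hol_on 2 (T j) (R j)" for j
  proof -
    have "hol_on 2 (T j) (Eq2 (C j))" by (rule hol_on_subset[OF Eq2_hol[OF C]]) (use VC in \<open>auto simp: T_def\<close>)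
    moreover have "hol_on 2 (T j) (\<lambda>y. of_int (m (ss j) y))"
      by (rule hol_on_subset[OF m_hol]) (use VU in \<open>auto simp: T_def\<close>)
    ultimately show ?thesis unfolding R_def[abs_def]
      using Lg_hol[OF Vo Xh, of j, folded T_def] gg_hol
      by (intro hol_on_add hol_on_diff hol_on_mult hol_on_const)
  qed

  \<comment> \<open>All three terms carry the same weight; the extra \<open>2 * gg x\<close> is the
    increment of \<open>m\<close> by one.\<close>
  have R_act: "R j (act 1 x) = \<delta> ^ (p + 1) * (R j x + 2 * gg x)" if x: "x \<in> W" "\<phi> x \<in> V j" for j x
  proof -
    have mu: "\<mu> 1 0 * \<mu> 1 1 = \<delta> ^ (p + 1)" by (simp add: \<mu>_def)
    have g: "gg (act 1 x) = \<delta> ^ (p + 1) * gg x" by (simp add: gg_def power_mult_distrib)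
    show ?thesis
      unfolding R_def g m_act[OF x(1)] Eq2_act[OF C x(1) VC(1)[OF x(2)], of 1] Lg_act[OF Vo Xh x, of 1] mu
      by (simp add: algebra_simps)
  qed

  \<comment> \<open>Here \<open>ln\<close> is not the logarithm but the parametrisation of the curve
    \<open>z = 0\<close>, on which \<open>gg\<close> vanishes only for \<open>w = 0\<close>.\<close>
  define ln where "ln w = (\<lambda>i::nat. 0)(1 := w)" for w :: complex
  have lnW: "ln w \<in> W" if "w \<noteq> 0" for w using that by (auto simp: ln_def W_iff cvec_def)
  have ln_act: "ln (\<delta> * w) = act 1 (ln w)" for w by (auto simp: ln_def act_def fun_eq_iff)
  have ln_upd: "(ln w)(1 := s) = ln s" for w s by (simp add: ln_def)
  have ln_gg: "gg (ln w) = w ^ (p + 1)" for w by (simp add: gg_def ln_def)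
  \<comment> \<open>Any index can be chosen, because by \<open>R_indep\<close> the value does not
    depend on it.\<close>
  define jj where "jj q = (SOME j. q \<in> V j)" for q
  have jj: "\<phi> x \<in> V (jj (\<phi> x))" if "x \<in> W" for x
  proof -
    have "\<exists>j. \<phi> x \<in> V j" using oc \<phi>_points[OF that] by (auto simp: open_cover_def)
    then show ?thesis unfolding jj_def by (rule someI_ex)
  qed
  define h where "h w = R (jj (\<phi> (ln w))) (ln w) / w ^ (p + 1)" for w
  have "h holomorphic_on - {0}"
    unfolding holomorphic_on_def
  proof
    fix w :: complex assume "w \<in> - {0}"
    then have w: "w \<noteq> 0" by simp
    define j where "j = jj (\<phi> (ln w))"
    have wT: "ln w \<in> T j" using jj[OF lnW[OF w]] lnW[OF w] by (simp add: T_def j_def)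
    have "((\<lambda>s. R j ((ln w)(1 := s))) has_field_derivative pdv 1 (R j) (ln w)) (at ((ln w) 1))"
      by (rule hol_on_pdv[OF R_hol wT]) simp
    then have 1: "((\<lambda>s. R j (ln s)) has_field_derivative pdv 1 (R j) (ln w)) (at w)"
      unfolding ln_upd by (simp add: ln_def)
    have diff: "(\<lambda>s. R j (ln s) / s ^ (p + 1)) field_differentiable (at w)"
      using 1 w by (intro field_differentiable_divide)
        (auto simp: field_differentiable_def intro!: derivative_eq_intros exI)
    have "eventually (\<lambda>s. (ln w)(1 := s) \<in> T j) (nhds ((ln w) 1))"
      by (rule slice_nhd[OF To wT]) simp
    then have "eventually (\<lambda>s. ln s \<in> T j) (nhds w)" unfolding ln_upd by (simp add: ln_def)
    then have ev: "eventually (\<lambda>s. R j (ln s) / s ^ (p + 1) = h s) (nhds w)"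
    proof eventually_elim
      case (elim s)
      then have "ln s \<in> W" "\<phi> (ln s) \<in> V j" by (auto simp: T_def)
      then show ?case using R_indep[OF _ _ jj, of "ln s" j] by (simp add: h_def)
    qed
    have "h field_differentiable (at w)"
      using diff unfolding field_differentiable_def DERIV_cong_ev[OF refl ev refl] .
    then show "h field_differentiable (at w within - {0})" by (rule field_differentiable_at_within)
  qed
  moreover have "h (\<delta> * w) = h w + 2" if w: "w \<noteq> 0" for w
  proof -
    have "h (\<delta> * w) = \<delta> ^ (p + 1) * (R (jj (\<phi> (ln w))) (ln w) + 2 * w ^ (p + 1)) / (\<delta> * w) ^ (p + 1)"
      unfolding h_def ln_act \<phi>_act[OF lnW[OF w]] R_act[OF lnW[OF w] jj[OF lnW[OF w]]] ln_gg ..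
    also have "\<dots> = (R (jj (\<phi> (ln w))) (ln w) + 2 * w ^ (p + 1)) / w ^ (p + 1)"
      unfolding power_mult_distrib by (rule mult_divide_mult_cancel_left) simp
    also have "\<dots> = h w + 2" unfolding h_def using w by (simp add: add_divide_distrib)
    finally show ?thesis .
  qed
  ultimately have "(2::complex) = 0" by (intro no_additive_multiplier[of h \<delta> 2]) auto
  then show False by simp
qed

end

section \<open>From surjectivity of the Kodaira-Spencer map to a pair of related cocycles\<close>

lemma adapted_cover_exists:
  assumes fam: "poisson_analytic_family F" and 0: "(\<lambda>i. 0) \<in> base F" and ne: "fibre_set F (\<lambda>i. 0) \<noteq> {}"
  shows "\<exists>c. adapted_cover F c"
proof -
  let ?S = "fibre_set F (\<lambda>i. 0)" and ?T = "mtop (tot F)"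
  have totM: "complex_manifold (tot F)" using fam by (simp add: poisson_analytic_family_def poisson_manifold_def)
  have "\<forall>t\<in>base F. compactin ?T (fibre_set F t)"
    using fam unfolding poisson_analytic_family_def by blast
  then have cmp: "compactin ?T ?S" using 0 by blast
  have o: "openin ?T U" if "U \<in> fst ` {c. adapted_chart F c}" for U
  proof -
    obtain c where c: "adapted_chart F c" "U = fst c" using \<open>U \<in> _\<close> by blast
    then have "c \<in> max_atlas (tot F)" by (simp add: adapted_chart_def)
    then show ?thesis using chart_open_dom[OF max_atlas_chart] c(2) by blast
  qed
  have "\<forall>q\<in>points (tot F). \<exists>c. adapted_chart F c \<and> q \<in> fst c"
    using fam unfolding poisson_analytic_family_def by blast
  then have cov: "?S \<subseteq> \<Union> (fst ` {c. adapted_chart F c})" by (force simp: fibre_set_def)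
  \<comment> \<open>By compactness finitely many adapted charts suffice; as a cover has to be a
    sequence, they are enumerated with repetitions.\<close>
  obtain FF where FF: "finite FF" "FF \<subseteq> fst ` {c. adapted_chart F c}" "?S \<subseteq> \<Union> FF"
    using conjunct2[OF cmp[unfolded compactin_def], rule_format, of "fst ` {c. adapted_chart F c}"] o cov by auto
  then obtain C where C: "finite C" "C \<subseteq> {c. adapted_chart F c}" "FF = fst ` C"
    using finite_subset_image by metis
  have Cne: "C \<noteq> {}" using C FF ne by auto
  have rng: "range (from_nat_into C) = C"
    by (rule range_from_nat_into[OF Cne countable_finite[OF C(1)]])
  have "adapted_cover F (from_nat_into C)"
    unfolding adapted_cover_def
  proof (intro conjI allI)
    show "adapted_chart F (from_nat_into C j)" for j using from_nat_into[OF Cne, of j] C(2) by blast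
    show "?S \<subseteq> (\<Union>j. fst (from_nat_into C j))" using FF(3) C(3) rng by (metis image_image)
  qed
  then show ?thesis by blast
qed

text \<open>The zero vector fields on the given cover serve as 0-cochain. Reflexivity is what turns
  an equality of classes into a related pair.\<close>

lemma (in hopf_target) hyper_rel_refl:
  assumes L: "\<And>c q a b. c \<in> max_atlas M \<Longrightarrow> q \<in> fst c \<Longrightarrow> a < 2 \<Longrightarrow> b < 2 \<Longrightarrow> L c a b q = 0"
    and z: "(U, \<theta>, P) \<in> hyper_Z1 M L"
  shows "((U, \<theta>, P), (U, \<theta>, P)) \<in> hyper_rel M L"
  unfolding hyper_rel_def mem_Collect_eq prod.case
proof (intro conjI z exI allI)
  have oc: "open_cover M U" using z by (simp add: hyper_Z1_def)
  then show "open_cover M U" .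
  show "U j \<subseteq> U (id j)" "U j \<subseteq> U (id j)" for j by simp_all
  show "hol_vfield M (U j) (\<lambda>c i q. 0)" for j
    unfolding hol_vfield_def hol_fun_def by (auto intro: hol_on_const)
  show "vf_eq M (U j \<inter> U k) (vf_diff (\<theta> (id j) (id k)) (\<theta> (id j) (id k))) (vf_diff (\<lambda>c i q. 0) (\<lambda>c i q. 0))" for j k
    by (simp add: vf_eq_def vf_diff_def)
  show "bf_eq M (U j) (bf_diff (P (id j)) (P (id j))) (bf_scale (- 1) (schouten_bv M L (\<lambda>c i q. 0)))" for j
    by (auto simp: bf_eq_def bf_diff_def bf_scale_def schouten_bv_def mdim_2 lie_deriv_zero[OF L])
qed

lemma hopf_III_obstructed:
  assumes "1 \<le> p" "0 < cmod \<delta>" "cmod \<delta> < 1"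
  shows "poisson_obstructed TYPE('e) (hopf_quotient (hopf_III_map p \<delta>)) bf_zero"
  unfolding poisson_obstructed_def
proof
  interpret diagonal_hopf p \<delta> using assms by unfold_locales
  assume "poisson_unobstructed TYPE('e) hopfX bf_zero"
  then obtain F :: "'e poisson_fam" and \<iota> where fam: "poisson_analytic_family F" and 0: "(\<lambda>i. 0) \<in> base F"
    and iso: "biholomorphic_map hopfX (fibre F (\<lambda>i. 0)) \<iota>"
    and pm: "poisson_map hopfX bf_zero (fibre F (\<lambda>i. 0)) (fibre_biv F (\<lambda>i. 0)) \<iota>"
    and ks: "ks_isomorphism F"
    unfolding poisson_unobstructed_def poisson_iso_def by blast
  let ?M = "fibre F (\<lambda>i. 0)" and ?L = "fibre_biv F (\<lambda>i. 0)"
  have "\<forall>t\<in>base F. \<exists>L. induces_on_fibre F t L"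
    using fam unfolding poisson_analytic_family_def by blast
  then have "\<exists>L. induces_on_fibre F (\<lambda>i. 0) L" using 0 by blast
  then have ind: "induces_on_fibre F (\<lambda>i. 0) ?L"
    unfolding fibre_biv_def by (rule someI_ex)
  interpret hopf_target p \<delta> ?M \<iota>
    by unfold_locales (use ind iso in \<open>auto simp: induces_on_fibre_def poisson_manifold_def\<close>)
  \<comment> \<open>The identification is a Poisson map from the zero structure and reaches every
    point, so the structure on the central fibre is zero as well.\<close>
  have L0: "?L c a b q = 0" if c: "c \<in> max_atlas ?M" and q: "q \<in> fst c" and ab: "a < 2" "b < 2" for c q a b
  proof -
    have "q \<in> points ?M" using chart_dom_points[OF c] q by blast
    then obtain x where x: "x \<in> W" "\<phi> x = q" using \<phi>_surj by blast
    have ox: "ochart (nb x) \<in> max_atlas hopfX" "orb x \<in> fst (ochart (nb x))"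
      using ochart_max_atlas[OF small_nb] nb_self[OF x(1)] by (auto simp: ochart_def)
    have "?L c a b (\<iota> (orb x)) = (\<Sum>i<mdim hopfX. \<Sum>j<mdim hopfX. bf_zero (ochart (nb x)) i j (orb x)
        * pd (ochart (nb x)) i (\<lambda>q. snd c (\<iota> q) a) (orb x) * pd (ochart (nb x)) j (\<lambda>q. snd c (\<iota> q) b) (orb x))"
      using pm ox c q x(2) ab unfolding poisson_map_def mdim_2 \<phi>_def by blast
    then show ?thesis using x(2) by (simp add: bf_zero_def \<phi>_def)
  qed
  let ?z = "(Uc, \<theta>c, \<lambda>j. \<pi>c)"
  have z: "?z \<in> hyper_Z1 ?M ?L" by (rule cocycle_Z1[OF L0])
  have "hyper_rel ?M ?L `` {?z} \<in> hyper_H1 ?M ?L"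
    unfolding hyper_H1_def by (rule quotientI[OF z])
  moreover have "ks_map F ` cvec (pardim F) = hyper_H1 ?M ?L"
    using ks unfolding ks_isomorphism_def Let_def bij_betw_def by blast
  ultimately obtain v where v: "v \<in> cvec (pardim F)" "hyper_rel ?M ?L `` {?z} = ks_map F v" by blast
  \<comment> \<open>The cocycle lies in its own class, hence in the equal class of the
    Kodaira-Spencer cocycle of \<open>v\<close>.\<close>
  have "?z \<in> hyper_rel ?M ?L `` {?z}" using hyper_rel_refl[OF L0 z] by simp
  then have rel: "(ks_cocycle F (SOME c. adapted_cover F c) v, ?z) \<in> hyper_rel ?M ?L"
    unfolding v(2) ks_map_def hyper_class_def by simp
  have "(\<lambda>i. 0)(0 := 1) \<in> W" by (auto simp: W_iff cvec_def)
  then have "points ?M \<noteq> {}" using \<phi>_points by blast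
  then have "fibre_set F (\<lambda>i. 0) \<noteq> {}" by (auto simp: fibre_def)
  then have "adapted_cover F (SOME c. adapted_cover F c)"
    by (rule someI_ex[OF adapted_cover_exists[OF fam 0]])
  then have cs: "adapted_chart F ((SOME c. adapted_cover F c) j)" for j
    by (simp add: adapted_cover_def)
  interpret hopf_family p \<delta> F \<iota> v
    by unfold_locales (use fam v ind L0 in auto)
  show False by (rule no_ks_preimage[OF cs rel])
qed

theorem theorem4p6p1:
  fixes X :: "(nat \<Rightarrow> complex) set cmanifold"
  assumes "hopf_type_IV X \<or> hopf_type_III X"
  shows "poisson_obstructed TYPE('e) X bf_zero"
proof -
  have eq: "hopf_IV_map \<alpha> = hopf_III_map 1 \<alpha>" for \<alpha>
    by (simp add: fun_eq_iff hopf_IV_map_def hopf_III_map_def)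
  from assms have "\<exists>p \<delta>. 1 \<le> p \<and> 0 < cmod \<delta> \<and> cmod \<delta> < 1 \<and> X = hopf_quotient (hopf_III_map p \<delta>)"
  proof
    assume "hopf_type_IV X"
    then show ?thesis unfolding hopf_type_IV_def eq by (intro exI[of _ "1::nat"]) simp
  next
    assume "hopf_type_III X"
    then obtain p \<delta> where "2 \<le> p" "0 < cmod \<delta>" "cmod \<delta> < 1" "X = hopf_quotient (hopf_III_map p \<delta>)"
      unfolding hopf_type_III_def by blast
    then show ?thesis by (intro exI[of _ p] exI[of _ \<delta>]) auto
  qed
  then show ?thesis using hopf_III_obstructed by blast
qed

end
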